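(* Let $K$ be an infinite field contained in a local field $L$, and let $\overline{L}$ be an algebraic closure of $L$. Let $\mathbf{V}=\mathbf{A}^m$ and let $Q\colon \mathbf{V}(K)=K^m\to K$ be a quadratic form such that the special orthogonal group $\mathrm{SO}_m=\mathrm{SO}(\mathbf{V},Q)$ is a connected quasisimple algebraic group acting absolutely irreducibly on $\mathbf{V}$. Let $r\ge1$ and let $w\in\mathrm{GO}(\mathbf{V}(\overline{L}),Q)\ast\mathbf{F}_r$ be a (reduced) word of length $l\ge2$ none of whose critical constants is Tomanov-small with respect to $\mathbf{G}=\mathrm{SO}_m$, i.e. $\mathbf{\Lambda}(\overline{L})\cap I(w)=\varnothing$. Then $\dim\bigl(w(\mathrm{SO}(\mathbf{V}(K),Q)^r)\bigr)\ge m-1$.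
   Context: $\mathrm{GO}(\mathbf{V}(\overline{L}),Q)$ is the full isometry group of $Q$ (linear maps $g$ with $Q(v.g)=Q(v)$ for all $v$). A connected non-abelian linear algebraic group is quasisimple if, over an algebraically closed field, all its proper Zariski closed connected normal subgroups are trivial. Words: $\mathbf{F}_r=\langle x_1,\dots,x_r\rangle$ is the free group of rank $r$. A word with constants in a group $C$ is $w=c_0x_{i(1)}^{\varepsilon(1)}c_1\cdots c_{l-1}x_{i(l)}^{\varepsilon(l)}c_l\in C\ast\mathbf{F}_r$ with $c_j\in C$, $\varepsilon(j)\in\{\pm1\}$, taken reduced: if $i(j)=i(j+1)$ and $\varepsilon(j)=-\varepsilon(j+1)$ then $c_j\ne 1$. Its length is $l$. An index $j\in\{1,\dots,l-1\}$ is critical if $i(j)=i(j+1)$ and $\varepsilon(j)=-\varepsilon(j+1)$; then $c_j$ is a critical constant, and $I(w)$ denotes the set of critical constants. For a subgroup $G\le C$, $w(G^r)\subseteq C$ is the image of the word map $(g_1,\dots,g_r)\mapsto w(g_1,\dots,g_r)$. Dimension: for a subset $T$ of the $m\times m$ matrices $\mathbf{M}_m(\overline{L})$, $\dim(T)$ is the Krull dimension of its Zariski closure in $\mathbf{M}_m(\overline{L})$. Tomanov-small constants: for $\mathbf{G}=\mathrm{SO}_m\le\mathrm{GL}(\mathbf{V})$, let $\mathbf{T}$ be a maximal torus of $\mathbf{G}$, and let $e_1,\dots,e_m$ be a basis of weight vectors of $\mathbf{V}(\overline{L})$ for $\mathbf{T}$ with $e_1$ a highest weight vector and $e_m$ a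 lowest weight vector; $e_1^\ast,\dots,e_m^\ast$ is the dual basis. Groups act from the right, and $c^g=g^{-1}cg$. Then $\mathbf{\Lambda}(\overline{L})=\{c\in\mathrm{GL}(\mathbf{V}(\overline{L})) : (e_1.c^g).e_m^\ast=0\text{ for all }g\in\mathbf{G}(\overline{L})\}$, where $v.e_m^\ast$ is the value of the functional $e_m^\ast$ at $v$. *)

theory Defs
  imports
    "HOL-Analysis.Analysis"
    "HOL-Library.Extended_Nat"
    "HOL-Computational_Algebra.Computational_Algebra"
    "HOL-Algebra.Solvable_Groups"
    "HOL-Algebra.Algebraic_Closure_Type"
begin

section \<open>Fields\<close>

text \<open>
  All fields occurring below are subfields of one algebraically closed type \<open>'a\<close>. A local field is a
  non-discrete locally compact Hausdorff topological field; the topology is carried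
  by the subfield \<open>L\<close>, not by the type.
\<close>

definition local_field :: "'a::field set \<Rightarrow> 'a topology \<Rightarrow> bool" where
  "local_field L \<tau> \<longleftrightarrow>
     subfield L ring_of_type_algebra \<and>
     topspace \<tau> = L \<and>
     continuous_map (prod_topology \<tau> \<tau>) \<tau> (\<lambda>(x, y). x + y) \<and>
     continuous_map \<tau> \<tau> uminus \<and>
     continuous_map (prod_topology \<tau> \<tau>) \<tau> (\<lambda>(x, y). x * y) \<and>
     continuous_map (subtopology \<tau> (L - {0})) \<tau> inverse \<and>
     Hausdorff_space \<tau> \<and> locally_compact_space \<tau> \<and> \<tau> \<noteq> discrete_topology L"

text \<open>
  For an algebraically closed type \<open>'a\<close>, this says that \<open>'a\<close> is an algebraic closure of \<open>L\<close>.
\<close>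

definition algebraic_over :: "'a::field set \<Rightarrow> bool" where
  "algebraic_over L \<longleftrightarrow> (\<forall>x. \<exists>p. p \<noteq> 0 \<and> (\<forall>i. poly.coeff p i \<in> L) \<and> poly p x = 0)"

section \<open>The Zariski topology on square matrices\<close>

inductive_set matrix_poly_funs :: "('a::field^'n^'n \<Rightarrow> 'a) set" where
  const: "(\<lambda>_. c) \<in> matrix_poly_funs"
| entry: "(\<lambda>A. A $ i $ j) \<in> matrix_poly_funs"
| add: "f \<in> matrix_poly_funs \<Longrightarrow> g \<in> matrix_poly_funs \<Longrightarrow> (\<lambda>A. f A + g A) \<in> matrix_poly_funs"
| mult: "f \<in> matrix_poly_funs \<Longrightarrow> g \<in> matrix_poly_funs \<Longrightarrow> (\<lambda>A. f A * g A) \<in> matrix_poly_funs"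

definition zero_locus :: "('a::field^'n^'n \<Rightarrow> 'a) set \<Rightarrow> ('a^'n^'n) set" where
  "zero_locus F = {A. \<forall>f\<in>F. f A = 0}"

definition zariski :: "('a::field^'n^'n) topology" where
  "zariski = topology (\<lambda>U. \<exists>F \<subseteq> matrix_poly_funs. - U = zero_locus F)"

lemma openin_zariski:
  "openin zariski U \<longleftrightarrow> (\<exists>F \<subseteq> matrix_poly_funs. - U = zero_locus F)"
proof -
  have "istopology (\<lambda>U::('a^'n^'n) set. \<exists>F \<subseteq> matrix_poly_funs. - U = zero_locus F)"
    unfolding istopology_def
  proof (intro conjI allI impI)
    fix S T :: "('a^'n^'n) set"
    assume "\<exists>F \<subseteq> matrix_poly_funs. - S = zero_locus F"
      and "\<exists>F \<subseteq> matrix_poly_funs. - T = zero_locus F"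
    then obtain F G where F: "F \<subseteq> matrix_poly_funs" "- S = zero_locus F"
      and G: "G \<subseteq> matrix_poly_funs" "- T = zero_locus G" by blast
    let ?H = "(\<lambda>(f, g) A. f A * g A) ` (F \<times> G)"
    have "?H \<subseteq> matrix_poly_funs"
      using F(1) G(1) by (auto intro!: matrix_poly_funs.mult)
    moreover have "zero_locus ?H = zero_locus F \<union> zero_locus G"
    proof
      show "zero_locus F \<union> zero_locus G \<subseteq> zero_locus ?H"
      proof
        fix A assume A: "A \<in> zero_locus F \<union> zero_locus G"
        have "h A = 0" if h: "h \<in> ?H" for h
        proof -
          obtain f g where "h = (\<lambda>A. f A * g A)" "f \<in> F" "g \<in> G"
            using h by auto
          then show ?thesis
            using A unfolding zero_locus_def by (cases "f A = 0") auto
        qed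
        then show "A \<in> zero_locus ?H"
          unfolding zero_locus_def by blast
      qed
      show "zero_locus ?H \<subseteq> zero_locus F \<union> zero_locus G"
      proof
        fix A assume "A \<in> zero_locus ?H"
        then have A: "\<forall>h\<in>?H. h A = 0"
          unfolding zero_locus_def by (rule CollectD)
        have "f A * g A = 0" if "f \<in> F" "g \<in> G" for f g
        proof -
          have "(\<lambda>A. f A * g A) \<in> ?H"
            using that by (intro image_eqI[of _ _ "(f, g)"]) auto
          from bspec[OF A this] show ?thesis .
        qed
        then show "A \<in> zero_locus F \<union> zero_locus G"
          unfolding zero_locus_def mult_eq_0_iff by blast
      qed
    qed
    ultimately show "\<exists>H \<subseteq> matrix_poly_funs. - (S \<inter> T) = zero_locus H"
      using F(2) G(2) by (intro exI[of _ ?H]) (auto simp: Compl_Int)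
  next
    fix \<U> :: "('a^'n^'n) set set"
    assume "\<forall>U\<in>\<U>. \<exists>F \<subseteq> matrix_poly_funs. - U = zero_locus F"
    then obtain F where F: "\<And>U. U \<in> \<U> \<Longrightarrow> F U \<subseteq> matrix_poly_funs \<and> - U = zero_locus (F U)"
      by metis
    have "- \<Union>\<U> = (\<Inter>U\<in>\<U>. zero_locus (F U))"
      using F by auto
    also have "\<dots> = zero_locus (\<Union>U\<in>\<U>. F U)"
      by (auto simp: zero_locus_def)
    finally show "\<exists>H \<subseteq> matrix_poly_funs. - \<Union>\<U> = zero_locus H"
      using F by (intro exI[of _ "\<Union>U\<in>\<U>. F U"]) auto
  qed
  from fun_cong[OF topology_inverse'[OF this]] show ?thesis
    unfolding zariski_def .
qed

lemma topspace_zariski [simp]: "topspace zariski = (UNIV :: ('a::field^'n^'n) set)"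
proof -
  have "openin zariski (UNIV :: ('a^'n^'n) set)"
    unfolding openin_zariski
    by (rule exI[of _ "{\<lambda>_. 1}"]) (auto simp: zero_locus_def intro: matrix_poly_funs.const)
  then show ?thesis
    using openin_subset by blast
qed

lemma closedin_zariski:
  "closedin zariski S \<longleftrightarrow> (\<exists>F \<subseteq> matrix_poly_funs. S = zero_locus F)"
  by (simp add: closedin_def openin_zariski Compl_eq_Diff_UNIV[symmetric])

definition irreducible_space :: "'b topology \<Rightarrow> bool" where
  "irreducible_space Y \<longleftrightarrow> topspace Y \<noteq> {} \<and>
     (\<forall>S T. closedin Y S \<longrightarrow> closedin Y T \<longrightarrow> topspace Y = S \<union> T \<longrightarrow> S = topspace Y \<or> T = topspace Y)"

text \<open>The Krull dimension of the empty space is \<open>0\<close> here.\<close>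

definition krull_dim :: "'b topology \<Rightarrow> enat" where
  "krull_dim Y = Sup {enat k |k. \<exists>Z :: nat \<Rightarrow> 'b set.
     (\<forall>i\<le>k. closedin Y (Z i) \<and> irreducible_space (subtopology Y (Z i))) \<and>
     (\<forall>i<k. Z i \<subset> Z (Suc i))}"

definition zariski_dim :: "('a::field^'n^'n) set \<Rightarrow> enat" where
  "zariski_dim T = krull_dim (subtopology zariski (Abstract_Topology.closure_of zariski T))"

section \<open>Linear algebraic groups\<close>

text \<open>
  An algebraic group is identified with its group of points over the algebraically closed field \<open>'a\<close>.
  Matrices act on row vectors from the right.
\<close>

definition GL :: "('a::field^'n^'n) monoid" where
  "GL = \<lparr>carrier = {g. invertible g}, monoid.mult = (**), one = mat 1\<rparr>"

definition linear_algebraic_group :: "('a::field^'n^'n) set \<Rightarrow> bool" where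
  "linear_algebraic_group G \<longleftrightarrow> subgroup G GL \<and> closedin (subtopology zariski (carrier GL)) G"

definition quasisimple :: "('a::field^'n^'n) set \<Rightarrow> bool" where
  "quasisimple G \<longleftrightarrow> linear_algebraic_group G \<and> connectedin zariski G \<and>
     \<not> comm_group (GL\<lparr>carrier := G\<rparr>) \<and>
     (\<forall>N. N \<lhd> GL\<lparr>carrier := G\<rparr> \<and> closedin (subtopology zariski G) N \<and> connectedin zariski N \<and> N \<noteq> G
        \<longrightarrow> N = {mat 1})"

text \<open>Over the algebraically closed field \<open>'a\<close>, irreducibility is absolute irreducibility.\<close>

definition acts_irreducibly :: "('a::field^'n^'n) set \<Rightarrow> bool" where
  "acts_irreducibly G \<longleftrightarrow>
     (\<forall>W. vec.subspace W \<and> (\<forall>g\<in>G. \<forall>v\<in>W. v v* g \<in> W) \<longrightarrow> W = {0} \<or> W = UNIV)"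

definition diagonalizable_group :: "('a::field^'n^'n) set \<Rightarrow> bool" where
  "diagonalizable_group T \<longleftrightarrow> (\<exists>P :: 'a^'n^'n. invertible P \<and>
     (\<forall>t\<in>T. \<forall>i j. i \<noteq> j \<longrightarrow> (P ** t ** matrix_inv P) $ i $ j = 0))"

definition torus :: "('a::field^'n^'n) set \<Rightarrow> bool" where
  "torus T \<longleftrightarrow> linear_algebraic_group T \<and> connectedin zariski T \<and> diagonalizable_group T"

definition maximal_torus :: "('a::field^'n^'n) set \<Rightarrow> ('a^'n^'n) set \<Rightarrow> bool" where
  "maximal_torus G T \<longleftrightarrow> torus T \<and> T \<subseteq> G \<and> (\<forall>S. torus S \<and> S \<subseteq> G \<and> T \<subseteq> S \<longrightarrow> S = T)"

definition connected_solvable :: "('a::field^'n^'n) set \<Rightarrow> bool" where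
  "connected_solvable B \<longleftrightarrow>
     linear_algebraic_group B \<and> connectedin zariski B \<and> solvable (GL\<lparr>carrier := B\<rparr>)"

definition borel_subgroup :: "('a::field^'n^'n) set \<Rightarrow> ('a^'n^'n) set \<Rightarrow> bool" where
  "borel_subgroup G B \<longleftrightarrow> connected_solvable B \<and> B \<subseteq> G \<and>
     (\<forall>S. connected_solvable S \<and> S \<subseteq> G \<and> B \<subseteq> S \<longrightarrow> S = B)"

text \<open>
  A common eigenvector. For a torus \<open>T\<close> this is a weight vector. A choice of positive roots of \<open>G\<close> with
  respect to \<open>T\<close> is a choice of a Borel subgroup \<open>B\<close> containing \<open>T\<close>. In an irreducible representation
  the highest weight vectors are the common eigenvectors of \<open>B\<close>, and the lowest weight vectors are
  those of the opposite Borel subgroup, determined by \<open>B \<inter> B' = T\<close>.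
\<close>

definition common_eigenvector :: "('a::field^'n^'n) set \<Rightarrow> 'a^'n \<Rightarrow> bool" where
  "common_eigenvector H v \<longleftrightarrow> v \<noteq> 0 \<and> (\<forall>h\<in>H. \<exists>c. v v* h = c *s v)"

definition opposite_borels ::
  "('a::field^'n^'n) set \<Rightarrow> ('a^'n^'n) set \<Rightarrow> ('a^'n^'n) set \<Rightarrow> ('a^'n^'n) set \<Rightarrow> bool" where
  "opposite_borels G T B B' \<longleftrightarrow> borel_subgroup G B \<and> borel_subgroup G B' \<and> B \<inter> B' = T"

text \<open>The basis is \<open>e 1, \<dots>, e m\<close> with \<open>m = CARD('n)\<close>.\<close>

definition weight_basis :: "('a::field^'n^'n) set \<Rightarrow> ('a^'n^'n) set \<Rightarrow> (nat \<Rightarrow> 'a^'n) \<Rightarrow> bool" where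
  "weight_basis G T e \<longleftrightarrow>
     inj_on e {1..CARD('n)} \<and> vec.independent (e ` {1..CARD('n)}) \<and> vec.span (e ` {1..CARD('n)}) = UNIV \<and>
     (\<forall>i\<in>{1..CARD('n)}. common_eigenvector T (e i)) \<and>
     (\<exists>B B'. opposite_borels G T B B' \<and>
        common_eigenvector B (e 1) \<and> common_eigenvector B' (e CARD('n)))"

definition dual_basis :: "(nat \<Rightarrow> 'a::field^'n) \<Rightarrow> nat \<Rightarrow> 'a^'n \<Rightarrow> 'a" where
  "dual_basis e k v = vec.representation (e ` {1..CARD('n)}) v (e k)"

definition tomanov_small :: "('a::field^'n^'n) set \<Rightarrow> (nat \<Rightarrow> 'a^'n) \<Rightarrow> ('a^'n^'n) set" where
  "tomanov_small G e = {c \<in> carrier GL.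
     \<forall>g\<in>G. dual_basis e CARD('n) (e 1 v* (matrix_inv g ** c ** g)) = 0}"

section \<open>Quadratic forms\<close>

text \<open>
  A form over \<open>K\<close> is represented by its extension to the vector space over \<open>'a\<close>, given by the same
  coefficients.
\<close>

definition quadratic_form_over :: "'a::field set \<Rightarrow> ('a^'n \<Rightarrow> 'a) \<Rightarrow> bool" where
  "quadratic_form_over K Q \<longleftrightarrow> (\<exists>a. (\<forall>i j. a i j \<in> K) \<and>
     (\<forall>v. Q v = (\<Sum>i\<in>UNIV. \<Sum>j\<in>UNIV. a i j * v $ i * v $ j)))"

definition GO :: "('a::field^'n \<Rightarrow> 'a) \<Rightarrow> ('a^'n^'n) set" where
  "GO Q = {g \<in> carrier GL. \<forall>v. Q (v v* g) = Q v}"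

text \<open>
  In characteristic 2 the determinant is trivial on \<open>GO Q\<close> for nondegenerate \<open>Q\<close>, and in even dimension its role is played
  by the Dickson invariant, the parity of the rank of \<open>g - 1\<close>.
\<close>

definition SO :: "('a::field^'n \<Rightarrow> 'a) \<Rightarrow> ('a^'n^'n) set" where
  "SO Q = {g \<in> GO Q. if CHAR('a) = 2 \<and> even CARD('n) then even (rank (g - mat 1)) else det g = 1}"

definition rational_points :: "'a set \<Rightarrow> ('a^'n^'n) set \<Rightarrow> ('a^'n^'n) set" where
  "rational_points K G = {g \<in> G. \<forall>i j. g $ i $ j \<in> K}"

section \<open>Words with constants\<close>

text \<open>
  The word with constants \<open>c\<^sub>0, \<dots>, c\<^sub>l\<close>, variables \<open>i(1), \<dots>, i(l)\<close> and exponents \<open>\<epsilon>(1), \<dots>, \<epsilon>(l)\<close> is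
  the pair of \<open>c\<^sub>0\<close> and the list of the triples \<open>(i(j), \<epsilon>(j), c\<^sub>j)\<close>, with \<open>True\<close> for the exponent \<open>1\<close> and
  \<open>False\<close> for \<open>-1\<close>. The variables
  are numbered from \<open>0\<close> to \<open>r - 1\<close>. Reduced words represent the elements of the free product uniquely.
\<close>

type_synonym 'c cword = "'c \<times> (nat \<times> bool \<times> 'c) list"

definition words :: "'c set \<Rightarrow> nat \<Rightarrow> 'c cword set" where
  "words C r = {(c\<^sub>0, ls). c\<^sub>0 \<in> C \<and> (\<forall>(i, \<epsilon>, c) \<in> set ls. i < r \<and> c \<in> C)}"

definition word_length :: "'c cword \<Rightarrow> nat" where
  "word_length w = length (snd w)"

text \<open>List positions start at \<open>0\<close>, so position \<open>j\<close> holds the letter \<open>j + 1\<close> and the constant \<open>c\<^bsub>j+1\<^esub>\<close>.\<close>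

definition critical_constants :: "'c cword \<Rightarrow> 'c set" where
  "critical_constants w = {c. \<exists>j i \<epsilon> c'. Suc j < word_length w \<and>
     snd w ! j = (i, \<epsilon>, c) \<and> snd w ! Suc j = (i, \<not> \<epsilon>, c')}"

definition reduced_word :: "('a::field^'n^'n) cword \<Rightarrow> bool" where
  "reduced_word w \<longleftrightarrow> mat 1 \<notin> critical_constants w"

fun word_value :: "('a::field^'n^'n) cword \<Rightarrow> (nat \<Rightarrow> 'a^'n^'n) \<Rightarrow> 'a^'n^'n" where
  "word_value (c\<^sub>0, []) g = c\<^sub>0"
| "word_value (c\<^sub>0, (i, \<epsilon>, c) # ls) g =
     c\<^sub>0 ** (if \<epsilon> then g i else matrix_inv (g i)) ** word_value (c, ls) g"

definition word_image :: "('a::field^'n^'n) cword \<Rightarrow> nat \<Rightarrow> ('a^'n^'n) set \<Rightarrow> ('a^'n^'n) set" where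
  "word_image w r G = {word_value w g |g. \<forall>i<r. g i \<in> G}"

end

theory Submission
  imports Defs
begin

text \<open>
  The image of the word map is not studied through its differential but through a degeneration. Let
  \<open>u, v\<close> be isotropic vectors with \<open>B(u, v) = 1\<close>, and let the letter \<open>\<tau>\<^sub>s(u, v)\<close> scale \<open>u\<close> by \<open>s\<close>,
  \<open>v\<close> by \<open>1/s\<close>, and fix the orthogonal space of \<open>u\<close> and \<open>v\<close>. As \<open>s\<close> tends to infinity,
  \<open>\<tau>\<^sub>s(u, v)/s\<close> tends to the rank one map \<open>x \<mapsto> B(x, v) u\<close>, and its inverse to \<open>x \<mapsto> B(x, u) v\<close>.
  Substituting such letters for the variables, the word divided by \<open>s\<^sup>l\<close> therefore tends to a map of rank
  at most one. This limit is a product of the pairings at the junctions, which at a critical constant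
  \<open>c\<close> are of the form \<open>B(u c, u)\<close>. That \<open>c\<close> is not Tomanov-small means that \<open>B(u c, u)\<close> is nonzero for
  some isotropic \<open>u\<close>, so for generic letters the limit has rank one, and its image is spanned by the
  image of an isotropic vector. Letting this vector vary gives \<open>m - 2\<close> parameters, and \<open>s\<close> one more: a
  polynomial relation between the corresponding \<open>m - 1\<close> functions would survive in the limit.

  Letters are products of reflections, so they lie in the Zariski closure of the \<open>K\<close>-points. For the
  zero form, the group is the special linear group, and pairs of flags (a vector and a hyperplane
  containing it) play the role of pairs of isotropic vectors.

  The highest weight vector \<open>e 1\<close> is defined by a Borel subgroup. By the Lie-Kolchin theorem it is
  isotropic, and by maximality the Borel subgroup contains all letters \<open>\<tau>\<^sub>s(e 1, v)\<close>. Comparing with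
  the opposite Borel subgroup, the other weight vectors except \<open>e m\<close> are orthogonal to \<open>e 1\<close>, hence
  the dual basis functional of \<open>e m\<close> is proportional to \<open>B(-, e 1)\<close>.
\<close>

unbundle no Formal_Power_Series.fps_syntax
unbundle no Formal_Laurent_Series.fps_syntax
hide_const (open) Polynomials.degree up_ring.monom up_ring.coeff

section \<open>Algebras of functions\<close>

text \<open>The form may have no isotropic vectors over \<open>K\<close>, so the letters are in
  general not \<open>K\<close>-rational, and isotropic vectors do not fill an affine space in which
  points over \<open>K\<close> would be dense. Pairs of anisotropic vectors fill an open part of an
  affine space, and there it is enough that \<open>K\<close> is infinite. This is why letters are
  expressed by reflections. Each letter is moreover written as a square, by taking a square root of
  its parameter: the square of a product of two reflections has determinant 1, and the product
  itself passes the rank condition that replaces the determinant in characteristic 2 and even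
  dimension.

  The zero form cannot be avoided: in dimension at least 2 the radical of the polar form is an
  invariant subspace, so that a form with irreducible group is nondegenerate or zero. Flags treat
  both cases at once; in the orthogonal case the functional of a flag is determined by its isotropic
  vector.

  Dimension is bounded by an explicit chain of irreducible closed sets. Strictness of the chain
  rests on counting monomials against points of a grid, so no general theory of dimension
  enters.\<close>

definition pair :: "'a::field^'n \<Rightarrow> 'a^'n \<Rightarrow> 'a" where
  "pair v q = (\<Sum>i\<in>UNIV. v $ i * q $ i)"

definition outer :: "'a::field^'n \<Rightarrow> 'a^'n \<Rightarrow> 'a^'n^'n" where
  "outer q p = (\<chi> i j. q $ i * p $ j)"

definition smat :: "'a::field \<Rightarrow> 'a^'n^'n \<Rightarrow> 'a^'n^'n" where
  "smat c A = (\<chi> i j. c * A $ i $ j)"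

lemma pair_add_left: "pair (u + v) q = pair u q + pair v q"
  and pair_diff_left: "pair (u - v) q = pair u q - pair v q"
  and pair_scale_left: "pair (c *s v) q = c * pair v q"
  and pair_add_right: "pair v (p + q) = pair v p + pair v q"
  and pair_diff_right: "pair v (p - q) = pair v p - pair v q"
  and pair_scale_right: "pair v (c *s q) = c * pair v q"
  and pair_0_left: "pair 0 q = 0"
  and pair_0_right: "pair v 0 = 0"
  by (simp_all add: pair_def algebra_simps sum.distrib sum_subtractf sum_distrib_left)

lemmas pair_simps = pair_add_left pair_diff_left pair_scale_left pair_add_right pair_diff_right
  pair_scale_right pair_0_left pair_0_right

lemma pair_minus: "pair (- v) q = - pair v q" "pair v (- q) = - pair v q"
  by (simp_all add: pair_def sum_negf)

lemma pair_commute: "pair v q = pair q v"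
  by (simp add: pair_def mult.commute)

lemma pair_vector_matrix: "pair (v v* A) q = pair v (A *v q)"
  unfolding pair_def vector_matrix_mult_def matrix_vector_mult_def
  by (simp add: sum_distrib_left sum_distrib_right mult.assoc) (rule sum.swap)

lemma vector_outer: "v v* outer q p = pair v q *s p"
  by (simp add: outer_def vector_matrix_mult_def pair_def vec_eq_iff sum_distrib_right mult.assoc)

lemma vector_smat: "v v* smat c A = c *s (v v* A)"
  by (simp add: smat_def vector_matrix_mult_def vec_eq_iff sum_distrib_left mult.left_commute)

lemma smat_mult: "smat c A ** B = smat c (A ** B)" "A ** smat c B = smat c (A ** B)"
  by (simp_all add: smat_def matrix_matrix_mult_def vec_eq_iff sum_distrib_left mult.assoc mult.left_commute)

lemma smat_smat: "smat c (smat d A) = smat (c * d) A"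
  by (simp add: smat_def vec_eq_iff mult.assoc)

lemma smat_1 [simp]: "smat 1 A = A"
  by (simp add: smat_def)

lemma pair_axis [simp]: "pair v (axis i 1) = v $ i"
  by (simp add: pair_def axis_def if_distrib cong: if_cong)

lemma pair_eqI: "(\<And>q. pair u q = pair v q) \<Longrightarrow> u = v"
  by (metis pair_axis vec_eq_iff)

lemma vector_matrix_eqI:
  fixes A B :: "'a::field^'n^'m"
  assumes "\<And>v. v v* A = v v* B" shows "A = B"
proof -
  have "transpose A = transpose B"
    using assms unfolding matrix_eq[of "transpose A"] by simp
  then show ?thesis by simp
qed

text \<open>Its instances are polynomial functions of matrix entries, of one variable and of a
  family of variables. Whether a matrix built from flags and letters depends polynomially on its
  data is settled once for all three.\<close>

locale fun_alg =
  fixes R :: "('x \<Rightarrow> 'a::field) set"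
  assumes const_fun: "(\<lambda>_. c) \<in> R"
    and add_fun: "f \<in> R \<Longrightarrow> g \<in> R \<Longrightarrow> (\<lambda>x. f x + g x) \<in> R"
    and mult_fun: "f \<in> R \<Longrightarrow> g \<in> R \<Longrightarrow> (\<lambda>x. f x * g x) \<in> R"
begin


lemma uminus: "f \<in> R \<Longrightarrow> (\<lambda>x. - f x) \<in> R"
  using mult_fun[OF const_fun[of "-1"]] by simp

lemma diff: "f \<in> R \<Longrightarrow> g \<in> R \<Longrightarrow> (\<lambda>x. f x - g x) \<in> R"
  using add_fun[OF _ uminus] by simp

lemma divide_const: "f \<in> R \<Longrightarrow> (\<lambda>x. f x / c) \<in> R"
  using mult_fun[OF const_fun[of "inverse c"]] by (simp add: field_simps)

lemma sum: "(\<And>i. i \<in> I \<Longrightarrow> f i \<in> R) \<Longrightarrow> (\<lambda>x. \<Sum>i\<in>I. f i x) \<in> R"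
  by (induction I rule: infinite_finite_induct) (auto intro: const_fun add_fun)

lemma prod: "(\<And>i. i \<in> I \<Longrightarrow> f i \<in> R) \<Longrightarrow> (\<lambda>x. \<Prod>i\<in>I. f i x) \<in> R"
  by (induction I rule: infinite_finite_induct) (auto intro: const_fun mult_fun)

lemma power: "f \<in> R \<Longrightarrow> (\<lambda>x. f x ^ n) \<in> R"
  by (induction n) (auto intro: const_fun mult_fun)

lemma pair: "(\<And>i. (\<lambda>x. u x $ i) \<in> R) \<Longrightarrow> (\<And>i. (\<lambda>x. v x $ i) \<in> R) \<Longrightarrow> (\<lambda>x. pair (u x) (v x)) \<in> R"
  unfolding pair_def by (intro sum mult_fun)

lemma vector_matrix_mult:
  "(\<And>i. (\<lambda>x. u x $ i) \<in> R) \<Longrightarrow> (\<And>i j. (\<lambda>x. M x $ i $ j) \<in> R) \<Longrightarrow> (\<lambda>x. (u x v* M x) $ i) \<in> R"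
  unfolding vector_matrix_mult_def by (simp, intro sum mult_fun)

lemma matrix_mult:
  "(\<And>i j. (\<lambda>x. M x $ i $ j) \<in> R) \<Longrightarrow> (\<And>i j. (\<lambda>x. N x $ i $ j) \<in> R) \<Longrightarrow> (\<lambda>x. (M x ** N x) $ i $ j) \<in> R"
  unfolding matrix_matrix_mult_def by (simp, intro sum mult_fun)

lemma outer:
  "(\<And>i. (\<lambda>x. u x $ i) \<in> R) \<Longrightarrow> (\<And>i. (\<lambda>x. v x $ i) \<in> R) \<Longrightarrow> (\<lambda>x. outer (u x) (v x) $ i $ j) \<in> R"
  unfolding outer_def by (simp, intro mult_fun)

lemma smat:
  "c \<in> R \<Longrightarrow> (\<And>i j. (\<lambda>x. M x $ i $ j) \<in> R) \<Longrightarrow> (\<lambda>x. smat (c x) (M x) $ i $ j) \<in> R"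
  unfolding smat_def by (simp, intro mult_fun)

lemma det: "(\<And>i j. (\<lambda>x. M x $ i $ j) \<in> R) \<Longrightarrow> (\<lambda>x. det (M x)) \<in> R"
  unfolding det_def by (intro sum mult_fun const_fun prod)

lemma matrix_poly_comp:
  assumes "f \<in> matrix_poly_funs" "\<And>i j. (\<lambda>x. M x $ i $ j) \<in> R"
  shows "(\<lambda>x. f (M x)) \<in> R"
  using assms by induction (auto intro: const_fun add_fun mult_fun)

text \<open>Letters have denominators. Clearing them costs a power of the common denominator
  \<open>D\<close>, with an exponent that absorbs the degree of \<open>f\<close>; the numerator lies
  in the algebra, where zeros can be counted and density arguments apply.\<close>

lemma matrix_poly_comp_fraction:
  assumes "f \<in> matrix_poly_funs" "\<And>i j. (\<lambda>x. N x $ i $ j) \<in> R" "D \<in> R"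
  shows "\<exists>d. \<exists>h\<in>R. \<forall>x. D x \<noteq> 0 \<longrightarrow> f (\<chi> i j. N x $ i $ j / D x) = h x / D x ^ d"
  using assms
proof (induction f)
  case (const c)
  show ?case by (rule exI[of _ 0], rule bexI[OF _ const_fun[of c]]) auto
next
  case (entry i j)
  show ?case by (rule exI[of _ 1], rule bexI[OF _ entry(1)[of i j]]) auto
next
  case (add f g)
  then obtain d e h k where *: "h \<in> R" "k \<in> R" "\<forall>x. D x \<noteq> 0 \<longrightarrow> f (\<chi> i j. N x $ i $ j / D x) = h x / D x ^ d"
     "\<forall>x. D x \<noteq> 0 \<longrightarrow> g (\<chi> i j. N x $ i $ j / D x) = k x / D x ^ e" by blast
  have "(\<lambda>x. h x * D x ^ e + k x * D x ^ d) \<in> R"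
    by (rule add_fun; rule mult_fun; (rule power)?; rule *(1,2) add.prems(2))
  moreover have "\<forall>x. D x \<noteq> 0 \<longrightarrow> f (\<chi> i j. N x $ i $ j / D x) + g (\<chi> i j. N x $ i $ j / D x)
      = (h x * D x ^ e + k x * D x ^ d) / D x ^ (d + e)"
    unfolding power_add using *(3,4) by (simp add: add_frac_eq)
  ultimately show ?case by (intro exI[of _ "d + e"]) (rule bexI)
next
  case (mult f g)
  then obtain d e h k where *: "h \<in> R" "k \<in> R" "\<forall>x. D x \<noteq> 0 \<longrightarrow> f (\<chi> i j. N x $ i $ j / D x) = h x / D x ^ d"
     "\<forall>x. D x \<noteq> 0 \<longrightarrow> g (\<chi> i j. N x $ i $ j / D x) = k x / D x ^ e" by blast
  have "(\<lambda>x. h x * k x) \<in> R" by (intro mult_fun * )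
  moreover have "\<forall>x. D x \<noteq> 0 \<longrightarrow> f (\<chi> i j. N x $ i $ j / D x) * g (\<chi> i j. N x $ i $ j / D x)
      = (h x * k x) / D x ^ (d + e)"
    using * by (simp add: power_add)
  ultimately show ?case by (intro exI[of _ "d + e"]) (rule bexI)
qed

end

interpretation matrix_polys: fun_alg matrix_poly_funs
  by unfold_locales (auto intro: matrix_poly_funs.intros)

section \<open>Polynomial functions of one variable\<close>

definition poly_funs :: "('a::field \<Rightarrow> 'a) set" where
  "poly_funs = range poly"

interpretation poly_funs: fun_alg poly_funs
proof
  show "(\<lambda>_. c) \<in> poly_funs" for c :: 'a
    unfolding poly_funs_def by (rule image_eqI[of _ _ "[:c:]"]) auto
next
  fix f g :: "'a \<Rightarrow> 'a" assume "f \<in> poly_funs" "g \<in> poly_funs"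
  then obtain p q where "f = poly p" "g = poly q" by (auto simp: poly_funs_def)
  then have "(\<lambda>x. f x + g x) = poly (p + q)" "(\<lambda>x. f x * g x) = poly (p * q)" by auto
  then show "(\<lambda>x. f x + g x) \<in> poly_funs" "(\<lambda>x. f x * g x) \<in> poly_funs"
    unfolding poly_funs_def by auto
qed

lemma poly_funs_id: "(\<lambda>x. x) \<in> poly_funs"
  unfolding poly_funs_def by (rule image_eqI[of _ _ "[:0, 1:]"]) auto

lemma finite_zeros_poly_funs:
  assumes "f \<in> poly_funs" "f a \<noteq> 0" shows "finite {t. f t = 0}"
proof -
  obtain p where "f = poly p" using assms by (auto simp: poly_funs_def)
  with assms show ?thesis using poly_roots_finite[of p] by fastforce
qed

text \<open>In a finite field the polynomial 1 plus the product of all \<open>X - a\<close> has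
  positive degree and takes the value 1 everywhere, so it has no root.\<close>

lemma infinite_alg_closed: "infinite (UNIV :: 'a::alg_closed_field set)"
proof
  assume fin: "finite (UNIV :: 'a set)"
  define p where "p = 1 + (\<Prod>a\<in>(UNIV::'a set). [:-a, 1:])"
  have "degree (\<Prod>a\<in>(UNIV::'a set). [:-a, 1:]) = card (UNIV :: 'a set)"
    by (subst degree_prod_eq_sum_degree) auto
  moreover have "card (UNIV :: 'a set) > 0" using fin by (simp add: card_gt_0_iff)
  ultimately have "degree p > 0" unfolding p_def by (subst degree_add_eq_right) auto
  then obtain x where "poly p x = 0" using alg_closed_imp_poly_has_root by blast
  moreover have "poly (\<Prod>a\<in>(UNIV::'a set). [:-a, 1:]) x = 0"
    using fin by (auto simp: poly_prod)
  ultimately show False by (simp add: p_def)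
qed

section \<open>Polynomial functions of several variables\<close>

inductive_set pfun :: "(('i \<Rightarrow> 'a::field) \<Rightarrow> 'a) set" where
  const: "(\<lambda>_. c) \<in> pfun"
| var: "(\<lambda>x. x i) \<in> pfun"
| add: "f \<in> pfun \<Longrightarrow> g \<in> pfun \<Longrightarrow> (\<lambda>x. f x + g x) \<in> pfun"
| mult: "f \<in> pfun \<Longrightarrow> g \<in> pfun \<Longrightarrow> (\<lambda>x. f x * g x) \<in> pfun"

interpretation pfun: fun_alg pfun
  by unfold_locales (auto intro: pfun.intros)

lemma (in fun_alg) pfun_comp:
  assumes "f \<in> pfun" "\<And>i. (\<lambda>x. u x i) \<in> R" shows "(\<lambda>x. f (u x)) \<in> R"
  using assms by induction (auto intro: const_fun add_fun mult_fun)

lemma pfun_line: "f \<in> pfun \<Longrightarrow> (\<lambda>t. f (\<lambda>i. x i + t * (y i - x i))) \<in> poly_funs"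
  by (erule poly_funs.pfun_comp) (intro poly_funs.diff poly_funs.add_fun poly_funs.mult_fun poly_funs.const_fun poly_funs_id)

lemma pfun_upd: "f \<in> pfun \<Longrightarrow> (\<lambda>t. f (x(i := t))) \<in> poly_funs"
  proof (erule poly_funs.pfun_comp)
  show "(\<lambda>t. (x(i := t)) j) \<in> poly_funs" for j
    by (cases "j = i") (auto intro: poly_funs.const_fun poly_funs_id)
qed

text \<open>This is the irreducibility of affine space: on the line through \<open>x\<close> and
  \<open>y\<close> both functions restrict to polynomials in \<open>t\<close>, nonzero at
  \<open>t = 0\<close> and \<open>t = 1\<close> respectively, so each has finitely many
  zeros.\<close>

lemma pfun_common_nonzero:
  fixes f g :: "('i \<Rightarrow> 'a::alg_closed_field) \<Rightarrow> 'a"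
  assumes "f \<in> pfun" "g \<in> pfun" "f x \<noteq> 0" "g y \<noteq> 0"
  shows "\<exists>t. f (\<lambda>i. x i + t * (y i - x i)) \<noteq> 0 \<and> g (\<lambda>i. x i + t * (y i - x i)) \<noteq> 0"
proof -
  let ?l = "\<lambda>t i. x i + t * (y i - x i)"
  have "finite {t. f (?l t) = 0}"
    using finite_zeros_poly_funs[OF pfun_line[OF assms(1), of x y], of 0] assms by simp
  moreover have "finite {t. g (?l t) = 0}"
    using finite_zeros_poly_funs[OF pfun_line[OF assms(2), of x y], of 1] assms by simp
  ultimately have "{t. f (?l t) = 0} \<union> {t. g (?l t) = 0} \<noteq> UNIV"
    by (metis (lifting) finite_UnI infinite_alg_closed)
  then show ?thesis by auto
qed

text \<open>A polynomial in one variable with infinitely many zeros vanishes. This frees the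
  coordinates from \<open>K\<close> one at a time; \<open>S\<close> in the induction collects those
  already free.\<close>

lemma pfun_zero_dense:
  fixes f :: "('i::finite \<Rightarrow> 'a::field) \<Rightarrow> 'a"
  assumes "f \<in> pfun" "infinite K" and van: "\<And>x. (\<And>i. x i \<in> K) \<Longrightarrow> f x = 0"
  shows "f x = 0"
proof -
  have "\<forall>x. (\<forall>i. i \<notin> S \<longrightarrow> x i \<in> K) \<longrightarrow> f x = 0" if "finite S" for S
    using that
  proof (induction S)
    case empty then show ?case using van by blast
  next
    case (insert j S)
    show ?case
    proof (intro allI impI)
      fix x assume x: "\<forall>i. i \<notin> insert j S \<longrightarrow> x i \<in> K"
      show "f x = 0"
      proof (rule ccontr)
        assume "f x \<noteq> 0"
        then have "finite {t. f (x(j := t)) = 0}"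
          by (intro finite_zeros_poly_funs[OF pfun_upd[OF assms(1)], of _ _ "x j"]) simp
        moreover have "K \<subseteq> {t. f (x(j := t)) = 0}"
        proof
          fix t assume "t \<in> K"
          with x have "\<forall>i. i \<notin> S \<longrightarrow> (x(j := t)) i \<in> K" by auto
          with insert.IH show "t \<in> {t. f (x(j := t)) = 0}" by blast
        qed
        ultimately show False using assms(2) finite_subset by blast
      qed
    qed
  qed
  from this[of UNIV] show ?thesis by simp
qed

section \<open>Degrees and linear systems\<close>

text \<open>A degree bound in each variable separately, read off from restrictions to coordinate
  lines. It is a property of the function, so no formal polynomial in several variables has to
  accompany it.\<close>

definition sepdeg :: "nat \<Rightarrow> (('i \<Rightarrow> 'a::field) \<Rightarrow> 'a) \<Rightarrow> bool" where
  "sepdeg D f \<longleftrightarrow> (\<forall>x i. \<exists>p. degree p \<le> D \<and> (\<forall>t. f (x(i := t)) = poly p t))"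

lemma sepdeg_const: "sepdeg D (\<lambda>_. c)"
  unfolding sepdeg_def by (intro allI exI[of _ "[:c:]"]) auto

lemma sepdeg_var: "sepdeg 1 (\<lambda>x. x j)"
  unfolding sepdeg_def
proof (intro allI)
  fix x :: "'a \<Rightarrow> 'b" and i
  show "\<exists>p. degree p \<le> 1 \<and> (\<forall>t. (x(i := t)) j = poly p t)"
    by (cases "i = j") (auto intro: exI[of _ "[:0, 1:]"] exI[of _ "[:x j:]"])
qed

lemma sepdeg_mono: "sepdeg D f \<Longrightarrow> D \<le> E \<Longrightarrow> sepdeg E f"
  unfolding sepdeg_def by (meson order_trans)

lemma sepdeg_add: "sepdeg D f \<Longrightarrow> sepdeg D g \<Longrightarrow> sepdeg D (\<lambda>x. f x + g x)"
  unfolding sepdeg_def by (metis degree_add_le poly_add)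

lemma sepdeg_mult: "sepdeg D f \<Longrightarrow> sepdeg E g \<Longrightarrow> sepdeg (D + E) (\<lambda>x. f x * g x)"
  unfolding sepdeg_def
proof (intro allI)
  fix x :: "'a \<Rightarrow> 'b" and i
  assume "\<forall>x i. \<exists>p. degree p \<le> D \<and> (\<forall>t. f (x(i := t)) = poly p t)"
    and "\<forall>x i. \<exists>p. degree p \<le> E \<and> (\<forall>t. g (x(i := t)) = poly p t)"
  then obtain p q where "degree p \<le> D" "\<forall>t. f (x(i := t)) = poly p t"
     "degree q \<le> E" "\<forall>t. g (x(i := t)) = poly q t" by blast
  then show "\<exists>p. degree p \<le> D + E \<and> (\<forall>t. f (x(i := t)) * g (x(i := t)) = poly p t)"
    by (intro exI[of _ "p * q"]) (auto intro: order_trans[OF degree_mult_le])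
qed

lemma sepdeg_power: "sepdeg D f \<Longrightarrow> sepdeg (n * D) (\<lambda>x. f x ^ n)"
  by (induction n) (auto intro: sepdeg_const sepdeg_mult)

lemma sepdeg_prod: "(\<And>j. j \<in> J \<Longrightarrow> sepdeg D (f j)) \<Longrightarrow> sepdeg (card J * D) (\<lambda>x. \<Prod>j\<in>J. f j x)"
  by (induction J rule: infinite_finite_induct) (auto intro: sepdeg_const sepdeg_mult)

lemma sepdeg_sum: "(\<And>j. j \<in> J \<Longrightarrow> sepdeg D (f j)) \<Longrightarrow> sepdeg D (\<lambda>x. \<Sum>j\<in>J. f j x)"
  by (induction J rule: infinite_finite_induct) (auto intro: sepdeg_const sepdeg_add)

lemma pfun_sepdeg: "f \<in> pfun \<Longrightarrow> \<exists>D. sepdeg D f"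
proof (induction f rule: pfun.induct)
  case (add f g)
  then obtain D E where "sepdeg D f" "sepdeg E g" by blast
  then have "sepdeg (max D E) f" "sepdeg (max D E) g" by (auto elim: sepdeg_mono)
  then show ?case by (blast intro: sepdeg_add)
qed (auto intro: sepdeg_const sepdeg_var sepdeg_mult)

text \<open>On a coordinate line the function is a polynomial of degree at most \<open>D\<close>
  with more than \<open>D\<close> zeros. The first \<open>k\<close> coordinates are freed from
  \<open>S\<close> one by one; the others stay frozen at \<open>c\<close>.\<close>

lemma sepdeg_grid_zero:
  fixes f :: "(nat \<Rightarrow> 'a::field) \<Rightarrow> 'a"
  assumes f: "sepdeg D f" and S: "D < card S"
    and van: "\<And>x. (\<And>j. j < k \<Longrightarrow> x j \<in> S) \<Longrightarrow> (\<And>j. j \<ge> k \<Longrightarrow> x j = c j) \<Longrightarrow> f x = 0"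
    and x: "\<And>j. j \<ge> k \<Longrightarrow> x j = c j"
  shows "f x = 0"
proof -
  have "\<forall>x. (\<forall>j<k. j \<ge> n \<longrightarrow> x j \<in> S) \<longrightarrow> (\<forall>j\<ge>k. x j = c j) \<longrightarrow> f x = 0" if "n \<le> k" for n
    using that
  proof (induction n)
    case 0 then show ?case using van by auto
  next
    case (Suc n)
    show ?case
    proof (intro allI impI)
      fix x assume x: "\<forall>j<k. j \<ge> Suc n \<longrightarrow> x j \<in> S" "\<forall>j\<ge>k. x j = c j"
      obtain p where p: "degree p \<le> D" "\<And>t. f (x(n := t)) = poly p t"
        using f unfolding sepdeg_def by blast
      have "poly p t = 0" if "t \<in> S" for t
      proof -
        have "f (x(n := t)) = 0"
        proof (rule Suc.IH[rule_format])
            show "n \<le> k" using Suc.prems by simp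
            show "(x(n := t)) j \<in> S" if "j < k" "n \<le> j" for j
              using that x \<open>t \<in> S\<close> by (cases "j = n") auto
            show "(x(n := t)) j = c j" if "k \<le> j" for j
              using that x Suc.prems by auto
          qed
        then show ?thesis using p by simp
      qed
      then have sub: "S \<subseteq> {t. poly p t = 0}" by blast
      have "p = 0"
      proof (rule ccontr)
        assume "p \<noteq> 0"
        then have "card S \<le> card {t. poly p t = 0}"
          by (intro card_mono poly_roots_finite sub)
        also have "\<dots> \<le> degree p"
          using \<open>p \<noteq> 0\<close> by (rule card_poly_roots_bound)
        finally have "card S \<le> degree p" .
        with p S show False by simp
      qed
      with p(2)[of "x n"] show "f x = 0" by simp
    qed
  qed
  from this[of k] x show ?thesis by auto
qed

text \<open>Gaussian elimination: an equation \<open>e\<close> with a nonzero coefficient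
  \<open>M e k\<close> eliminates the unknown \<open>k\<close> from the remaining equations and
  determines its value at the end.\<close>

lemma homogeneous_system_solution:
  fixes M :: "'e \<Rightarrow> 'i \<Rightarrow> 'a::field"
  assumes "finite E" "finite I" "card E < card I"
  shows "\<exists>c. (\<exists>i\<in>I. c i \<noteq> 0) \<and> (\<forall>e\<in>E. (\<Sum>i\<in>I. M e i * c i) = 0)"
  using assms
proof (induction E arbitrary: I M)
  case empty
  then obtain i where "i \<in> I" by fastforce
  then show ?case by (intro exI[of _ "\<lambda>_. 1"]) auto
next
  case (insert e E)
  show ?case
  proof (cases "\<forall>i\<in>I. M e i = 0")
    case True
    have "\<exists>c. (\<exists>i\<in>I. c i \<noteq> 0) \<and> (\<forall>e\<in>E. (\<Sum>i\<in>I. M e i * c i) = 0)"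
      using insert by (intro insert.IH) auto
    then show ?thesis using True by auto
  next
    case False
    then obtain k where k: "k \<in> I" "M e k \<noteq> 0" by blast
    let ?I = "I - {k}"
    have "\<exists>c. (\<exists>i\<in>?I. c i \<noteq> 0) \<and> (\<forall>f\<in>E. (\<Sum>i\<in>?I. (M f i - M f k * M e i / M e k) * c i) = 0)"
      using insert k by (intro insert.IH) auto
    then obtain c where c: "\<exists>i\<in>?I. c i \<noteq> 0"
      "\<And>f. f \<in> E \<Longrightarrow> (\<Sum>i\<in>?I. (M f i - M f k * M e i / M e k) * c i) = 0" by blast
    define s where "s = (\<Sum>i\<in>?I. M e i * c i)"
    define d where "d = c(k := - s / M e k)"
    have split: "(\<Sum>i\<in>I. M f i * d i) = M f k * (- s / M e k) + (\<Sum>i\<in>?I. M f i * c i)" for f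
    proof -
      have "(\<Sum>i\<in>I. M f i * d i) = M f k * d k + (\<Sum>i\<in>?I. M f i * d i)"
        using insert.prems k by (simp add: sum.remove)
      also have "(\<Sum>i\<in>?I. M f i * d i) = (\<Sum>i\<in>?I. M f i * c i)"
        by (rule sum.cong) (auto simp: d_def)
      finally show ?thesis by (simp add: d_def)
    qed
    have "(\<Sum>i\<in>I. M f i * d i) = 0" if f: "f \<in> insert e E" for f
    proof (cases "f = e")
      case True
      then show ?thesis using k by (simp add: split s_def)
    next
      case False
      then have "f \<in> E" using f by blast
      from c(2)[OF this] have "(\<Sum>i\<in>?I. M f i * c i) = M f k / M e k * s"
        unfolding s_def
        by (simp add: left_diff_distrib right_diff_distrib sum_subtractf sum_distrib_left mult_ac)
      then show ?thesis by (simp add: split)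
    qed
    moreover have "\<exists>i\<in>I. d i \<noteq> 0" using c(1) by (auto simp: d_def)
    ultimately show ?thesis by blast
  qed
qed

text \<open>As a polynomial in one variable \<open>x j\<close> the sum has vanishing coefficients,
  and each coefficient is a sum of the same shape in fewer variables. Exponents only need to be
  distinguished by their values on \<open>J\<close>.\<close>

lemma monomials_independent:
  fixes R :: "('j \<Rightarrow> nat) \<Rightarrow> 'a::field"
  assumes "finite J" "finite I" and inf: "infinite (UNIV :: 'a set)"
    and "\<And>a b. a \<in> I \<Longrightarrow> b \<in> I \<Longrightarrow> (\<And>j. j \<in> J \<Longrightarrow> a j = b j) \<Longrightarrow> a = b"
    and "\<And>x. (\<Sum>a\<in>I. R a * (\<Prod>j\<in>J. x j ^ a j)) = 0"
    and "a \<in> I"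
  shows "R a = 0"
  using assms(1,2,4-)
proof (induction J arbitrary: I a)
  case empty
  then have "I = {a}" by auto
  with empty show ?case by simp
next
  case (insert j J)
  define I' where "I' = {b \<in> I. b j = a j}"
  have "(\<Sum>b\<in>I'. R b * (\<Prod>i\<in>J. x i ^ b i)) = 0" for x :: "'j \<Rightarrow> 'a"
  proof -
    define p where "p = (\<Sum>b\<in>I. monom (R b * (\<Prod>i\<in>J. x i ^ b i)) (b j))"
    have "poly p t = 0" for t
    proof -
      have "(\<Prod>i\<in>insert j J. (x(j := t)) i ^ b i) = t ^ b j * (\<Prod>i\<in>J. x i ^ b i)" for b
      proof -
        have "(\<Prod>i\<in>J. (x(j := t)) i ^ b i) = (\<Prod>i\<in>J. x i ^ b i)"
          using insert.hyps by (intro prod.cong) auto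
        then show ?thesis using insert.hyps by simp
      qed
      with insert.prems(3)[of "x(j := t)"] show ?thesis
        by (simp add: p_def poly_sum poly_monom mult_ac)
    qed
    then have "p = 0" using inf poly_roots_finite[of p] by auto
    then have "0 = coeff p (a j)" by simp
    also have "\<dots> = (\<Sum>b\<in>I. if b j = a j then R b * (\<Prod>i\<in>J. x i ^ b i) else 0)"
      by (simp add: p_def coeff_sum)
    also have "\<dots> = (\<Sum>b\<in>I'. R b * (\<Prod>i\<in>J. x i ^ b i))"
      using insert.prems by (simp add: I'_def sum.inter_filter)
    finally show ?thesis by simp
  qed
  moreover have "b = b'" if "b \<in> I'" "b' \<in> I'" "\<And>i. i \<in> J \<Longrightarrow> b i = b' i" for b b'
    using that by (intro insert.prems(2)[of b b']) (auto simp: I'_def)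
  moreover have "finite I'" "a \<in> I'" using insert.prems by (auto simp: I'_def)
  ultimately show ?case using insert.IH[of I' a] by blast
qed

section \<open>Zariski closures and Krull dimension\<close>

lemma closedin_zariski_zero: "f \<in> matrix_poly_funs \<Longrightarrow> closedin zariski {A. f A = 0}"
  unfolding closedin_zariski by (rule exI[of _ "{f}"]) (auto simp: zero_locus_def)

lemma closedin_zariski_separate:
  assumes "closedin zariski S" "A \<notin> S"
  obtains f where "f \<in> matrix_poly_funs" "f A \<noteq> 0" "\<And>B. B \<in> S \<Longrightarrow> f B = 0"
  using assms unfolding closedin_zariski zero_locus_def by blast

lemma in_zariski_closure_iff:
  "A \<in> zariski closure_of S \<longleftrightarrow> (\<forall>f\<in>matrix_poly_funs. (\<forall>B\<in>S. f B = 0) \<longrightarrow> f A = 0)"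
proof
  assume A: "A \<in> zariski closure_of S"
  show "\<forall>f\<in>matrix_poly_funs. (\<forall>B\<in>S. f B = 0) \<longrightarrow> f A = 0"
  proof (intro ballI impI)
    fix f :: "'a^'b^'b \<Rightarrow> 'a" assume "f \<in> matrix_poly_funs" "\<forall>B\<in>S. f B = 0"
    then have "zariski closure_of S \<subseteq> {A. f A = 0}"
      by (intro closure_of_minimal closedin_zariski_zero) auto
    with A show "f A = 0" by blast
  qed
next
  assume *: "\<forall>f\<in>matrix_poly_funs. (\<forall>B\<in>S. f B = 0) \<longrightarrow> f A = 0"
  show "A \<in> zariski closure_of S"
  proof (rule ccontr)
    assume "A \<notin> zariski closure_of S"
    then obtain f where "f \<in> matrix_poly_funs" "f A \<noteq> 0" "\<And>B. B \<in> zariski closure_of S \<Longrightarrow> f B = 0"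
      using closedin_zariski_separate[OF closedin_closure_of] by metis
    with * show False using closure_of_subset[of S zariski] by auto
  qed
qed

text \<open>Nonempty relatively open sets contain nonzero loci of single polynomials
  \<open>f\<close> and \<open>g\<close>, so it suffices that these meet in the parameter set
  \<open>P\<close>. \<open>Z\<close> may be the closure, as in the chain of closed sets, or the
  image itself, as for connectedness of a one-parameter group.\<close>

lemma irreducible_closure_image:
  fixes \<phi> :: "'x \<Rightarrow> 'a::field^'n^'n"
  assumes "P \<noteq> {}"
    and common: "\<And>f g x y. f \<in> matrix_poly_funs \<Longrightarrow> g \<in> matrix_poly_funs \<Longrightarrow> x \<in> P \<Longrightarrow> y \<in> P \<Longrightarrow>
       f (\<phi> x) \<noteq> 0 \<Longrightarrow> g (\<phi> y) \<noteq> 0 \<Longrightarrow> \<exists>z\<in>P. f (\<phi> z) \<noteq> 0 \<and> g (\<phi> z) \<noteq> 0"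
    and Z: "\<phi> ` P \<subseteq> Z" "Z \<subseteq> zariski closure_of (\<phi> ` P)"
  shows "irreducible_space (subtopology zariski Z)"
  unfolding irreducible_space_def
proof (intro conjI allI impI)
  show "topspace (subtopology zariski Z) \<noteq> {}"
    using assms(1) Z(1) by auto
next
  fix S T
  assume "closedin (subtopology zariski Z) S" "closedin (subtopology zariski Z) T"
    and "topspace (subtopology zariski Z) = S \<union> T"
  then have un: "Z = S \<union> T" by simp
  obtain S' where S': "closedin zariski S'" "S = S' \<inter> Z"
    using \<open>closedin (subtopology zariski Z) S\<close> unfolding closedin_subtopology by blast
  obtain T' where T': "closedin zariski T'" "T = T' \<inter> Z"
    using \<open>closedin (subtopology zariski Z) T\<close> unfolding closedin_subtopology by blast
  show "S = topspace (subtopology zariski Z) \<or> T = topspace (subtopology zariski Z)"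
  proof (rule ccontr)
    assume "\<not> ?thesis"
    then have "S \<noteq> Z" "T \<noteq> Z" by auto
    then obtain A B where A: "A \<in> Z" "A \<notin> S'" and B: "B \<in> Z" "B \<notin> T'"
      unfolding S'(2) T'(2) by blast
    obtain f where f: "f \<in> matrix_poly_funs" "f A \<noteq> 0" "\<And>B. B \<in> S' \<Longrightarrow> f B = 0"
      using closedin_zariski_separate[OF S'(1) A(2)] by metis
    obtain g where g: "g \<in> matrix_poly_funs" "g B \<noteq> 0" "\<And>B. B \<in> T' \<Longrightarrow> g B = 0"
      using closedin_zariski_separate[OF T'(1) B(2)] by metis
    have "A \<in> zariski closure_of (\<phi> ` P)" "B \<in> zariski closure_of (\<phi> ` P)"
      using A(1) B(1) Z(2) by auto
    from this(1)[unfolded in_zariski_closure_iff, rule_format, OF f(1)] f(2)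
      this(2)[unfolded in_zariski_closure_iff, rule_format, OF g(1)] g(2)
    obtain x y where "x \<in> P" "f (\<phi> x) \<noteq> 0" "y \<in> P" "g (\<phi> y) \<noteq> 0"
      by auto
    then obtain z where "z \<in> P" "f (\<phi> z) \<noteq> 0" "g (\<phi> z) \<noteq> 0"
      using common[OF f(1) g(1)] by blast
    moreover have "\<phi> z \<in> S' \<or> \<phi> z \<in> T'"
    proof -
      have "\<phi> z \<in> S \<union> T" using \<open>z \<in> P\<close> Z(1) unfolding un[symmetric] by blast
      then show ?thesis unfolding S'(2) T'(2) by blast
    qed
    ultimately show False using f(3) g(3) by auto
  qed
qed

lemma irreducible_imp_connectedin:
  assumes "irreducible_space (subtopology zariski Z)" shows "connectedin zariski Z"
  unfolding connectedin_def connected_space_closedin_eq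
proof (intro conjI notI)
  show "Z \<subseteq> topspace zariski" by simp
  let ?T = "subtopology zariski Z"
  assume "\<exists>E1 E2. closedin ?T E1 \<and> closedin ?T E2 \<and> E1 \<union> E2 = topspace ?T \<and> E1 \<inter> E2 = {} \<and> E1 \<noteq> {} \<and> E2 \<noteq> {}"
  then obtain E1 E2 where E: "closedin ?T E1" "closedin ?T E2" "topspace ?T = E1 \<union> E2"
     "E1 \<inter> E2 = {}" "E1 \<noteq> {}" "E2 \<noteq> {}" by metis
  then have "E1 = topspace ?T \<or> E2 = topspace ?T"
    using assms unfolding irreducible_space_def by simp
  with E show False by auto
qed

lemma krull_dim_geI:
  assumes "\<And>i. i \<le> d \<Longrightarrow> closedin Y (Z i) \<and> irreducible_space (subtopology Y (Z i))"
    and "\<And>i. i < d \<Longrightarrow> Z i \<subset> Z (Suc i)"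
  shows "enat d \<le> krull_dim Y"
  unfolding krull_dim_def by (rule Sup_upper) (use assms in auto)

text \<open>The quotients \<open>N j / x 0 ^ l\<close> for \<open>j \<le> k\<close> are
  \<open>k + 1\<close> rational functions of \<open>k\<close> free coordinates, hence algebraically
  dependent; here the relation has been multiplied by \<open>x 0 ^ (l * n * (k + 1))\<close>. It
  comes from linear algebra: there are more monomials with exponents up to \<open>n\<close> than
  points of a grid on which their combination has to vanish.\<close>

lemma exists_algebraic_relation:
  fixes N :: "nat \<Rightarrow> (nat \<Rightarrow> 'a::field) \<Rightarrow> 'a"
  assumes inf: "infinite (UNIV :: 'a set)" and N: "\<And>j. j \<le> k \<Longrightarrow> N j \<in> pfun"
  obtains n R where "\<exists>a\<in>PiE {..k} (\<lambda>_. {..n::nat}). R a \<noteq> 0"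
    "\<And>x. (\<And>j. j \<ge> k \<Longrightarrow> x j = c j) \<Longrightarrow>
      (\<Sum>a\<in>PiE {..k} (\<lambda>_. {..n}). R a * (x 0 ^ (l * (n * Suc k - (\<Sum>j\<le>k. a j))) * (\<Prod>j\<le>k. N j x ^ a j))) = 0"
proof -
  have "\<exists>D. \<forall>j\<le>k. sepdeg D (N j)"
  proof -
    obtain D where D: "\<And>j. j \<le> k \<Longrightarrow> sepdeg (D j) (N j)"
      using pfun_sepdeg[OF N] by metis
    have "sepdeg (Max (D ` {..k})) (N j)" if "j \<le> k" for j
      using D[OF that] that by (auto intro: sepdeg_mono)
    then show ?thesis by blast
  qed
  then obtain D where D: "\<And>j. j \<le> k \<Longrightarrow> sepdeg D (N j)" by blast
  \<comment> \<open>Each product \<open>h a\<close> has degree at most \<open>n * C\<close> in every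
    variable: \<open>n * l * (k + 1)\<close> from the power of \<open>x 0\<close> and
    \<open>n * (k + 1) * D\<close> from the \<open>N j\<close>. The summand 1 yields
    \<open>Suc (n * C) \<le> C * Suc n\<close>.\<close>
  define C where "C = l * Suc k + Suc k * D + 1"
  \<comment> \<open>With this choice \<open>(C * Suc n) ^ k = n * Suc n ^ k\<close>, which is less
    than the number \<open>Suc n ^ Suc k\<close> of monomials.\<close>
  define n where "n = C ^ k"
  let ?I = "PiE {..k} (\<lambda>_. {..n})"
  define h where "h = (\<lambda>a x. x 0 ^ (l * (n * Suc k - (\<Sum>j\<le>k. a j))) * (\<Prod>j\<le>k. N j x ^ a j))"
  have deg: "sepdeg (n * C) (h a)" if "a \<in> ?I" for a
  proof -
    have "sepdeg (n * D) (\<lambda>x. N j x ^ a j)" if "j \<in> {..k}" for j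
      using sepdeg_mono[OF sepdeg_power[OF D, of j "a j"], of "n * D"] \<open>a \<in> ?I\<close> that
      by (auto simp: PiE_def Pi_def)
    from sepdeg_prod[of "{..k}", OF this] have 1: "sepdeg (Suc k * (n * D)) (\<lambda>x. \<Prod>j\<le>k. N j x ^ a j)"
      by simp
    have "sepdeg (l * (n * Suc k - (\<Sum>j\<le>k. a j)) * 1) (\<lambda>x. x 0 ^ (l * (n * Suc k - (\<Sum>j\<le>k. a j))) :: 'a)"
      by (rule sepdeg_power[OF sepdeg_var])
    from sepdeg_mult[OF this 1] show ?thesis
      unfolding h_def by (elim sepdeg_mono) (auto simp: C_def algebra_simps intro!: mult_le_mono)
  qed
  obtain S :: "'a set" where S: "finite S" "card S = Suc (n * C)"
    using infinite_arbitrarily_large[OF inf] by blast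
  let ?E = "PiE {..<k} (\<lambda>_. S)"
  let ?x = "\<lambda>e j. if j < k then e j else c j"
  have "card ?E < card ?I"
  proof -
    have "Suc (n * C) ^ k \<le> (C * Suc n) ^ k"
      by (intro power_mono) (auto simp: C_def algebra_simps)
    also have "\<dots> = n * Suc n ^ k" by (simp only: power_mult_distrib n_def)
    also have "\<dots> < Suc n ^ Suc k" by simp
    finally show ?thesis by (simp add: card_PiE S)
  qed
  moreover have "finite ?E" "finite ?I" using S by (auto intro: finite_PiE)
  ultimately obtain R where R: "\<exists>a\<in>?I. R a \<noteq> 0" "\<And>e. e \<in> ?E \<Longrightarrow> (\<Sum>a\<in>?I. h a (?x e) * R a) = 0"
    using homogeneous_system_solution[of ?E ?I "\<lambda>e a. h a (?x e)"] by blast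
  have rel: "(\<Sum>a\<in>?I. R a * h a x) = 0" if x: "\<And>j. j \<ge> k \<Longrightarrow> x j = c j" for x
  proof (rule sepdeg_grid_zero[where k = k and S = S and c = c and f = "\<lambda>x. \<Sum>a\<in>?I. R a * h a x"])
    show "sepdeg (n * C) (\<lambda>x. \<Sum>a\<in>?I. R a * h a x)"
      using sepdeg_mult[OF sepdeg_const[of 0] deg] by (intro sepdeg_sum) simp
    show "n * C < card S" using S by simp
    show "x j = c j" if "j \<ge> k" for j using x that .
    fix x assume x: "\<And>j. j < k \<Longrightarrow> x j \<in> S" "\<And>j. j \<ge> k \<Longrightarrow> x j = c j"
    have "?x (restrict x {..<k}) = x" using x(2) by auto
    moreover have "restrict x {..<k} \<in> ?E" using x(1) by auto
    ultimately show "(\<Sum>a\<in>?I. R a * h a x) = 0"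
      using R(2)[of "restrict x {..<k}"] by (simp add: mult.commute)
  qed
  show ?thesis by (rule that[OF R(1)]) (use rel in \<open>simp add: h_def\<close>)
qed

text \<open>
  The family \<open>N x\<close> degenerates as \<open>x 0 \<rightarrow> 0\<close> to matrices on which the functionals \<open>F j\<close> are, up to a
  common factor, the coordinates \<open>1, x 1, \<dots>, x (d - 1)\<close>. The coordinate \<open>x 0\<close> contributes one more
  dimension: the top degree part of a relation between the \<open>F j\<close> survives in the limit.
\<close>

lemma krull_dim_ge_degeneration:
  fixes N :: "(nat \<Rightarrow> 'a::alg_closed_field) \<Rightarrow> 'a^'n^'n"
  assumes Y: "closedin zariski Y" and l: "l > 0"
    and N: "\<And>i j. (\<lambda>x. N x $ i $ j) \<in> pfun"
    and NX: "\<And>x. x 0 \<noteq> 0 \<Longrightarrow> (\<chi> i j. N x $ i $ j / x 0 ^ l) \<in> Y"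
    and F: "\<And>j. j < d \<Longrightarrow> F j \<in> matrix_poly_funs" "\<And>j c A. j < d \<Longrightarrow> F j (\<chi> a b. A $ a $ b / c) = F j A / c"
    and lim: "\<And>x j. x 0 = 0 \<Longrightarrow> j < d \<Longrightarrow> 0 < j \<Longrightarrow> F j (N x) = x j * F 0 (N x)"
    and nz: "F 0 (N (\<lambda>_. 0)) \<noteq> 0"
  shows "enat d \<le> krull_dim (subtopology zariski Y)"
proof -
  define \<phi> where "\<phi> = (\<lambda>x. \<chi> i j. N x $ i $ j / x 0 ^ l)"
  \<comment> \<open>The base point is \<open>(1, 0, 0, ...)\<close>. The set \<open>P k\<close>
    frees the first \<open>k\<close> coordinates, so \<open>P 0\<close> is this single point and the
    chain has \<open>d + 1\<close> members.\<close>
  define c where "c = (\<lambda>j::nat. if j = 0 then 1 else 0 :: 'a)"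
  define P where "P = (\<lambda>k. {x. x 0 \<noteq> 0 \<and> (\<forall>j\<ge>k. x j = c j)})"
  define Z where "Z = (\<lambda>k. zariski closure_of (\<phi> ` P k))"
  have c_P: "c \<in> P k" for k by (auto simp: P_def c_def)
  have FN: "(\<lambda>x. F j (N x)) \<in> pfun" if "j < d" for j
    using pfun.matrix_poly_comp[OF F(1)[OF that] N] .
  have ZX: "Z k \<subseteq> Y" for k
    unfolding Z_def using NX by (intro closure_of_minimal Y) (auto simp: P_def \<phi>_def)
  have irr: "irreducible_space (subtopology zariski (Z k))" for k
  proof (rule irreducible_closure_image[where \<phi> = \<phi> and P = "P k"])
    show "P k \<noteq> {}" using c_P by blast
    show "\<phi> ` P k \<subseteq> Z k" unfolding Z_def by (rule closure_of_subset) simp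
    show "Z k \<subseteq> zariski closure_of \<phi> ` P k" by (simp add: Z_def)
    fix f g :: "'a^'n^'n \<Rightarrow> 'a" and x y
    assume fg: "f \<in> matrix_poly_funs" "g \<in> matrix_poly_funs" and xy: "x \<in> P k" "y \<in> P k"
      "f (\<phi> x) \<noteq> 0" "g (\<phi> y) \<noteq> 0"
    have x0: "(\<lambda>x. x 0 ^ l) \<in> pfun" by (intro pfun.power pfun.var)
    from pfun.matrix_poly_comp_fraction[OF fg(1) N x0] obtain e h where
      h: "h \<in> pfun" "\<And>x. x 0 ^ l \<noteq> 0 \<Longrightarrow> f (\<phi> x) = h x / (x 0 ^ l) ^ e"
      unfolding \<phi>_def by auto
    from pfun.matrix_poly_comp_fraction[OF fg(2) N x0] obtain e' h' where
      h': "h' \<in> pfun" "\<And>x. x 0 ^ l \<noteq> 0 \<Longrightarrow> g (\<phi> x) = h' x / (x 0 ^ l) ^ e'"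
      unfolding \<phi>_def by auto
    \<comment> \<open>The factor \<open>x 0\<close> keeps the point found on the line away from
      \<open>x 0 = 0\<close>, hence inside \<open>P k\<close>.\<close>
    have "(\<lambda>x. h x * x 0) x \<noteq> 0" "h' y \<noteq> 0"
      using xy h h' by (auto simp: P_def)
    moreover have "(\<lambda>x. h x * x 0) \<in> pfun" by (intro pfun.mult h pfun.var)
    ultimately obtain t where t: "h (\<lambda>i. x i + t * (y i - x i)) * (x 0 + t * (y 0 - x 0)) \<noteq> 0"
       "h' (\<lambda>i. x i + t * (y i - x i)) \<noteq> 0"
      using pfun_common_nonzero[OF _ h'(1), of "\<lambda>x. h x * x 0" x y] by auto
    define z where "z = (\<lambda>i. x i + t * (y i - x i))"
    have "z 0 \<noteq> 0" using t by (auto simp: z_def)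
    moreover have "z j = c j" if "j \<ge> k" for j using xy that by (auto simp: z_def P_def)
    ultimately have "z \<in> P k" by (auto simp: P_def)
    moreover have "f (\<phi> z) \<noteq> 0" "g (\<phi> z) \<noteq> 0"
      using h(2)[of z] h'(2)[of z] t \<open>z 0 \<noteq> 0\<close> by (auto simp: z_def)
    ultimately show "\<exists>z\<in>P k. f (\<phi> z) \<noteq> 0 \<and> g (\<phi> z) \<noteq> 0" by blast
  qed
  have F\<phi>: "F j (\<phi> x) = F j (N x) / x 0 ^ l" if "j < d" for j x
    unfolding \<phi>_def by (rule F(2)[OF that])
  have strict: "Z k \<subset> Z (Suc k)" if k: "k < d" for k
  proof
    show "Z k \<subseteq> Z (Suc k)"
      unfolding Z_def by (intro closure_of_mono image_mono) (auto simp: P_def)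
    show "Z k \<noteq> Z (Suc k)"
    proof
      assume eq: "Z k = Z (Suc k)"
      \<comment> \<open>On \<open>P k\<close> only \<open>k\<close> coordinates are free, so the
        \<open>k + 1\<close> functionals \<open>F 0, ..., F k\<close> satisfy a relation there.
        Equality of the closures carries it over to \<open>P (Suc k)\<close>, where its top degree
        part leads to a contradiction.\<close>
      have "(\<lambda>x. F j (N x)) \<in> pfun" if "j \<le> k" for j using FN k that by simp
      from exists_algebraic_relation[OF infinite_alg_closed this, of k "\<lambda>j. j" c l] obtain n R where
        R: "\<exists>a\<in>PiE {..k} (\<lambda>_. {..n::nat}). R a \<noteq> 0"
        "\<And>x. (\<And>j. j \<ge> k \<Longrightarrow> x j = c j) \<Longrightarrow> (\<Sum>a\<in>PiE {..k} (\<lambda>_. {..n}).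
            R a * (x 0 ^ (l * (n * Suc k - (\<Sum>j\<le>k. a j))) * (\<Prod>j\<le>k. F j (N x) ^ a j))) = 0"
        by blast
      let ?I = "PiE {..k} (\<lambda>_. {..n})"
      let ?w = "\<lambda>a. \<Sum>j\<le>k. a j :: nat"
      have fin: "finite ?I" by (auto intro: finite_PiE)
      define \<psi> where "\<psi> = (\<lambda>A. \<Sum>a\<in>?I. R a * (\<Prod>j\<le>k. F j A ^ a j))"
      have \<psi>: "\<psi> \<in> matrix_poly_funs"
        unfolding \<psi>_def using k
        by (intro matrix_polys.sum matrix_polys.mult_fun matrix_polys.const_fun matrix_polys.prod matrix_polys.power F) auto
      have \<psi>\<phi>: "\<psi> (\<phi> x) * x 0 ^ (l * m) = (\<Sum>a\<in>?I. R a * (x 0 ^ (l * m) / x 0 ^ (l * ?w a) * (\<Prod>j\<le>k. F j (N x) ^ a j)))"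
        for x m
      proof -
        have "(\<Prod>j\<le>k. F j (\<phi> x) ^ a j) = (\<Prod>j\<le>k. F j (N x) ^ a j) / x 0 ^ (l * ?w a)" for a
        proof -
          have "(\<Prod>j\<le>k. F j (\<phi> x) ^ a j) = (\<Prod>j\<le>k. F j (N x) ^ a j / x 0 ^ (l * a j))"
            using k by (intro prod.cong) (auto simp: F\<phi> power_divide power_mult)
          also have "\<dots> = (\<Prod>j\<le>k. F j (N x) ^ a j) / (\<Prod>j\<le>k. x 0 ^ (l * a j))"
            by (rule prod_dividef)
          also have "(\<Prod>j\<le>k. x 0 ^ (l * a j)) = x 0 ^ (l * ?w a)"
            by (simp add: power_sum sum_distrib_left)
          finally show ?thesis .
        qed
        then show ?thesis by (simp add: \<psi>_def sum_distrib_right sum_distrib_left mult_ac)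
      qed
      have "\<psi> (\<phi> x) = 0" if x: "x \<in> P k" for x
      proof -
        have "\<psi> (\<phi> x) * x 0 ^ (l * (n * Suc k)) = 0"
        proof -
          have "?w a \<le> n * Suc k" if "a \<in> ?I" for a
            using sum_bounded_above[of "{..k}" a n] that by (auto simp: PiE_def Pi_def mult.commute)
          then have "x 0 ^ (l * (n * Suc k)) / x 0 ^ (l * ?w a) = x 0 ^ (l * (n * Suc k - ?w a))" if "a \<in> ?I" for a
            using x that by (simp add: P_def power_diff diff_mult_distrib2)
          then show ?thesis using R(2)[of x] x by (simp add: \<psi>\<phi> P_def)
        qed
        then show ?thesis using x by (simp add: P_def)
      qed
      then have \<psi>0: "\<psi> A = 0" if "A \<in> Z (Suc k)" for A
      proof -
        have "A \<in> zariski closure_of (\<phi> ` P k)" using that eq unfolding Z_def by simp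
        then show ?thesis
          using \<psi> \<open>\<And>x. x \<in> P k \<Longrightarrow> \<psi> (\<phi> x) = 0\<close> unfolding in_zariski_closure_iff by simp
      qed
      define I' where "I' = {a \<in> ?I. R a \<noteq> 0}"
      \<comment> \<open>\<open>m\<close> is the top total degree among the monomials that occur.
        After multiplication by \<open>x 0 ^ (l * m)\<close> the terms of lower degree keep a
        positive power of \<open>x 0\<close> and vanish in the limit.\<close>
      define m where "m = Max (?w ` I')"
      have I': "finite I'" "I' \<noteq> {}" using fin R(1) by (auto simp: I'_def)
      have m: "?w a \<le> m" if "a \<in> I'" for a unfolding m_def using I' that by auto
      define I'' where "I'' = {a \<in> I'. ?w a = m}"
      have "m \<in> ?w ` I'" unfolding m_def using I' by (intro Max_in) auto
      then obtain a0 where a0: "a0 \<in> I''" by (auto simp: I''_def)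
      define L where "L = (\<lambda>x::nat \<Rightarrow> 'a. \<Sum>a\<in>I''. R a * (\<Prod>j\<in>{1..k}. x j ^ a j))"
      define H where "H = (\<lambda>x. \<Sum>a\<in>I'. R a * (x 0 ^ (l * (m - ?w a)) * (\<Prod>j\<le>k. F j (N x) ^ a j)))"
      have H: "H \<in> pfun"
        unfolding H_def using k
        by (intro pfun.sum pfun.mult pfun.const pfun.power pfun.var pfun.prod FN) auto
      have HP: "H x = 0" if x: "x \<in> P (Suc k)" for x
      proof -
        have "\<phi> x \<in> Z (Suc k)"
          unfolding Z_def using closure_of_subset[of "\<phi> ` P (Suc k)" zariski] x by auto
        then have "0 = \<psi> (\<phi> x) * x 0 ^ (l * m)" using \<psi>0 by simp
        also have "\<dots> = (\<Sum>a\<in>I'. R a * (x 0 ^ (l * m) / x 0 ^ (l * ?w a) * (\<Prod>j\<le>k. F j (N x) ^ a j)))"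
          unfolding \<psi>\<phi> I'_def using fin by (intro sum.mono_neutral_right) auto
        also have "\<dots> = H x"
          unfolding H_def using x m by (intro sum.cong) (auto simp: P_def power_diff diff_mult_distrib2)
        finally show ?thesis by simp
      qed
      \<comment> \<open>This is the passage to the limit: a polynomial in \<open>x 0\<close> that
        vanishes at all nonzero values also vanishes at 0.\<close>
      have H0: "H x = 0" if x: "x 0 = 0" "\<And>j. j > k \<Longrightarrow> x j = 0" for x
      proof (rule ccontr)
        assume "H x \<noteq> 0"
        then have "finite {t. H (x(0 := t)) = 0}"
          using finite_zeros_poly_funs[OF pfun_upd[OF H, of x 0], of 0] x(1) fun_upd_triv[of x 0] by simp
        moreover have "UNIV - {0} \<subseteq> {t. H (x(0 := t)) = 0}"
          using HP x(2) by (auto simp: P_def c_def)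
        ultimately show False
          using infinite_alg_closed by (metis finite_Diff2 finite.emptyI finite_insert finite_subset)
      qed
      have HL: "H x = F 0 (N x) ^ m * L x" if x: "x 0 = 0" for x
      proof -
        have "(\<Prod>j\<le>k. F j (N x) ^ a j) = F 0 (N x) ^ ?w a * (\<Prod>j\<in>{1..k}. x j ^ a j)" for a
        proof -
          have "(\<Prod>j\<le>k. F j (N x) ^ a j) = (\<Prod>j\<le>k. F 0 (N x) ^ a j * (if j = 0 then 1 else x j ^ a j))"
            using k lim[of x, OF x] by (intro prod.cong) (auto simp: power_mult_distrib mult.commute)
          also have "\<dots> = F 0 (N x) ^ ?w a * (\<Prod>j\<le>k. if j = 0 then 1 else x j ^ a j)"
            by (simp add: prod.distrib power_sum)
          also have "(\<Prod>j\<le>k. if j = 0 then 1 else x j ^ a j) = (\<Prod>j\<in>{1..k}. x j ^ a j)"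
            by (intro prod.mono_neutral_cong_right) auto
          finally show ?thesis .
        qed
        then have "H x = (\<Sum>a\<in>I'. R a * (0 ^ (l * (m - ?w a)) * (F 0 (N x) ^ ?w a * (\<Prod>j\<in>{1..k}. x j ^ a j))))"
          unfolding H_def using x by simp
        also have "\<dots> = (\<Sum>a\<in>I''. R a * (0 ^ (l * (m - ?w a)) * (F 0 (N x) ^ ?w a * (\<Prod>j\<in>{1..k}. x j ^ a j))))"
          using I' l m by (intro sum.mono_neutral_right) (auto simp: I''_def power_0_left dest: le_antisym)
        also have "\<dots> = F 0 (N x) ^ m * L x"
          unfolding L_def sum_distrib_left by (intro sum.cong) (auto simp: I''_def)
        finally show ?thesis .
      qed
      have "L \<in> pfun" unfolding L_def
        by (intro pfun.sum pfun.mult pfun.const pfun.power pfun.var pfun.prod)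
      have L0: "L x = 0" for x
      proof (rule ccontr)
        assume nL: "L x \<noteq> 0"
        \<comment> \<open>\<open>L\<close> involves only the coordinates 1 to \<open>k\<close>, so
          the others may be set to 0, as \<open>H0\<close> demands. On the line from the origin to
          \<open>y\<close> there is then a point at which both \<open>L\<close> and
          \<open>F 0\<close> are nonzero.\<close>
        define y where "y = (\<lambda>j. if 1 \<le> j \<and> j \<le> k then x j else 0)"
        have "L y = L x" unfolding L_def y_def by (intro sum.cong arg_cong2[where f = "(*)"] prod.cong) auto
        with nL have "L y \<noteq> 0" by simp
        have "0 < d" using k by simp
        from pfun_common_nonzero[where f = "\<lambda>x. F 0 (N x)" and g = L, OF FN[OF this] \<open>L \<in> pfun\<close> nz \<open>L y \<noteq> 0\<close>]
        obtain t where "F 0 (N (\<lambda>i. t * y i)) \<noteq> 0" "L (\<lambda>i. t * y i) \<noteq> 0" by auto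
        moreover have "H (\<lambda>i. t * y i) = 0" by (rule H0) (auto simp: y_def)
        ultimately show False using HL[of "\<lambda>i. t * y i"] by (auto simp: y_def)
      qed
      have "R a0 = 0"
      proof (rule monomials_independent[where J = "{1..k}" and I = "I''" and R = R and a = a0])
        show "infinite (UNIV :: 'a set)" by (rule infinite_alg_closed)
        show "finite I''" using I' by (auto simp: I''_def)
        show "(\<Sum>a\<in>I''. R a * (\<Prod>j\<in>{1..k}. x j ^ a j)) = 0" for x using L0[of x] by (simp add: L_def)
        show "a0 \<in> I''" by fact
        \<comment> \<open>In the limit \<open>F 0\<close> contributes no variable, but its exponent
          is recovered from the others because the total degree is \<open>m\<close>.\<close>
        fix a b assume a: "a \<in> I''" and b: "b \<in> I''" and ab: "\<And>j. j \<in> {1..k} \<Longrightarrow> a j = b j"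
        have split: "?w a = a 0 + (\<Sum>j\<in>{1..k}. a j)" for a
        proof -
          have "{..k} = insert 0 {1..k}" by auto
          then show ?thesis by simp
        qed
        have "(\<Sum>j\<in>{1..k}. a j) = (\<Sum>j\<in>{1..k}. b j)" using ab by (intro sum.cong) auto
        with a b split[of a] split[of b] have "a 0 = b 0" by (simp add: I''_def)
        with ab have "a j = b j" if "j \<le> k" for j using that by (cases "j = 0") auto
        then show "a = b"
          using a b by (intro PiE_ext[of a "{..k}" "\<lambda>_. {..n}"]) (auto simp: I''_def I'_def)
      qed simp
      with a0 show False by (simp add: I''_def I'_def)
    qed
  qed
  show ?thesis
  proof (rule krull_dim_geI[where Z = Z])
    fix i
    have "closedin (subtopology zariski Y) (Z i)"
      unfolding Z_def using ZX[of i] by (intro closedin_subset_topspace) (auto simp: Z_def)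
    moreover have "subtopology (subtopology zariski Y) (Z i) = subtopology zariski (Z i)"
      using ZX[of i] by (simp add: subtopology_subtopology Int_absorb1)
    ultimately show "closedin (subtopology zariski Y) (Z i) \<and> irreducible_space (subtopology (subtopology zariski Y) (Z i))"
      using irr by simp
  next
    show "Z i \<subset> Z (Suc i)" if "i < d" for i using strict that .
  qed
qed

lemma zariski_closureD:
  assumes "A \<in> zariski closure_of S" "f \<in> matrix_poly_funs" "\<And>B. B \<in> S \<Longrightarrow> f B = 0"
  shows "f A = 0"
  using assms(1)[unfolded in_zariski_closure_iff, rule_format, OF assms(2)] assms(3) by blast

section \<open>Word maps\<close>

lemma matrix_inv_eqI:
  fixes A B :: "'a::field^'n^'n"
  assumes "A ** B = mat 1" shows "matrix_inv A = B"
proof -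
  have "B ** A = mat 1" using assms matrix_left_right_inverse by blast
  then have "\<exists>B. A ** B = mat 1 \<and> B ** A = mat 1" using assms by blast
  then have "matrix_inv A ** A = mat 1"
    unfolding matrix_inv_def by (rule someI2_ex) blast
  then have "matrix_inv A ** (A ** B) = B" by (simp add: matrix_mul_assoc)
  then show ?thesis by (simp add: assms)
qed

lemma matrix_inv_mult:
  fixes A :: "'a::field^'n^'n"
  assumes "invertible A"
  shows "A ** matrix_inv A = mat 1" "matrix_inv A ** A = mat 1"
  using assms matrix_inv_eqI unfolding invertible_def by metis+

text \<open>Cramer's rule with division by \<open>det A\<close> replaced by multiplication, which is
  the same where \<open>det A ^ 2 = 1\<close>. Unlike \<open>matrix_inv\<close> it is polynomial in
  the entries, hence compatible with Zariski closures.\<close>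

definition adjugate_inv :: "'a::field^'n^'n \<Rightarrow> 'a^'n^'n" where
  "adjugate_inv A = (\<chi> k b. det (\<chi> i j. if j = k then axis b 1 $ i else A $ i $ j) * det A)"

lemma adjugate_inv:
  fixes A :: "'a::field^'n^'n"
  assumes "det A ^ 2 = 1"
  shows "A ** adjugate_inv A = mat 1" and "matrix_inv A = adjugate_inv A"
proof -
  have d: "det A \<noteq> 0" "inverse (det A) = det A"
    using assms by (auto simp: power2_eq_square intro: inverse_unique)
  have "A *v column b (adjugate_inv A) = axis b 1" for b
    unfolding cramer[OF d(1)]
    using d(2) by (simp add: adjugate_inv_def column_def vec_eq_iff divide_inverse)
  then have "(A ** adjugate_inv A) $ i $ b = mat 1 $ i $ b" for i b
    unfolding vec_eq_iff
    by (simp add: matrix_matrix_mult_def matrix_vector_mult_def column_def axis_def mat_def)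
  then show "A ** adjugate_inv A = mat 1" by (simp add: vec_eq_iff)
  then show "matrix_inv A = adjugate_inv A" by (rule matrix_inv_eqI)
qed

lemma (in fun_alg) adjugate_inv:
  assumes "\<And>i j. (\<lambda>x. M x $ i $ j) \<in> R"
  shows "(\<lambda>x. adjugate_inv (M x) $ i $ j) \<in> R"
proof -
  have "(\<lambda>x. (\<chi> a b. if b = i then axis j 1 $ a else M x $ a $ b) $ a $ b) \<in> R" for a b
    by (cases "b = i") (simp_all add: assms const_fun)
  then have "(\<lambda>x. det (\<chi> a b. if b = i then axis j 1 $ a else M x $ a $ b) * det (M x)) \<in> R"
    by (intro mult_fun det assms)
  then show ?thesis by (simp add: adjugate_inv_def)
qed

lemma closure_of_det_square:
  assumes "\<And>g. g \<in> \<Gamma> \<Longrightarrow> det g ^ 2 = 1" "h \<in> zariski closure_of \<Gamma>"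
  shows "det h ^ 2 = 1"
proof -
  have "(\<lambda>A. det A ^ 2 - 1) \<in> matrix_poly_funs"
    by (intro matrix_polys.diff matrix_polys.power matrix_polys.det matrix_polys.const_fun matrix_poly_funs.entry)
  with assms show ?thesis unfolding in_zariski_closure_iff by fastforce
qed

text \<open>Inverses of \<open>h\<close> can be replaced by \<open>adjugate_inv h\<close>. This
  expresses continuity of the word map in the variable \<open>k\<close> while the other variables
  are fixed.\<close>

lemma word_value_poly:
  fixes ls :: "(nat \<times> bool \<times> ('a::field^'n^'n)) list"
  shows "\<exists>\<Phi>. (\<forall>a b. (\<lambda>h. \<Phi> h $ a $ b) \<in> matrix_poly_funs) \<and>
    (\<forall>h. det h ^ 2 = 1 \<longrightarrow> word_value (c, ls) (g(k := h)) = \<Phi> h)"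
proof (induction ls arbitrary: c)
  case Nil
  show ?case by (intro exI[of _ "\<lambda>_. c"]) (auto intro: matrix_polys.const_fun)
next
  case (Cons l ls)
  obtain i \<epsilon> d where l: "l = (i, \<epsilon>, d)" by (metis prod_cases3)
  from Cons[of d] obtain \<Phi> where \<Phi>: "\<And>a b. (\<lambda>h. \<Phi> h $ a $ b) \<in> matrix_poly_funs"
    "\<And>h. det h ^ 2 = 1 \<Longrightarrow> word_value (d, ls) (g(k := h)) = \<Phi> h" by blast
  define \<Psi> where "\<Psi> = (\<lambda>h. if i = k then (if \<epsilon> then h else adjugate_inv h) else (if \<epsilon> then g i else matrix_inv (g i)))"
  have \<Psi>: "(\<lambda>h. \<Psi> h $ a $ b) \<in> matrix_poly_funs" for a b
    unfolding \<Psi>_def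
    by (cases "i = k"; cases \<epsilon>)
      (simp_all add: matrix_polys.const_fun matrix_polys.adjugate_inv matrix_poly_funs.entry)
  show ?case
  proof (intro exI[of _ "\<lambda>h. c ** \<Psi> h ** \<Phi> h"] conjI allI impI)
    show "(\<lambda>h. (c ** \<Psi> h ** \<Phi> h) $ a $ b) \<in> matrix_poly_funs" for a b
      by (intro matrix_polys.matrix_mult matrix_polys.const_fun \<Psi> \<Phi>)
    fix h :: "'a^'n^'n" assume "det h ^ 2 = 1"
    then show "word_value (c, l # ls) (g(k := h)) = c ** \<Psi> h ** \<Phi> h"
      by (simp add: l \<Phi> \<Psi>_def adjugate_inv(2))
  qed
qed

text \<open>Separate continuity suffices: the variables move from \<open>\<Gamma>\<close> to its
  closure one at a time, the first \<open>k\<close> of them after \<open>k\<close> steps.\<close>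

lemma word_value_in_closure:
  fixes w :: "('a::field^'n^'n) cword"
  assumes w: "w \<in> words C r" and \<Gamma>: "\<And>g. g \<in> \<Gamma> \<Longrightarrow> det g ^ 2 = 1" and "\<Gamma> \<subseteq> G"
    and h: "\<And>i. i < r \<Longrightarrow> h i \<in> zariski closure_of \<Gamma>"
  shows "word_value w h \<in> zariski closure_of (word_image w r G)"
proof -
  have "\<forall>h. (\<forall>i<r. h i \<in> zariski closure_of \<Gamma>) \<longrightarrow> (\<forall>i<r. i \<ge> k \<longrightarrow> h i \<in> \<Gamma>) \<longrightarrow>
     word_value w h \<in> zariski closure_of (word_image w r G)" for k
  proof (induction k)
    case 0
    show ?case
    proof (intro allI impI)
      fix h assume "\<forall>i<r. i \<ge> 0 \<longrightarrow> h i \<in> \<Gamma>"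
      then have "word_value w h \<in> word_image w r G"
        using assms(3) unfolding word_image_def by auto
      then show "word_value w h \<in> zariski closure_of (word_image w r G)"
        using closure_of_subset[of "word_image w r G" zariski] by auto
    qed
  next
    case (Suc k)
    show ?case
    proof (intro allI impI)
      fix h assume h: "\<forall>i<r. h i \<in> zariski closure_of \<Gamma>" "\<forall>i<r. i \<ge> Suc k \<longrightarrow> h i \<in> \<Gamma>"
      show "word_value w h \<in> zariski closure_of (word_image w r G)"
      proof (cases "k < r")
        case False
        then show ?thesis using Suc h by auto
      next
        case True
        obtain \<Phi> where \<Phi>: "\<And>a b. (\<lambda>h. \<Phi> h $ a $ b) \<in> matrix_poly_funs"
           "\<And>m. det m ^ 2 = 1 \<Longrightarrow> word_value w (h(k := m)) = \<Phi> m"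
          using word_value_poly[of "fst w" "snd w" h k] by auto
        have step: "\<Phi> m \<in> zariski closure_of (word_image w r G)" if "m \<in> \<Gamma>" for m
        proof -
          have "m \<in> zariski closure_of \<Gamma>" using closure_of_subset[of \<Gamma> zariski] that by auto
          then have "word_value w (h(k := m)) \<in> zariski closure_of (word_image w r G)"
            using h that by (intro Suc.IH[rule_format]) auto
          then show ?thesis using \<Phi>(2) \<Gamma>[OF that] by simp
        qed
        have hk: "h k \<in> zariski closure_of \<Gamma>" using h True by blast
        have "\<Phi> (h k) \<in> zariski closure_of (word_image w r G)"
          unfolding in_zariski_closure_iff
        proof (intro ballI impI)
          fix f :: "'a^'n^'n \<Rightarrow> 'a" assume f: "f \<in> matrix_poly_funs" "\<forall>B\<in>word_image w r G. f B = 0"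
          have "(\<lambda>m. f (\<Phi> m)) \<in> matrix_poly_funs"
            by (rule matrix_polys.matrix_poly_comp[OF f(1) \<Phi>(1)])
          moreover have "\<forall>m\<in>\<Gamma>. f (\<Phi> m) = 0"
            using zariski_closureD[OF step f(1)] f(2) by blast
          ultimately show "f (\<Phi> (h k)) = 0" using zariski_closureD[OF hk] by blast
        qed
        moreover have "word_value w h = \<Phi> (h k)"
          using \<Phi>(2)[OF closure_of_det_square[OF \<Gamma> hk]] by simp
        ultimately show ?thesis by simp
      qed
    qed
  qed
  from this[of r] h show ?thesis by auto
qed

section \<open>Letters attached to pairs of flags\<close>

text \<open>
  A flag is a vector \<open>p\<close> together with a linear functional \<open>q\<close>, given by its coefficients, that
  vanishes at \<open>p\<close>. For two opposite flags \<open>(p, q)\<close> and \<open>(p', q')\<close>, the letter scales \<open>p\<close> by \<open>s\<close> and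
  \<open>p'\<close> by \<open>1/s\<close>, and fixes the common kernel of \<open>q\<close> and \<open>q'\<close>.
\<close>

type_synonym ('a, 'n) flag = "('a^'n) \<times> ('a^'n)"

definition opposite :: "('a::field, 'n::finite) flag \<Rightarrow> ('a, 'n) flag \<Rightarrow> bool" where
  "opposite z z' \<longleftrightarrow> pair (fst z) (snd z') \<noteq> 0 \<and> pair (fst z') (snd z) \<noteq> 0"

definition letter :: "('a::field, 'n::finite) flag \<Rightarrow> ('a, 'n) flag \<Rightarrow> 'a \<Rightarrow> 'a^'n^'n" where
  "letter z z' s = mat 1
     + outer (((s - 1) / pair (fst z) (snd z')) *s snd z') (fst z)
     + outer (((1 / s - 1) / pair (fst z') (snd z)) *s snd z) (fst z')"

lemma vector_letter: "v v* letter z z' s = v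
     + ((s - 1) / pair (fst z) (snd z') * pair v (snd z')) *s fst z
     + ((1 / s - 1) / pair (fst z') (snd z) * pair v (snd z)) *s fst z'"
  by (simp add: letter_def vector_matrix_mult_add_rdistrib vector_outer pair_simps)

lemma letter_swap: "letter z' z (1 / s) = letter z z' s"
  by (simp add: letter_def add_ac)

lemma letter_inverse:
  assumes z: "pair (fst z) (snd z) = 0" "pair (fst z') (snd z') = 0" "opposite z z'" and s: "s \<noteq> 0"
  shows "letter z z' s ** letter z z' (1 / s) = mat 1"
proof (rule vector_matrix_eqI)
  fix v
  have *: "(s - 1) * (1 / s - 1) + (s - 1) + (1 / s - 1) = 0" using s by (simp add: field_simps)
  show "v v* (letter z z' s ** letter z z' (1 / s)) = v v* mat 1"
    unfolding vector_matrix_mul_assoc[symmetric] vector_letter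
    using z s by (simp add: vec_eq_iff pair_simps opposite_def field_simps)
qed

text \<open>The inverse has parameter \<open>1 / s\<close>, and inverting the parameter exchanges
  the two flags. A variable with exponent -1 is thus replaced by a letter with the same parameter,
  which grows at the same rate.\<close>

lemma matrix_inv_letter:
  assumes "pair (fst z) (snd z) = 0" "pair (fst z') (snd z') = 0" "opposite z z'" "s \<noteq> 0"
  shows "matrix_inv (letter z z' s) = letter z' z s"
  using matrix_inv_eqI[OF letter_inverse[OF assms]] letter_swap[of z' z s]
  by (metis letter_swap)

text \<open>The letter with parameter \<open>1/y\<close>, cleared of the denominator \<open>y\<close>; \<open>\<kappa>\<close> and \<open>\<kappa>'\<close> are the two pairings.\<close>

definition scaled_letter :: "'a \<Rightarrow> 'a \<Rightarrow> ('a::field, 'n::finite) flag \<Rightarrow> ('a, 'n) flag \<Rightarrow> 'a \<Rightarrow> 'a^'n^'n" where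
  "scaled_letter \<kappa> \<kappa>' z z' y = smat y (mat 1)
     + outer (((1 - y) / \<kappa>) *s snd z') (fst z) + outer (((y\<^sup>2 - y) / \<kappa>') *s snd z) (fst z')"

lemma scaled_letter_eq:
  assumes "y \<noteq> 0"
  shows "scaled_letter (pair (fst z) (snd z')) (pair (fst z') (snd z)) z z' y = smat y (letter z z' (1 / y))"
proof (rule vector_matrix_eqI)
  fix v
  let ?k = "pair (fst z) (snd z')" and ?k' = "pair (fst z') (snd z)"
  have e: "y * (1 / y - 1) = 1 - y" "y * (y - 1) = y\<^sup>2 - y"
    using assms by (simp_all add: right_diff_distrib power2_eq_square) have "v v* smat y (letter z z' (1 / y)) = y *s v
      + (y * ((1 / y - 1) / ?k) * pair v (snd z')) *s fst z
      + (y * ((1 / (1 / y) - 1) / ?k') * pair v (snd z)) *s fst z'"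
    by (simp only: vector_smat vector_letter vec.scale_right_distrib vec.scale_scale mult.assoc)
  then show "v v* scaled_letter ?k ?k' z z' y = v v* smat y (letter z z' (1 / y))"
    by (simp add: scaled_letter_def vector_smat vector_matrix_mult_add_rdistrib vector_outer pair_simps e)
qed

section \<open>Dimension of the image of a word map\<close>

text \<open>The flag \<open>z i \<epsilon>\<close> dominates where the variable \<open>i\<close> has
  exponent \<open>\<epsilon>\<close>. The pairings \<open>\<kappa>\<close> are separate arguments
  because they stay constant while the flags vary; dividing by constants keeps the entries
  polynomial.\<close>

fun scaled_word :: "(nat \<Rightarrow> bool \<Rightarrow> 'a) \<Rightarrow> (nat \<Rightarrow> bool \<Rightarrow> ('a::field, 'n::finite) flag) \<Rightarrow> 'a \<Rightarrow>
    ('a^'n^'n) cword \<Rightarrow> 'a^'n^'n" where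
  "scaled_word \<kappa> z y (c\<^sub>0, []) = c\<^sub>0"
| "scaled_word \<kappa> z y (c\<^sub>0, (i, \<epsilon>, c) # ls) =
     c\<^sub>0 ** scaled_letter (\<kappa> i \<epsilon>) (\<kappa> i (\<not> \<epsilon>)) (z i \<epsilon>) (z i (\<not> \<epsilon>)) y ** scaled_word \<kappa> z y (c, ls)"

lemma scaled_word_eq:
  assumes "y \<noteq> 0" and \<kappa>: "\<And>i \<epsilon>. \<kappa> i \<epsilon> = pair (fst (z i \<epsilon>)) (snd (z i (\<not> \<epsilon>)))"
    and z: "\<And>i \<epsilon>. i < r \<Longrightarrow> pair (fst (z i \<epsilon>)) (snd (z i \<epsilon>)) = 0" "\<And>i. i < r \<Longrightarrow> opposite (z i True) (z i False)"
    and "\<And>i \<epsilon> c. (i, \<epsilon>, c) \<in> set ls \<Longrightarrow> i < r"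
  shows "smat (1 / y ^ length ls) (scaled_word \<kappa> z y (c\<^sub>0, ls)) =
    word_value (c\<^sub>0, ls) (\<lambda>i. letter (z i True) (z i False) (1 / y))"
  using assms(5)
proof (induction ls arbitrary: c\<^sub>0)
  case (Cons l ls)
  obtain i \<epsilon> c where l: "l = (i, \<epsilon>, c)" by (metis prod_cases3)
  have i: "i < r" using Cons.prems by (auto simp: l)
  let ?g = "letter (z i \<epsilon>) (z i (\<not> \<epsilon>)) (1 / y)"
  have g: "(if \<epsilon> then letter (z i True) (z i False) (1 / y) else matrix_inv (letter (z i True) (z i False) (1 / y))) = ?g"
    using matrix_inv_letter[OF z(1)[OF i] z(1)[OF i] z(2)[OF i], of "1 / y"] assms(1) by simp
  have s: "scaled_letter (\<kappa> i \<epsilon>) (\<kappa> i (\<not> \<epsilon>)) (z i \<epsilon>) (z i (\<not> \<epsilon>)) y = smat y ?g"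
    using scaled_letter_eq[OF assms(1), of "z i \<epsilon>" "z i (\<not> \<epsilon>)"] by (simp add: \<kappa>)
  have IH: "smat (1 / y ^ length ls) (scaled_word \<kappa> z y (c, ls)) =
      word_value (c, ls) (\<lambda>i. letter (z i True) (z i False) (1 / y))"
    using Cons.prems by (intro Cons.IH) auto
  have "smat (1 / y ^ length (l # ls)) (scaled_word \<kappa> z y (c\<^sub>0, l # ls)) =
      smat (1 / y ^ length (l # ls) * y) (c\<^sub>0 ** ?g ** scaled_word \<kappa> z y (c, ls))"
    by (simp add: l s smat_mult smat_smat)
  also have "1 / y ^ length (l # ls) * y = 1 / y ^ length ls" using assms(1) by simp
  also have "smat (1 / y ^ length ls) (c\<^sub>0 ** ?g ** scaled_word \<kappa> z y (c, ls)) =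
      c\<^sub>0 ** ?g ** smat (1 / y ^ length ls) (scaled_word \<kappa> z y (c, ls))"
    by (simp add: smat_mult)
  also have "\<dots> = word_value (c\<^sub>0, l # ls) (\<lambda>i. letter (z i True) (z i False) (1 / y))"
    by (simp only: IH l word_value.simps g)
  finally show ?case .
qed simp

lemma (in fun_alg) scaled_word:
  assumes z: "\<And>i \<epsilon> a. (\<lambda>x. fst (z x i \<epsilon>) $ a) \<in> R" "\<And>i \<epsilon> a. (\<lambda>x. snd (z x i \<epsilon>) $ a) \<in> R" and y: "y \<in> R"
  shows "(\<lambda>x. scaled_word \<kappa> (z x) (y x) (c\<^sub>0, ls) $ a $ b) \<in> R"
proof (induction ls arbitrary: c\<^sub>0 a b)
  case Nil
  show ?case by (simp add: const_fun)
next
  case (Cons l ls)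
  obtain i \<epsilon> c where l: "l = (i, \<epsilon>, c)" by (metis prod_cases3)
  have "(\<lambda>x. ((1 - y x) / \<kappa> i \<epsilon>) * snd (z x i (\<not> \<epsilon>)) $ a) \<in> R"
    "(\<lambda>x. (((y x)\<^sup>2 - y x) / \<kappa> i (\<not> \<epsilon>)) * snd (z x i \<epsilon>) $ a) \<in> R" for a
    by (intro mult_fun divide_const diff const_fun y z power)+
  then have "(\<lambda>x. scaled_letter (\<kappa> i \<epsilon>) (\<kappa> i (\<not> \<epsilon>)) (z x i \<epsilon>) (z x i (\<not> \<epsilon>)) (y x) $ a $ b) \<in> R" for a b
    unfolding scaled_letter_def by (simp, intro add_fun smat outer y z const_fun) simp_all
  then show ?case
    unfolding l scaled_word.simps by (intro matrix_mult const_fun Cons.IH)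
qed

text \<open>
  At \<open>y = 0\<close> each letter has rank one, so the word sends every vector to a multiple of a fixed
  vector; the factor is the product of the pairings at the junctions.
\<close>

fun junction_prod :: "(nat \<Rightarrow> bool \<Rightarrow> 'a) \<Rightarrow> (nat \<Rightarrow> bool \<Rightarrow> ('a::field, 'n::finite) flag) \<Rightarrow> 'a^'n \<Rightarrow>
    ('a^'n^'n) cword \<Rightarrow> 'a" where
  "junction_prod \<kappa> z v (c\<^sub>0, []) = 1"
| "junction_prod \<kappa> z v (c\<^sub>0, (i, \<epsilon>, c) # ls) =
     pair (v v* c\<^sub>0) (snd (z i (\<not> \<epsilon>))) / \<kappa> i \<epsilon> * junction_prod \<kappa> z (fst (z i \<epsilon>)) (c, ls)"

lemma vector_scaled_word_0:
  assumes "ls \<noteq> []" "last ls = (i, \<epsilon>, c)"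
  shows "v v* scaled_word \<kappa> z 0 (c\<^sub>0, ls) = junction_prod \<kappa> z v (c\<^sub>0, ls) *s (fst (z i \<epsilon>) v* c)"
  using assms
proof (induction ls arbitrary: v c\<^sub>0)
  case (Cons l ls)
  obtain i' \<epsilon>' c' where l: "l = (i', \<epsilon>', c')" by (metis prod_cases3)
  have "v v* scaled_word \<kappa> z 0 (c\<^sub>0, l # ls) =
      (pair (v v* c\<^sub>0) (snd (z i' (\<not> \<epsilon>'))) / \<kappa> i' \<epsilon>') *s (fst (z i' \<epsilon>') v* scaled_word \<kappa> z 0 (c', ls))"
    by (simp add: l scaled_letter_def vector_matrix_mul_assoc[symmetric] vector_smat
        vector_matrix_mult_add_rdistrib vector_outer pair_simps scalar_vector_matrix_assoc)
  then show ?case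
  proof (cases "ls = []")
    case True
    then show ?thesis using Cons.prems \<open>v v* scaled_word \<kappa> z 0 (c\<^sub>0, l # ls) = _\<close> by (simp add: l)
  next
    case False
    then show ?thesis using Cons.prems Cons.IH[of "fst (z i' \<epsilon>')" c'] \<open>v v* scaled_word \<kappa> z 0 (c\<^sub>0, l # ls) = _\<close>
      by (simp add: l)
  qed
qed simp

text \<open>At a junction the vector of \<open>z i \<epsilon>\<close> meets the functional of
  \<open>z i' (\<not> \<epsilon>')\<close>. Both belong to the same flag exactly when
  \<open>i' = i\<close> and \<open>\<epsilon>' = (\<not> \<epsilon>)\<close>, that is, at a critical
  constant.\<close>

lemma junction_prod_nonzero:
  assumes "\<And>i \<epsilon> c ms. ls = (i, \<epsilon>, c) # ms \<Longrightarrow> pair (v v* c\<^sub>0) (snd (z i (\<not> \<epsilon>))) \<noteq> 0"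
    and "\<And>j i \<epsilon> c i' \<epsilon>' c'. Suc j < length ls \<Longrightarrow> ls ! j = (i, \<epsilon>, c) \<Longrightarrow> ls ! Suc j = (i', \<epsilon>', c') \<Longrightarrow>
       pair (fst (z i \<epsilon>) v* c) (snd (z i' (\<not> \<epsilon>'))) \<noteq> 0"
    and "\<And>i \<epsilon> c. (i, \<epsilon>, c) \<in> set ls \<Longrightarrow> \<kappa> i \<epsilon> \<noteq> 0"
  shows "junction_prod \<kappa> z v (c\<^sub>0, ls) \<noteq> 0"
  using assms
proof (induction ls arbitrary: v c\<^sub>0)
  case (Cons l ls)
  obtain i \<epsilon> c where l: "l = (i, \<epsilon>, c)" by (metis prod_cases3)
  have "junction_prod \<kappa> z (fst (z i \<epsilon>)) (c, ls) \<noteq> 0"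
  proof (rule Cons.IH)
    show "pair (fst (z i \<epsilon>) v* c) (snd (z i' (\<not> \<epsilon>'))) \<noteq> 0" if "ls = (i', \<epsilon>', c') # ms" for i' \<epsilon>' c' ms
      using Cons.prems(2)[of 0 i \<epsilon> c i' \<epsilon>' c'] that by (simp add: l)
    show "pair (fst (z i \<epsilon>) v* c) (snd (z i' (\<not> \<epsilon>'))) \<noteq> 0"
      if "Suc j < length ls" "ls ! j = (i, \<epsilon>, c)" "ls ! Suc j = (i', \<epsilon>', c')" for j i \<epsilon> c i' \<epsilon>' c'
      using Cons.prems(2)[of "Suc j" i \<epsilon> c i' \<epsilon>' c'] that by simp
    show "\<kappa> i \<epsilon> \<noteq> 0" if "(i, \<epsilon>, c) \<in> set ls" for i \<epsilon> c
      using Cons.prems(3)[of i \<epsilon> c] that by simp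
  qed
  then show ?case
    using Cons.prems(1)[of i \<epsilon> c ls] Cons.prems(3)[of i \<epsilon> c] by (simp add: l)
qed simp

text \<open>The junction conditions seen from one flag while all others are fixed: a critical
  junction involves the flag twice, any other only through its vector or only through its
  functional.\<close>

definition flag_tests :: "(('a::field, 'n::finite) flag \<Rightarrow> 'a) set" where
  "flag_tests = range (\<lambda>c z. pair (fst z v* c) (snd z)) \<union> range (\<lambda>a z. pair (fst z) a) \<union> range (\<lambda>a z. pair a (snd z))"

text \<open>
  Irreducibility of a set of flags, in the form in which it is used: any two flags are joined by a
  rational curve on which no test that is nonzero at one of them vanishes identically.
\<close>

definition curve_connected :: "('a::field, 'n::finite) flag set \<Rightarrow> bool" where
  "curve_connected C \<longleftrightarrow> (\<forall>z1\<in>C. \<forall>z2\<in>C. \<exists>\<gamma> :: 'a \<Rightarrow> ('a, 'n) flag. (\<forall>s. \<gamma> s \<in> C) \<and>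
     (\<forall>f\<in>flag_tests. f z1 \<noteq> 0 \<or> f z2 \<noteq> 0 \<longrightarrow> finite {s. f (\<gamma> s) = 0}))"

text \<open>By induction one flag passes the old tests and another one the new test. On the curve
  joining them each test fails for finitely many parameters only.\<close>

lemma common_nonzero_flag:
  fixes C :: "('a::alg_closed_field, 'n::finite) flag set"
  assumes "curve_connected C" "C \<noteq> {}" "finite F" "F \<subseteq> flag_tests" "\<And>f. f \<in> F \<Longrightarrow> \<exists>z\<in>C. f z \<noteq> 0"
  shows "\<exists>z\<in>C. \<forall>f\<in>F. f z \<noteq> 0"
  using assms(3-)
proof (induction F)
  case empty
  then show ?case using assms(2) by auto
next
  case (insert g F)
  obtain z1 where z1: "z1 \<in> C" "\<forall>f\<in>F. f z1 \<noteq> 0" using insert.IH insert.prems by auto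
  obtain z2 where z2: "z2 \<in> C" "g z2 \<noteq> 0" using insert.prems(2)[of g] by auto
  obtain \<gamma> :: "'a \<Rightarrow> ('a, 'n) flag" where \<gamma>: "\<forall>s. \<gamma> s \<in> C" "\<forall>f\<in>flag_tests. f z1 \<noteq> 0 \<or> f z2 \<noteq> 0 \<longrightarrow> finite {s. f (\<gamma> s) = 0}"
    using bspec[OF bspec[OF assms(1)[unfolded curve_connected_def] z1(1)] z2(1)] by (elim exE conjE)
  have "finite {s. f (\<gamma> s) = 0}" if "f \<in> insert g F" for f
  proof -
    have "f \<in> flag_tests" "f z1 \<noteq> 0 \<or> f z2 \<noteq> 0"
      using that z1(2) z2(2) insert.prems(1) by blast+
    with \<gamma>(2) show ?thesis by blast
  qed
  then have "finite (\<Union>f\<in>insert g F. {s. f (\<gamma> s) = 0})" using insert.hyps(1) by (intro finite_UN_I) auto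
  then obtain s where "s \<notin> (\<Union>f\<in>insert g F. {s. f (\<gamma> s) = 0})"
    by (rule ex_new_if_finite[OF infinite_alg_closed, THEN exE])
  then show ?case using \<gamma>(1) by (intro bexI[of _ "\<gamma> s"]) auto
qed

text \<open>A triple \<open>(a, c, b)\<close> stands for the vector of flag \<open>a\<close> meeting
  the functional of flag \<open>b\<close> across the constant \<open>c\<close>. The flags are chosen
  one after another, each generic with respect to the earlier ones; only triples with equal ends
  need more than invertibility of \<open>c\<close>.\<close>

lemma generic_flags:
  fixes C :: "('a::alg_closed_field, 'n::finite) flag set" and J :: "('i \<times> ('a^'n^'n) \<times> 'i) set"
  assumes C: "curve_connected C" "\<And>a. a \<noteq> 0 \<Longrightarrow> \<exists>z\<in>C. pair (fst z) a \<noteq> 0"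
      "\<And>a. a \<noteq> 0 \<Longrightarrow> \<exists>z\<in>C. pair a (snd z) \<noteq> 0"
    and I: "finite I" and J: "finite J"
      "\<And>a c b. (a, c, b) \<in> J \<Longrightarrow> invertible c"
      "\<And>a c. (a, c, a) \<in> J \<Longrightarrow> \<exists>z\<in>C. pair (fst z v* c) (snd z) \<noteq> 0"
  shows "\<exists>z. (\<forall>a\<in>I. z a \<in> C \<and> fst (z a) \<noteq> 0 \<and> snd (z a) \<noteq> 0) \<and>
    (\<forall>(a, c, b)\<in>J. a \<in> I \<longrightarrow> b \<in> I \<longrightarrow> pair (fst (z a) v* c) (snd (z b)) \<noteq> 0)"
  using I
proof (induction I)
  case empty
  show ?case by auto
next
  case (insert a I)
  then obtain z where z: "\<And>b. b \<in> I \<Longrightarrow> z b \<in> C \<and> fst (z b) \<noteq> 0 \<and> snd (z b) \<noteq> 0"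
    "\<And>b c d. (b, c, d) \<in> J \<Longrightarrow> b \<in> I \<Longrightarrow> d \<in> I \<Longrightarrow> pair (fst (z b) v* c) (snd (z d)) \<noteq> 0" by fast
  obtain a0 :: "'a^'n" where a0: "a0 \<noteq> 0" by (metis axis_eq_0_iff zero_neq_one)
  \<comment> \<open>\<open>F1\<close> collects the triples with both ends at the new flag,
    \<open>F2\<close> and \<open>F3\<close> those whose other end is an earlier flag, and
    \<open>F4\<close> makes the vector and the functional of the new flag nonzero.\<close>
  define F1 where "F1 = (\<lambda>(b, c, d) (x :: ('a, 'n) flag). pair (fst x v* c) (snd x)) ` {(b, c, d) \<in> J. b = a \<and> d = a}"
  define F2 where "F2 = (\<lambda>(b, c, d) (x :: ('a, 'n) flag). pair (fst x) (c *v snd (z d))) ` {(b, c, d) \<in> J. b = a \<and> d \<in> I}"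
  define F3 where "F3 = (\<lambda>(b, c, d) (x :: ('a, 'n) flag). pair (fst (z b) v* c) (snd x)) ` {(b, c, d) \<in> J. b \<in> I \<and> d = a}"
  define F4 where "F4 = {\<lambda>x :: ('a, 'n) flag. pair (fst x) a0, \<lambda>x. pair a0 (snd x)}"
  have "\<exists>x\<in>C. \<forall>f\<in>F1 \<union> F2 \<union> F3 \<union> F4. f x \<noteq> 0"
  proof (rule common_nonzero_flag[OF C(1)])
    show "C \<noteq> {}" using C(2)[OF a0] by auto
    show "finite (F1 \<union> F2 \<union> F3 \<union> F4)"
      unfolding F1_def F2_def F3_def F4_def
      by (intro finite_UnI finite_imageI finite_subset[OF _ J(1)]) auto
    show "F1 \<union> F2 \<union> F3 \<union> F4 \<subseteq> flag_tests"
      unfolding F1_def F2_def F3_def F4_def flag_tests_def by auto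
    have inv: "c *v q \<noteq> 0" "q v* c \<noteq> 0" if "(b, c, d) \<in> J" "q \<noteq> 0" for b c d and q :: "'a^'n"
    proof -
      from J(2)[OF that(1)] obtain c' where c': "c ** c' = mat 1" "c' ** c = mat 1"
        unfolding invertible_def by blast
      show "c *v q \<noteq> 0"
      proof
        assume "c *v q = 0"
        then have "c' *v (c *v q) = 0" by simp
        with c' that(2) show False by (simp add: matrix_vector_mul_assoc)
      qed
      show "q v* c \<noteq> 0"
      proof
        assume "q v* c = 0"
        then have "(q v* c) v* c' = 0" by simp
        with c' that(2) show False by (simp add: vector_matrix_mul_assoc)
      qed
    qed
    fix f assume "f \<in> F1 \<union> F2 \<union> F3 \<union> F4"
    then consider "f \<in> F1" | "f \<in> F2" | "f \<in> F3" | "f \<in> F4" by blast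
    then show "\<exists>z\<in>C. f z \<noteq> 0"
    proof cases
      case 1 then show ?thesis unfolding F1_def using J(3) by auto
    next
      case 2 then show ?thesis unfolding F2_def using C(2) inv(1) z(1) by auto
    next
      case 3 then show ?thesis unfolding F3_def using C(3) inv(2) z(1) by auto
    next
      case 4 then show ?thesis unfolding F4_def using C(2,3)[OF a0] by auto
    qed
  qed
  then obtain x where x: "x \<in> C" "\<And>f. f \<in> F1 \<union> F2 \<union> F3 \<union> F4 \<Longrightarrow> f x \<noteq> 0" by blast
  have x0: "fst x \<noteq> 0" "snd x \<noteq> 0"
    using x(2)[of "\<lambda>x. pair (fst x) a0"] x(2)[of "\<lambda>x. pair a0 (snd x)"] by (auto simp: F4_def pair_simps)
  show ?case
  proof (intro exI[of _ "z(a := x)"] conjI ballI)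
    fix b assume "b \<in> insert a I"
    then show "(z(a := x)) b \<in> C" "fst ((z(a := x)) b) \<noteq> 0" "snd ((z(a := x)) b) \<noteq> 0"
      using z(1)[of b] x(1) x0 by auto
  next
    fix t assume "t \<in> J"
    moreover obtain b c d where t: "t = (b, c, d)" by (metis prod_cases3)
    ultimately have bcd: "(b, c, d) \<in> J" by simp
    have "pair (fst ((z(a := x)) b) v* c) (snd ((z(a := x)) d)) \<noteq> 0" if bd: "b \<in> insert a I" "d \<in> insert a I"
    proof -
      consider "b = a" "d = a" | "b = a" "d \<noteq> a" | "b \<noteq> a" "d = a" | "b \<noteq> a" "d \<noteq> a" by blast
      then show ?thesis
      proof cases
        case 1
        then have "(\<lambda>x. pair (fst x v* c) (snd x)) \<in> F1" unfolding F1_def using bcd by force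
        then show ?thesis using x(2) 1 by auto
      next
        case 2
        then have "(\<lambda>x. pair (fst x) (c *v snd (z d))) \<in> F2" unfolding F2_def using bcd bd by force
        then show ?thesis using x(2) 2 by (auto simp: pair_vector_matrix)
      next
        case 3
        then have "(\<lambda>x. pair (fst (z b) v* c) (snd x)) \<in> F3" unfolding F3_def using bcd bd by force
        then show ?thesis using x(2) 3 by auto
      next
        case 4
        then show ?thesis using z(2) bcd bd by auto
      qed
    qed
    then show "case t of (b, c, d) \<Rightarrow> b \<in> insert a I \<longrightarrow> d \<in> insert a I \<longrightarrow>
        pair (fst ((z(a := x)) b) v* c) (snd ((z(a := x)) d)) \<noteq> 0"
      by (simp only: t split_conv) blast
  qed
qed

text \<open>
  Makes the image of the last letter run through a family with \<open>d - 1\<close> independent coordinates.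
\<close>

definition deformable :: "('a::field, 'n::finite) flag set \<Rightarrow> nat \<Rightarrow> bool" where
  "deformable C d \<longleftrightarrow> (\<forall>z\<in>C. \<forall>z'\<in>C. opposite z z' \<longrightarrow> (\<exists>Z :: (nat \<Rightarrow> 'a) \<Rightarrow> ('a, 'n) flag. \<exists>a.
     (\<forall>i. (\<lambda>x. fst (Z x) $ i) \<in> pfun) \<and> (\<forall>i. (\<lambda>x. snd (Z x) $ i) \<in> pfun) \<and>
     (\<forall>x. Z x \<in> C) \<and> Z (\<lambda>_. 0) = z \<and>
     (\<forall>x. pair (fst (Z x)) (snd z') = pair (fst z) (snd z')) \<and>
     (\<forall>x. pair (fst z') (snd (Z x)) = pair (fst z') (snd z)) \<and>
     (\<forall>x j. 0 < j \<longrightarrow> j < d \<longrightarrow> pair (fst (Z x)) (a j) = x j * pair (fst z) (snd z'))))"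

text \<open>Only the dominant flag of the last letter is deformed. At \<open>x 0 = 0\<close> this
  moves the image of the rank one limit in \<open>d - 1\<close> coordinates, while further
  occurrences of the same flag in the word only affect the common factor, the junction
  product.\<close>

theorem zariski_dim_word_image_ge:
  fixes C :: "('a::alg_closed_field, 'n::finite) flag set" and w :: "('a^'n^'n) cword"
  assumes C: "curve_connected C" "\<And>a. a \<noteq> 0 \<Longrightarrow> \<exists>z\<in>C. pair (fst z) a \<noteq> 0"
      "\<And>a. a \<noteq> 0 \<Longrightarrow> \<exists>z\<in>C. pair a (snd z) \<noteq> 0" "\<And>z. z \<in> C \<Longrightarrow> pair (fst z) (snd z) = 0"
    and def: "deformable C d"
    and \<Gamma>: "\<Gamma> \<subseteq> G" "\<And>g. g \<in> \<Gamma> \<Longrightarrow> det g ^ 2 = 1"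
      "\<And>z z' s. z \<in> C \<Longrightarrow> z' \<in> C \<Longrightarrow> opposite z z' \<Longrightarrow> s \<noteq> 0 \<Longrightarrow> letter z z' s \<in> zariski closure_of \<Gamma>"
    and w: "w \<in> words E r" "\<And>c. c \<in> E \<Longrightarrow> invertible c" "word_length w \<ge> 1"
      "\<And>c. c \<in> critical_constants w \<Longrightarrow> \<exists>z\<in>C. pair (fst z v* c) (snd z) \<noteq> 0"
    and d: "d \<ge> 1"
  shows "enat d \<le> zariski_dim (word_image w r G)"
proof -
  obtain c0 ls where w_eq: "w = (c0, ls)" by (cases w)
  have ls: "ls \<noteq> []" using w(3) by (auto simp: w_eq word_length_def)
  have inv: "invertible c0" and ls_in: "\<And>i \<epsilon> c. (i, \<epsilon>, c) \<in> set ls \<Longrightarrow> i < r \<and> invertible c"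
    using w(1,2) by (auto simp: words_def w_eq)
  \<comment> \<open>\<open>J0\<close> makes the two flags of each variable opposite, and
    \<open>J1\<close> lists the junctions of the word. The negated exponent designates the flag
    whose functional the next letter applies.\<close>
  define J0 where "J0 = (\<lambda>(i, \<epsilon>). ((i, \<epsilon>), mat 1 :: 'a^'n^'n, (i, \<not> \<epsilon>))) ` ({..<r} \<times> UNIV)"
  define J1 where "J1 = (\<lambda>j. case (ls ! j, ls ! Suc j) of ((i, \<epsilon>, c), (i', \<epsilon>', c')) \<Rightarrow> ((i, \<epsilon>), c, (i', \<not> \<epsilon>')))
     ` {j. Suc j < length ls}"
  have "\<exists>z. (\<forall>a\<in>{..<r} \<times> UNIV. z a \<in> C \<and> fst (z a) \<noteq> 0 \<and> snd (z a) \<noteq> 0) \<and>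
    (\<forall>(a, c, b)\<in>J0 \<union> J1. a \<in> {..<r} \<times> UNIV \<longrightarrow> b \<in> {..<r} \<times> UNIV \<longrightarrow> pair (fst (z a) v* c) (snd (z b)) \<noteq> 0)"
  proof (rule generic_flags[OF C(1-3)])
    show "finite ({..<r} \<times> (UNIV :: bool set))" by simp
    have "finite {j. Suc j < length ls}" by (rule finite_subset[of _ "{..length ls}"]) auto
    then show "finite (J0 \<union> J1)" unfolding J0_def J1_def by auto
    fix a c b assume J: "(a, c, b) \<in> J0 \<union> J1"
    show "invertible c"
    proof (cases "(a, c, b) \<in> J0")
      case True then show ?thesis by (auto simp: J0_def invertible_def intro!: exI[of _ "mat 1"])
    next
      case False
      with J obtain j where j: "Suc j < length ls"
        "(a, c, b) = (case (ls ! j, ls ! Suc j) of ((i, \<epsilon>, c), (i', \<epsilon>', c')) \<Rightarrow> ((i, \<epsilon>), c, (i', \<not> \<epsilon>')))"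
        unfolding J1_def by auto
      obtain i \<epsilon> c1 where 1: "ls ! j = (i, \<epsilon>, c1)" by (metis prod_cases3)
      obtain i' \<epsilon>' c2 where 2: "ls ! Suc j = (i', \<epsilon>', c2)" by (metis prod_cases3)
      have "(i, \<epsilon>, c1) \<in> set ls" using j(1) 1 by (metis Suc_lessD nth_mem)
      then show ?thesis using ls_in j(2) 1 2 by auto
    qed
  next
    fix a c assume J: "(a, c, a) \<in> J0 \<union> J1"
    moreover have "(a, c, a) \<notin> J0" by (auto simp: J0_def)
    ultimately obtain j where j: "Suc j < length ls"
        "(a, c, a) = (case (ls ! j, ls ! Suc j) of ((i, \<epsilon>, c), (i', \<epsilon>', c')) \<Rightarrow> ((i, \<epsilon>), c, (i', \<not> \<epsilon>')))"
      unfolding J1_def by auto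
    obtain i \<epsilon> c1 where 1: "ls ! j = (i, \<epsilon>, c1)" by (metis prod_cases3)
    obtain i' \<epsilon>' c2 where 2: "ls ! Suc j = (i', \<epsilon>', c2)" by (metis prod_cases3)
    have "i' = i" "\<epsilon>' = (\<not> \<epsilon>)" "c = c1" using j(2) 1 2 by auto
    then have "c \<in> critical_constants w"
      unfolding critical_constants_def w_eq word_length_def using j(1) 1 2 by auto
    then show "\<exists>z\<in>C. pair (fst z v* c) (snd z) \<noteq> 0" by (rule w(4))
  qed
  then obtain z where z: "\<And>a. a \<in> {..<r} \<times> UNIV \<Longrightarrow> z a \<in> C \<and> fst (z a) \<noteq> 0 \<and> snd (z a) \<noteq> 0"
    and zJ: "\<And>a c b. (a, c, b) \<in> J0 \<union> J1 \<Longrightarrow> a \<in> {..<r} \<times> UNIV \<Longrightarrow> b \<in> {..<r} \<times> UNIV \<Longrightarrow>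
       pair (fst (z a) v* c) (snd (z b)) \<noteq> 0" by fast
  have opp: "pair (fst (z (i, \<epsilon>))) (snd (z (i, \<not> \<epsilon>))) \<noteq> 0" if "i < r" for i \<epsilon>
  proof -
    have "((i, \<epsilon>), mat 1, (i, \<not> \<epsilon>)) \<in> J0" unfolding J0_def using that by force
    with zJ[of "(i, \<epsilon>)" "mat 1" "(i, \<not> \<epsilon>)"] that show ?thesis by simp
  qed
  obtain k \<eta> cl where last: "last ls = (k, \<eta>, cl)" by (metis prod_cases3)
  have last_in: "(k, \<eta>, cl) \<in> set ls" using ls last last_in_set by metis
  then have k: "k < r" and cl: "invertible cl" using ls_in by auto
  have opk: "opposite (z (k, \<eta>)) (z (k, \<not> \<eta>))"
    unfolding opposite_def using opp[OF k, of \<eta>] opp[OF k, of "\<not> \<eta>"] by simp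
  obtain Z :: "(nat \<Rightarrow> 'a) \<Rightarrow> ('a, 'n) flag" and a where
    Zp: "\<And>i. (\<lambda>x. fst (Z x) $ i) \<in> pfun" "\<And>i. (\<lambda>x. snd (Z x) $ i) \<in> pfun"
    and ZC: "\<And>x. Z x \<in> C" and Z0: "Z (\<lambda>_. 0) = z (k, \<eta>)"
    and Zk: "\<And>x. pair (fst (Z x)) (snd (z (k, \<not> \<eta>))) = pair (fst (z (k, \<eta>))) (snd (z (k, \<not> \<eta>)))"
      "\<And>x. pair (fst (z (k, \<not> \<eta>))) (snd (Z x)) = pair (fst (z (k, \<not> \<eta>))) (snd (z (k, \<eta>)))"
    and Za: "\<And>x j. 0 < j \<Longrightarrow> j < d \<Longrightarrow> pair (fst (Z x)) (a j) = x j * pair (fst (z (k, \<eta>))) (snd (z (k, \<not> \<eta>)))"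
  proof -
    have "z (k, \<eta>) \<in> C" "z (k, \<not> \<eta>) \<in> C" using z k by auto
    from def[unfolded deformable_def, rule_format, OF this opk] show ?thesis
      using that by (elim exE conjE) blast
  qed
  define zz where "zz = (\<lambda>x i \<epsilon>. if i = k \<and> \<epsilon> = \<eta> then Z x else z (i, \<epsilon>))"
  define \<kappa> where "\<kappa> = (\<lambda>i \<epsilon>. pair (fst (z (i, \<epsilon>))) (snd (z (i, \<not> \<epsilon>))))"
  have zz\<kappa>: "\<kappa> i \<epsilon> = pair (fst (zz x i \<epsilon>)) (snd (zz x i (\<not> \<epsilon>)))" for x i \<epsilon>
    using Zk by (cases "\<epsilon> = \<eta>") (auto simp: zz_def \<kappa>_def)
  have zzC: "zz x i \<epsilon> \<in> C" if "i < r" for x i \<epsilon>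
    using z[of "(i, \<epsilon>)"] that ZC by (auto simp: zz_def)
  have zz_opp: "opposite (zz x i True) (zz x i False)" if "i < r" for x i
    unfolding opposite_def using zz\<kappa>[of i True x] zz\<kappa>[of i False x] opp[OF that, of True] opp[OF that, of False]
    by (simp add: \<kappa>_def)
  have zz0: "zz (\<lambda>_. 0) i \<epsilon> = z (i, \<epsilon>)" for i \<epsilon> by (simp add: zz_def Z0)
  have zzp: "(\<lambda>x. fst (zz x i \<epsilon>) $ a) \<in> pfun" "(\<lambda>x. snd (zz x i \<epsilon>) $ a) \<in> pfun" for i \<epsilon> a
    unfolding zz_def by (cases "i = k \<and> \<epsilon> = \<eta>"; auto simp: Zp pfun.const)+
  obtain i1 \<epsilon>1 c1 ms where ls1: "ls = (i1, \<epsilon>1, c1) # ms" using ls by (metis neq_Nil_conv prod_cases3)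
  have i1: "i1 < r" using ls_in ls1 by auto
  \<comment> \<open>The row vector on which the limit is evaluated has to survive the first
    pairing.\<close>
  obtain v where v: "pair (v v* c0) (snd (z (i1, \<not> \<epsilon>1))) \<noteq> 0"
  proof -
    obtain c' where c': "c' ** c0 = mat 1" using inv unfolding invertible_def by blast
    have "snd (z (i1, \<not> \<epsilon>1)) \<noteq> 0" using z i1 by auto
    then obtain b where "snd (z (i1, \<not> \<epsilon>1)) $ b \<noteq> 0" by (auto simp: vec_eq_iff)
    then have "pair ((axis b 1 v* c') v* c0) (snd (z (i1, \<not> \<epsilon>1))) \<noteq> 0"
      by (simp add: vector_matrix_mul_assoc c' pair_commute[of "axis b 1"])
    then show ?thesis by (rule that)
  qed
  define N where "N = (\<lambda>x. scaled_word \<kappa> (zz x) (x 0) w)"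
  \<comment> \<open>The last constant \<open>cl\<close> is undone. Slot 0 holds the functional of
    the opposite flag, whose value is constant along the deformation and normalises the other
    coordinates.\<close>
  define b where "b = (\<lambda>j. matrix_inv cl *v (if j = 0 then snd (z (k, \<not> \<eta>)) else a j))"
  define F where "F = (\<lambda>j A. pair (v v* A) (b j))"
  have FN: "F j (N x) = junction_prod \<kappa> (zz x) v w * pair (fst (Z x)) (if j = 0 then snd (z (k, \<not> \<eta>)) else a j)"
    if "x 0 = 0" for x j
  proof -
    have "v v* N x = junction_prod \<kappa> (zz x) v w *s (fst (Z x) v* cl)"
      unfolding N_def that w_eq vector_scaled_word_0[OF ls last] by (simp add: zz_def)
    moreover have "cl *v b j = (if j = 0 then snd (z (k, \<not> \<eta>)) else a j)"
      by (simp add: b_def matrix_vector_mul_assoc matrix_inv_mult(1)[OF cl])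
    ultimately show ?thesis
      by (simp only: F_def pair_scale_left pair_vector_matrix[of "fst (Z x)"])
  qed
  define Y where "Y = zariski closure_of (word_image w r G)"
  have "enat d \<le> krull_dim (subtopology zariski Y)"
  proof (rule krull_dim_ge_degeneration[where N = N and F = F and l = "length ls"])
    show "closedin zariski Y" by (simp add: Y_def)
    show "0 < length ls" using ls by simp
    show "(\<lambda>x. N x $ i $ j) \<in> pfun" for i j
      unfolding N_def w_eq by (intro pfun.scaled_word zzp pfun.var)
    show "(\<chi> i j. N x $ i $ j / x 0 ^ length ls) \<in> Y" if "x 0 \<noteq> 0" for x
    proof -
      have "(\<chi> i j. N x $ i $ j / x 0 ^ length ls) = smat (1 / x 0 ^ length ls) (scaled_word \<kappa> (zz x) (x 0) (c0, ls))"
        by (simp add: smat_def N_def w_eq)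
      also have "\<dots> = word_value (c0, ls) (\<lambda>i. letter (zz x i True) (zz x i False) (1 / x 0))"
        using that zz\<kappa> C(4) zzC zz_opp ls_in by (intro scaled_word_eq[where r = r]) auto
      also have "\<dots> \<in> Y"
        unfolding Y_def w_eq[symmetric]
        using zzC zz_opp that by (intro word_value_in_closure[OF w(1) \<Gamma>(2) \<Gamma>(1)] \<Gamma>(3)) auto
      finally show ?thesis .
    qed
    show "F j \<in> matrix_poly_funs" for j
      unfolding F_def
      by (intro matrix_polys.pair matrix_polys.vector_matrix_mult matrix_polys.const_fun matrix_poly_funs.entry)
    show "F j (\<chi> a b. A $ a $ b / c) = F j A / c" for j A c
    proof -
      have "(\<chi> a b. A $ a $ b / c) = smat (inverse c) A" by (simp add: smat_def vec_eq_iff divide_inverse mult.commute)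
      then show ?thesis by (simp add: F_def vector_smat pair_simps divide_inverse mult.commute)
    qed
    show "F j (N x) = x j * F 0 (N x)" if "x 0 = 0" "j < d" "0 < j" for x j
      using that by (simp add: FN Za Zk)
    have "junction_prod \<kappa> (zz (\<lambda>_. 0)) v (c0, ls) \<noteq> 0"
    proof (rule junction_prod_nonzero)
      show "pair (v v* c0) (snd (zz (\<lambda>_. 0) i (\<not> \<epsilon>))) \<noteq> 0" if "ls = (i, \<epsilon>, c) # ms" for i \<epsilon> c ms
        using v that ls1 by (simp add: zz0)
      show "\<kappa> i \<epsilon> \<noteq> 0" if "(i, \<epsilon>, c) \<in> set ls" for i \<epsilon> c
        using opp[of i \<epsilon>] ls_in[OF that] by (simp add: \<kappa>_def)
      fix j i \<epsilon> c i' \<epsilon>' c'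
      assume j: "Suc j < length ls" "ls ! j = (i, \<epsilon>, c)" "ls ! Suc j = (i', \<epsilon>', c')"
      have "((i, \<epsilon>), c, (i', \<not> \<epsilon>')) \<in> J1" unfolding J1_def using j by force
      moreover have "i < r" "i' < r"
        using ls_in j nth_mem[of j ls] nth_mem[of "Suc j" ls] by auto
      ultimately show "pair (fst (zz (\<lambda>_. 0) i \<epsilon>) v* c) (snd (zz (\<lambda>_. 0) i' (\<not> \<epsilon>'))) \<noteq> 0"
        unfolding zz0 by (intro zJ) auto
    qed
    then show "F 0 (N (\<lambda>_. 0)) \<noteq> 0"
      using FN[of "\<lambda>_. 0" 0] opp[OF k, of \<eta>] by (simp add: Z0 w_eq)
  qed
  then show ?thesis by (simp add: zariski_dim_def Y_def)
qed

section \<open>Connected matrix groups\<close>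

lemma carrier_GL [simp]: "g \<in> carrier GL \<longleftrightarrow> invertible g"
  and mult_GL [simp]: "g \<otimes>\<^bsub>GL\<^esub> h = g ** h"
  and one_GL [simp]: "\<one>\<^bsub>GL\<^esub> = mat 1"
  by (simp_all add: GL_def)

interpretation GL: group "GL :: ('a::field^'n^'n) monoid"
proof (rule groupI)
  fix x y z :: "'a^'n^'n"
  show "\<one>\<^bsub>GL\<^esub> \<in> carrier (GL :: ('a^'n^'n) monoid)"
    by (auto simp: invertible_def intro: exI[of _ "mat 1"])
  assume x: "x \<in> carrier GL"
  show "\<one>\<^bsub>GL\<^esub> \<otimes>\<^bsub>GL\<^esub> x = x" by simp
  show "\<exists>y\<in>carrier GL. y \<otimes>\<^bsub>GL\<^esub> x = \<one>\<^bsub>GL\<^esub>"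
    using x by (metis carrier_GL invertible_def mult_GL one_GL)
  assume y: "y \<in> carrier GL"
  show "x \<otimes>\<^bsub>GL\<^esub> y \<in> carrier GL"
    using x y by (simp add: invertible_mult)
  assume z: "z \<in> carrier GL"
  show "x \<otimes>\<^bsub>GL\<^esub> y \<otimes>\<^bsub>GL\<^esub> z = x \<otimes>\<^bsub>GL\<^esub> (y \<otimes>\<^bsub>GL\<^esub> z)" by (simp add: matrix_mul_assoc)
qed

lemma inv_GL [simp]: "invertible g \<Longrightarrow> inv\<^bsub>GL\<^esub> g = matrix_inv g"
  using matrix_inv_eqI[of g "inv\<^bsub>GL\<^esub> g"] GL.r_inv[of g] by simp

lemma subgroup_GL_D:
  assumes "subgroup H GL" "g \<in> H"
  shows "invertible g" "matrix_inv g \<in> H" "g ** matrix_inv g = mat 1" "matrix_inv g ** g = mat 1"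
proof -
  show "invertible g" using subgroup.subset[OF assms(1)] assms(2) by auto
  then show "matrix_inv g \<in> H" using subgroup.m_inv_closed[OF assms] by simp
  show "g ** matrix_inv g = mat 1" "matrix_inv g ** g = mat 1"
    using \<open>invertible g\<close> by (auto simp: matrix_inv_mult)
qed

lemma subgroup_GL_mult: "subgroup H GL \<Longrightarrow> g \<in> H \<Longrightarrow> h \<in> H \<Longrightarrow> g ** h \<in> H"
  using subgroup.m_closed[of H GL g h] by simp

lemma subgroup_GL_one: "subgroup H GL \<Longrightarrow> mat 1 \<in> H"
  using subgroup.one_closed[of H GL] by simp

lemma continuous_map_zariski:
  fixes \<Phi> :: "'a::field^'n^'n \<Rightarrow> 'a^'m^'m"
  assumes "\<And>i j. (\<lambda>A. \<Phi> A $ i $ j) \<in> matrix_poly_funs"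
  shows "continuous_map zariski zariski \<Phi>"
  unfolding continuous_map_closedin
proof (intro conjI allI impI)
  fix S :: "('a^'m^'m) set" assume "closedin zariski S"
  then obtain F where F: "F \<subseteq> matrix_poly_funs" "S = zero_locus F" unfolding closedin_zariski by blast
  have "{x \<in> topspace zariski. \<Phi> x \<in> S} = zero_locus ((\<lambda>f A. f (\<Phi> A)) ` F)"
    by (auto simp: F zero_locus_def)
  moreover have "(\<lambda>f A. f (\<Phi> A)) ` F \<subseteq> matrix_poly_funs"
    using F(1) matrix_polys.matrix_poly_comp[OF _ assms] by blast
  ultimately show "closedin zariski {x \<in> topspace zariski. \<Phi> x \<in> S}"
    unfolding closedin_zariski by blast
qed simp

lemma continuous_map_mult_zariski:
  "continuous_map zariski zariski (\<lambda>h. g ** h)" "continuous_map zariski zariski (\<lambda>h. h ** g)"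
  by (intro continuous_map_zariski matrix_polys.matrix_mult matrix_polys.const_fun matrix_poly_funs.entry)+

text \<open>Inside \<open>H\<close> the closed set \<open>S l\<close> and the finite union of the
  others are disjoint, so one of them is empty there. It serves to show that a quantity with
  finitely many values is constant on a connected group.\<close>

lemma connectedin_finite_cover:
  assumes "connectedin \<T> H" "finite \<Lambda>" "\<And>l. l \<in> \<Lambda> \<Longrightarrow> closedin \<T> (S l)"
    and "H \<subseteq> (\<Union>l\<in>\<Lambda>. S l)" "\<And>l m. l \<in> \<Lambda> \<Longrightarrow> m \<in> \<Lambda> \<Longrightarrow> l \<noteq> m \<Longrightarrow> S l \<inter> S m \<inter> H = {}"
    and "l \<in> \<Lambda>" "h \<in> H" "h \<in> S l"
  shows "H \<subseteq> S l"
proof -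
  let ?E = "\<Union>m\<in>\<Lambda> - {l}. S m"
  have "closedin \<T> ?E" using assms by (intro closedin_Union) auto
  moreover have "H \<subseteq> S l \<union> ?E" using assms(4) by auto
  moreover have "S l \<inter> ?E \<inter> H = {}" using assms(5)[OF \<open>l \<in> \<Lambda>\<close>] by blast
  moreover have "S l \<inter> H \<noteq> {}" using assms by blast
  ultimately have "?E \<inter> H = {}"
    using assms(1) assms(3)[OF \<open>l \<in> \<Lambda>\<close>] unfolding connectedin_closedin by metis
  then show ?thesis using \<open>H \<subseteq> S l \<union> ?E\<close> by blast
qed

text \<open>Every element lies in a connected subset through the identity: if \<open>C\<close>
  contains 1 and \<open>g\<close>, and \<open>D\<close> contains 1 and \<open>h\<close>, then the
  union of \<open>C\<close> and the translate of \<open>D\<close> by \<open>g\<close> contains 1 and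
  \<open>g ** h\<close>.\<close>

lemma connectedin_generate:
  fixes S :: "('a::field^'n^'n) set"
  assumes S: "S \<subseteq> carrier GL"
    and C: "\<And>s. s \<in> S \<Longrightarrow> \<exists>C. connectedin zariski C \<and> C \<subseteq> generate GL S \<and> mat 1 \<in> C \<and> s \<in> C"
  shows "connectedin zariski (generate GL S)"
proof -
  have sub: "subgroup (generate GL S) GL" by (rule GL.generate_is_subgroup[OF S])
  let ?P = "\<lambda>C. connectedin zariski C \<and> C \<subseteq> generate GL S \<and> mat 1 \<in> C"
  have "\<exists>C. ?P C \<and> x \<in> C" if "x \<in> generate GL S" for x
    using that
  proof (induction rule: generate.induct)
    case one
    have "mat 1 \<in> generate GL S" using generate.one[of GL S] by simp
    then show ?case by (intro exI[of _ "{mat 1}"]) auto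
  next
    case (incl h)
    then show ?case using C by blast
  next
    case (inv h)
    then obtain C where C': "?P C" "h \<in> C" using C by blast
    have h: "invertible h" "h \<in> generate GL S" using inv S generate.incl[OF inv] by auto
    have "connectedin zariski ((\<lambda>m. matrix_inv h ** m) ` C)"
      using C' by (intro connectedin_continuous_map_image[OF continuous_map_mult_zariski(1)]) auto
    moreover have "(\<lambda>m. matrix_inv h ** m) ` C \<subseteq> generate GL S"
      using C' subgroup_GL_mult[OF sub subgroup_GL_D(2)[OF sub h(2)]] by blast
    moreover have "mat 1 \<in> (\<lambda>m. matrix_inv h ** m) ` C"
      using C'(2) by (intro image_eqI[of _ _ h]) (simp_all add: matrix_inv_mult h)
    moreover have "inv\<^bsub>GL\<^esub> h \<in> (\<lambda>m. matrix_inv h ** m) ` C"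
      using C'(1) h by (intro image_eqI[of _ _ "mat 1"]) simp_all
    ultimately show ?case by blast
  next
    case (eng g h)
    then obtain C D where C': "?P C" "g \<in> C" and D: "?P D" "h \<in> D" by blast
    have "connectedin zariski ((\<lambda>m. g ** m) ` D)"
      using D by (intro connectedin_continuous_map_image[OF continuous_map_mult_zariski(1)]) auto
    moreover have g: "g \<in> (\<lambda>m. g ** m) ` D" using D by (intro image_eqI[of _ _ "mat 1"]) auto
    ultimately have "connectedin zariski (C \<union> (\<lambda>m. g ** m) ` D)"
      using C' by (intro connectedin_Un) auto
    moreover have "(\<lambda>m. g ** m) ` D \<subseteq> generate GL S"
      using D subgroup_GL_mult[OF sub eng(1)] by blast
    ultimately show ?case
      using C' D by (intro exI[of _ "C \<union> (\<lambda>m. g ** m) ` D"]) auto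
  qed
  then have un: "generate GL S = \<Union>{C. ?P C}" by blast
  show ?thesis
    by (subst un, rule connectedin_Union) auto
qed

lemma derived_GL_subset: "subgroup H GL \<Longrightarrow> derived GL H \<subseteq> H"
  by (rule GL.derived_incl) auto

lemma commutator_in_derived_GL:
  assumes "subgroup H GL" "g \<in> H" "h \<in> H"
  shows "g ** h ** matrix_inv g ** matrix_inv h \<in> derived GL H"
proof -
  have "g \<otimes>\<^bsub>GL\<^esub> h \<otimes>\<^bsub>GL\<^esub> inv\<^bsub>GL\<^esub> g \<otimes>\<^bsub>GL\<^esub> inv\<^bsub>GL\<^esub> h \<in> derived GL H"
    unfolding derived_def using assms(2,3) by (intro generate.incl) blast
  then show ?thesis using subgroup_GL_D(1)[OF assms(1)] assms by simp
qed

text \<open>For fixed \<open>g\<close> the commutators with \<open>g\<close> form a continuous image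
  of \<open>H\<close> through the identity; the condition on determinants makes the inverse
  polynomial.\<close>

lemma connectedin_derived:
  fixes H :: "('a::field^'n^'n) set"
  assumes H: "subgroup H GL" "connectedin zariski H" and det: "\<And>h. h \<in> H \<Longrightarrow> det h ^ 2 = 1"
  shows "connectedin zariski (derived GL H)"
  unfolding derived_def
proof (rule connectedin_generate)
  show "derived_set GL H \<subseteq> carrier GL"
    by (rule GL.derived_set_in_carrier) (rule subgroup.subset[OF H(1)])
  fix s assume "s \<in> derived_set GL H"
  then obtain g h where gh: "g \<in> H" "h \<in> H" and s: "s = g ** h ** matrix_inv g ** matrix_inv h"
    using subgroup_GL_D(1)[OF H(1)] by auto
  let ?C = "(\<lambda>k. g ** k ** matrix_inv g ** adjugate_inv k) ` H"
  have eq: "g ** k ** matrix_inv g ** adjugate_inv k = g ** k ** matrix_inv g ** matrix_inv k" if "k \<in> H" for k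
    using adjugate_inv(2)[OF det[OF that]] by simp
  have "connectedin zariski ?C"
    using H(2)
    by (intro connectedin_continuous_map_image[OF continuous_map_zariski] matrix_polys.matrix_mult
        matrix_polys.adjugate_inv matrix_polys.const_fun matrix_poly_funs.entry)
  moreover have "?C \<subseteq> generate GL (derived_set GL H)"
    using commutator_in_derived_GL[OF H(1) gh(1)] eq unfolding derived_def by auto
  moreover have "mat 1 \<in> ?C"
  proof (rule image_eqI)
    show one: "mat 1 \<in> H" by (rule subgroup_GL_one[OF H(1)])
    have "matrix_inv (mat 1 :: 'a^'n^'n) = mat 1" by (rule matrix_inv_eqI) simp
    then show "mat 1 = g ** mat 1 ** matrix_inv g ** adjugate_inv (mat 1)"
      unfolding eq[OF one] by (simp add: subgroup_GL_D(3)[OF H(1) gh(1)])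
  qed
  moreover have "s \<in> ?C" using eq[OF gh(2)] gh(2) unfolding s by (intro image_eqI[of _ _ h]) auto
  ultimately show "\<exists>C. connectedin zariski C \<and> C \<subseteq> generate GL (derived_set GL H) \<and> mat 1 \<in> C \<and> s \<in> C"
    by blast
qed

section \<open>Eigenvectors modulo a subspace\<close>

hide_const (open) Module.smult

lemma subspace_separate:
  fixes U :: "('a::field^'n) set"
  assumes "vec.subspace U" "v \<notin> U"
  obtains q where "pair v q \<noteq> 0" "\<And>u. u \<in> U \<Longrightarrow> pair u q = 0"
proof -
  obtain B where B: "B \<subseteq> U" "vec.independent B" "U \<subseteq> vec.span B" by (rule vec.basis_exists)
  have span: "vec.span B = U" using B assms(1) by (simp add: vec.span_minimal subset_antisym)
  then have "vec.independent (insert v B)"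
    using B(2) assms(2) by (simp add: vec.independent_insert)
  \<comment> \<open>The extension is vector-valued. It sends \<open>v\<close> to a unit vector, and
    the coordinate \<open>undefined\<close>, some fixed index, turns it into a functional.\<close>
  from vec.linear_independent_extend[OF this, of "\<lambda>x. if x = v then axis undefined 1 else 0"] obtain g :: "'a^'n \<Rightarrow> 'a^'n" where g: "Vector_Spaces.linear (*s) (*s) g"
    "\<forall>x\<in>insert v B. g x = (if x = v then axis undefined 1 else 0)" by (elim exE conjE)
  interpret g: Vector_Spaces.linear "(*s)" "(*s)" g by (rule g(1))
  have "v \<notin> B" using B(1) assms(2) by auto
  have gU: "g u = 0" if "u \<in> U" for u
    using that unfolding span[symmetric]
  proof (induction rule: vec.span_induct_alt)
    case base then show ?case by (rule g.zero)
  next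
    case (step c x y)
    then have "g x = 0" using g(2) \<open>v \<notin> B\<close> by auto
    then show ?case using step by (simp add: g.add g.scale)
  qed
  have pg: "pair x (matrix g $ undefined) = g x $ undefined" for x
    using matrix_works[OF g(1), of x] by (simp add: pair_def matrix_vector_mult_def mult.commute vec_eq_iff)
  show ?thesis
  proof (rule that[of "matrix g $ undefined"])
    show "pair v (matrix g $ undefined) \<noteq> 0" using g(2) by (simp add: pg axis_def)
    show "pair u (matrix g $ undefined) = 0" if "u \<in> U" for u using gU[OF that] by (simp add: pg)
  qed
qed

lemma closedin_subspace_preimage:
  fixes \<Phi> :: "'a::field^'n^'n \<Rightarrow> 'a^'n"
  assumes U: "vec.subspace U" and \<Phi>: "\<And>i. (\<lambda>A. \<Phi> A $ i) \<in> matrix_poly_funs"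
  shows "closedin zariski {A. \<Phi> A \<in> U}"
proof -
  let ?F = "(\<lambda>q A. pair (\<Phi> A) q) ` {q. \<forall>u\<in>U. pair u q = 0}"
  have "?F \<subseteq> matrix_poly_funs"
    by (auto intro!: matrix_polys.pair \<Phi> matrix_polys.const_fun)
  moreover have "{A. \<Phi> A \<in> U} = zero_locus ?F"
  proof (intro Set.set_eqI iffI)
    fix A assume A: "A \<in> zero_locus ?F"
    show "A \<in> {A. \<Phi> A \<in> U}"
    proof (rule ccontr)
      assume "A \<notin> {A. \<Phi> A \<in> U}"
      then obtain q where "pair (\<Phi> A) q \<noteq> 0" "\<And>u. u \<in> U \<Longrightarrow> pair u q = 0"
        using subspace_separate[OF U, of "\<Phi> A"] by auto
      with A show False by (auto simp: zero_locus_def)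
    qed
  qed (auto simp: zero_locus_def)
  ultimately show ?thesis unfolding closedin_zariski by blast
qed

text \<open>The vector \<open>x\<close> multiplied by the matrix \<open>p(g)\<close>, in Horner
  form.\<close>

definition pact :: "'a::field^'n^'n \<Rightarrow> 'a poly \<Rightarrow> 'a^'n \<Rightarrow> 'a^'n" where
  "pact g p x = fold_coeffs (\<lambda>a y. a *s x + y v* g) p 0"

lemma pact_0 [simp]: "pact g 0 x = 0"
  by (simp add: pact_def)

lemma pact_pCons [simp]: "pact g (pCons a p) x = a *s x + pact g p x v* g"
  by (cases "a = 0 \<and> p = 0") (auto simp: pact_def)

lemma pact_add: "pact g (p + q) x = pact g p x + pact g q x"
  by (induction p q rule: poly_induct2) (simp_all add: vec.scale_left_distrib vector_matrix_left_distrib)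

lemma pact_smult: "pact g (smult c p) x = c *s pact g p x"
  by (induction p) (simp_all add: vec.scale_right_distrib scalar_vector_matrix_assoc)

lemma pact_sum: "pact g (\<Sum>i\<in>I. p i) x = (\<Sum>i\<in>I. pact g (p i) x)"
  by (induction I rule: infinite_finite_induct) (auto simp: pact_add)

lemma pact_diff: "pact g (p - q) x = pact g p x - pact g q x"
proof -
  have "p - q = p + smult (- 1) q" by simp
  then show ?thesis by (simp only: pact_add pact_smult) simp
qed

lemma pact_diff_right: "pact g p (x - y) = pact g p x - pact g p y"
  by (induction p) (simp_all add: vec.scale_right_diff_distrib vector_matrix_mult_diff_distrib)

lemma pact_scale_right: "pact g p (c *s x) = c *s pact g p x"
  by (induction p) (simp_all add: vec.scale_right_distrib scalar_vector_matrix_assoc mult.commute)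

lemma pact_apply_right: "pact g p (x v* g) = pact g p x v* g"
  by (induction p) (simp_all add: vector_matrix_left_distrib scalar_vector_matrix_assoc)

lemma pact_linear_factor: "pact g ([:- l, 1:] * q) x = pact g q (x v* g - l *s x)"
  by (simp add: pact_add pact_diff pact_smult pact_diff_right pact_scale_right pact_apply_right)

lemma pact_monom: "pact g (monom c k) x = c *s (x v* (((**) g ^^ k) (mat 1)))"
proof (induction k)
  case (Suc k)
  have comm: "((**) g ^^ k) (mat 1) ** g = g ** ((**) g ^^ k) (mat 1)"
    by (induction k) (simp_all add: matrix_mul_assoc[symmetric])
  show ?case using Suc
    by (simp add: monom_Suc scalar_vector_matrix_assoc vector_matrix_mul_assoc comm)
qed (simp add: monom_0)

text \<open>The powers of \<open>g\<close> with exponent from 0 up to the number of matrix entries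
  are one more than the dimension of the space of matrices, hence linearly dependent.\<close>

lemma exists_annihilating_poly:
  fixes g :: "'a::field^'n^'n"
  obtains p where "p \<noteq> 0" "\<And>x. pact g p x = 0"
proof -
  define P where "P = (\<lambda>k. ((**) g ^^ k) (mat 1))"
  let ?I = "{..card (UNIV :: ('n \<times> 'n) set)}"
  obtain c where c: "\<exists>k\<in>?I. c k \<noteq> 0" "\<And>i j. (\<Sum>k\<in>?I. P k $ i $ j * c k) = 0"
    using homogeneous_system_solution[of "UNIV :: ('n \<times> 'n) set" ?I "\<lambda>(i, j) k. P k $ i $ j"] by auto
  define p where "p = (\<Sum>k\<in>?I. monom (c k) k)"
  have "coeff p k = c k" if "k \<in> ?I" for k
    using that by (simp add: p_def coeff_sum sum.delta)
  with c(1) have "p \<noteq> 0" by fastforce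
  moreover have "pact g p x = 0" for x
  proof -
    have m: "pact g (monom a k) x = a *s (x v* P k)" for a k
      by (simp add: pact_monom P_def)
    have "pact g p x $ j = (\<Sum>i\<in>UNIV. x $ i * (\<Sum>k\<in>?I. P k $ i $ j * c k))" for j
      unfolding p_def pact_sum m
      by (simp add: vector_matrix_mult_def sum_distrib_left sum_distrib_right mult_ac) (rule sum.swap)
    then have "pact g p x $ j = 0" for j unfolding c(2) by simp
    then show ?thesis by (simp add: vec_eq_iff)
  qed
  ultimately show ?thesis by (rule that)
qed

lemma subspace_rules:
  assumes "vec.subspace U"
  shows "0 \<in> U" "x \<in> U \<Longrightarrow> y \<in> U \<Longrightarrow> x + y \<in> U" "x \<in> U \<Longrightarrow> y \<in> U \<Longrightarrow> x - y \<in> U" "x \<in> U \<Longrightarrow> c *s x \<in> U"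
    "x \<in> U \<Longrightarrow> - x \<in> U"
  using assms by (auto simp: vec.subspace_0 vec.subspace_add vec.subspace_diff vec.subspace_scale vec.subspace_neg)

lemma subspace_scale_cancel:
  assumes "vec.subspace U" "c *s x \<in> U" "c \<noteq> 0" shows "x \<in> U"
  using subspace_rules(4)[OF assms(1,2), of "inverse c"] assms(3) by simp

text \<open>On an eigenvector modulo \<open>U\<close> the matrix \<open>p(g)\<close> acts by
  \<open>p(l)\<close>, so every such eigenvalue is a root of an annihilating polynomial.\<close>

lemma finite_eigenvalues_mod:
  fixes g :: "'a::field^'n^'n"
  assumes U: "vec.subspace U" and inv: "\<And>u. u \<in> U \<Longrightarrow> u v* g \<in> U"
  shows "finite {l. \<exists>x. x \<notin> U \<and> x v* g - l *s x \<in> U}"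
proof -
  obtain p where p: "p \<noteq> 0" "\<And>x. pact g p x = 0" using exists_annihilating_poly[of g] by metis
  have "pact g p x - poly p l *s x \<in> U" if x: "x v* g - l *s x \<in> U" for x l p
  proof (induction p)
    case 0 show ?case using U by (simp add: subspace_rules)
  next
    case (pCons a p)
    have "pact g (pCons a p) x - poly (pCons a p) l *s x =
      (pact g p x - poly p l *s x) v* g + poly p l *s (x v* g - l *s x)"
      by (simp add: vec.scale_left_distrib vec.scale_right_diff_distrib vector_matrix_mult_diff_distrib
          scalar_vector_matrix_assoc mult.commute)
    also have "\<dots> \<in> U"
      by (rule subspace_rules(2)[OF U inv[OF pCons(2)] subspace_rules(4)[OF U x]])
    finally show ?case .
  qed
  note eig = this
  have "poly p l = 0" if "x \<notin> U" "x v* g - l *s x \<in> U" for x l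
  proof (rule ccontr)
    assume "poly p l \<noteq> 0"
    from eig[OF that(2), of p] have "(- poly p l) *s x \<in> U" by (simp add: p(2))
    from subspace_scale_cancel[OF U this] show False using that(1) \<open>poly p l \<noteq> 0\<close> by simp
  qed
  then have "{l. \<exists>x. x \<notin> U \<and> x v* g - l *s x \<in> U} \<subseteq> {l. poly p l = 0}" by auto
  then show ?thesis using poly_roots_finite[OF p(1)] finite_subset by blast
qed

text \<open>An annihilating polynomial has a root \<open>l\<close>. Either \<open>x\<close> is an
  eigenvector modulo \<open>U\<close> for \<open>l\<close>, or \<open>x v* g - l *s x\<close> lies
  outside \<open>U\<close> and is sent into \<open>U\<close> by a polynomial of smaller
  degree.\<close>

lemma exists_eigenvector_mod:
  fixes g :: "'a::alg_closed_field^'n^'n"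
  assumes U: "vec.subspace U" and W: "vec.subspace W" "\<And>u. u \<in> W \<Longrightarrow> u v* g \<in> W"
    and x: "x \<in> W - U"
  obtains y l where "y \<in> W - U" "y v* g - l *s y \<in> U"
proof -
  obtain p where p: "p \<noteq> 0" "\<And>x. pact g p x = 0" using exists_annihilating_poly[of g] by metis
  have "\<exists>y\<in>W - U. \<exists>l. y v* g - l *s y \<in> U" if "p \<noteq> 0" "x \<in> W - U" "pact g p x \<in> U" for p x
    using that
  proof (induction "degree p" arbitrary: p x rule: less_induct)
    case less
    show ?case
    proof (cases "degree p = 0")
      case True
      then obtain c where "p = [:c:]" by (rule degree_eq_zeroE)
      with less.prems have "c \<noteq> 0" "c *s x \<in> U" by auto
      then show ?thesis using less.prems subspace_scale_cancel[OF U] by blast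
    next
      case False
      then obtain l where "poly p l = 0" using alg_closed_imp_poly_has_root by blast
      then obtain q where q: "p = [:- l, 1:] * q" by (metis poly_eq_0_iff_dvd dvdE)
      then have q0: "q \<noteq> 0" using less.prems by auto
      then have "degree p = Suc (degree q)" unfolding q by (subst degree_mult_eq) auto
      moreover have "pact g q (x v* g - l *s x) \<in> U" using less.prems(3) unfolding q pact_linear_factor .
      moreover have "x v* g - l *s x \<in> W" using less.prems W by (auto intro: subspace_rules)
      ultimately show ?thesis
        using less.hyps[of q "x v* g - l *s x"] q0 less.prems(2) by auto
    qed
  qed
  from this[OF p(1) x] p(2) U show ?thesis using that by (auto simp: subspace_rules)
qed

section \<open>The Lie-Kolchin theorem\<close>

text \<open>The eigenvalue of \<open>g\<close> on \<open>x v* h\<close> modulo \<open>U\<close> has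
  finitely many possible values and closed level sets in \<open>h\<close>, and it is
  \<open>l\<close> at the identity. On a connected group it is constant.\<close>

lemma connected_orbit_eigenvector_mod:
  fixes H :: "('a::field^'n^'n) set"
  assumes H: "subgroup H GL" "connectedin zariski H"
    and U: "vec.subspace U" "\<And>h u. h \<in> H \<Longrightarrow> u \<in> U \<Longrightarrow> u v* h \<in> U" "\<And>u. u \<in> U \<Longrightarrow> u v* g \<in> U"
    and x: "x \<notin> U" "x v* g - l *s x \<in> U"
    and eig: "\<And>h. h \<in> H \<Longrightarrow> \<exists>m. x v* h v* g - m *s (x v* h) \<in> U"
    and "h \<in> H"
  shows "x v* h v* g - l *s (x v* h) \<in> U"
proof -
  let ?\<Lambda> = "{l. \<exists>x. x \<notin> U \<and> x v* g - l *s x \<in> U}"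
  let ?S = "\<lambda>m. {h. x v* h v* g - m *s (x v* h) \<in> U}"
  have nU: "x v* h \<notin> U" if "h \<in> H" for h
  proof
    assume "x v* h \<in> U"
    then have "x v* h v* matrix_inv h \<in> U" by (rule U(2)[OF subgroup_GL_D(2)[OF H(1) that]])
    then show False using x(1) subgroup_GL_D(3)[OF H(1) that] by (simp add: vector_matrix_mul_assoc)
  qed
  have "H \<subseteq> ?S l"
  proof (rule connectedin_finite_cover[OF H(2), of ?\<Lambda> ?S l "mat 1"])
    show "finite ?\<Lambda>" by (rule finite_eigenvalues_mod[OF U(1,3)])
    show "closedin zariski (?S m)" for m
    proof (rule closedin_subspace_preimage[OF U(1)])
      show "(\<lambda>h. (x v* h v* g - m *s (x v* h)) $ i) \<in> matrix_poly_funs" for i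
        unfolding vector_minus_component vector_smult_component
        by (intro matrix_polys.diff matrix_polys.mult_fun matrix_polys.vector_matrix_mult
            matrix_polys.const_fun matrix_poly_funs.entry)
    qed
    show "H \<subseteq> (\<Union>m\<in>?\<Lambda>. ?S m)" using eig nU by blast
    show "?S m \<inter> ?S m' \<inter> H = {}" if "m \<noteq> m'" for m m'
    proof -
      have False if h: "h \<in> H" "x v* h v* g - m *s (x v* h) \<in> U" "x v* h v* g - m' *s (x v* h) \<in> U" for h
      proof -
        have "(x v* h v* g - m *s (x v* h)) - (x v* h v* g - m' *s (x v* h)) \<in> U"
          by (rule subspace_rules(3)[OF U(1) h(2,3)])
        then have "(m' - m) *s (x v* h) \<in> U" by (simp add: vec.scale_left_diff_distrib)
        from subspace_scale_cancel[OF U(1) this] show False using nU[OF h(1)] \<open>m \<noteq> m'\<close> by simp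
      qed
      then show ?thesis by blast
    qed
    show "l \<in> ?\<Lambda>" using x by blast
    show "mat 1 \<in> H" by (rule subgroup_GL_one[OF H(1)])
    show "mat 1 \<in> ?S l" using x by simp
  qed
  then show ?thesis using \<open>h \<in> H\<close> by blast
qed

text \<open>Induction on the derived length. The form modulo an invariant subspace \<open>U\<close>
  is what the application needs: in characteristic 2 the orthogonal space of a vector
  \<open>e\<close> contains \<open>e\<close> itself.\<close>

lemma lie_kolchin:
  fixes H :: "('a::alg_closed_field^'n^'n) set"
  assumes H: "subgroup H GL" "connectedin zariski H" "\<And>h. h \<in> H \<Longrightarrow> det h ^ 2 = 1"
    and solv: "(derived GL ^^ n) H = {mat 1}"
    and U: "vec.subspace U" "\<And>h u. h \<in> H \<Longrightarrow> u \<in> U \<Longrightarrow> u v* h \<in> U"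
    and W: "vec.subspace W" "\<And>h u. h \<in> H \<Longrightarrow> u \<in> W \<Longrightarrow> u v* h \<in> W" "U \<subset> W"
  shows "\<exists>w\<in>W - U. \<forall>h\<in>H. \<exists>c. w v* h - c *s w \<in> U"
  using assms
proof (induction n arbitrary: H W)
  case 0
  then obtain w where "w \<in> W - U" by blast
  moreover have "w v* h - 1 *s w \<in> U" if "h \<in> H" for h
    using 0 that by (simp add: subspace_rules)
  ultimately show ?case by blast
next
  case (Suc n)
  define D where "D = derived GL H"
  have D: "subgroup D GL" "connectedin zariski D" "D \<subseteq> H" "(derived GL ^^ n) D = {mat 1}"
  proof -
    show "subgroup D GL" unfolding D_def by (rule GL.derived_is_subgroup[OF subgroup.subset[OF Suc.prems(1)]])
    show "connectedin zariski D" unfolding D_def by (rule connectedin_derived[OF Suc.prems(1-3)])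
    show "D \<subseteq> H" unfolding D_def by (rule derived_GL_subset[OF Suc.prems(1)])
    show "(derived GL ^^ n) D = {mat 1}"
      using Suc.prems(4) unfolding D_def by (simp add: funpow_swap1)
  qed
  note gH = subgroup_GL_D[OF Suc.prems(1)] and mH = subgroup_GL_mult[OF Suc.prems(1)]
  \<comment> \<open>\<open>V\<close> is an invariant subspace of least dimension properly containing
    \<open>U\<close>. By minimality the weight space of the derived group, and later an eigenspace
    of a single element, fill all of \<open>V\<close> once they are invariant.\<close>
  define P where "P = (\<lambda>V. vec.subspace V \<and> (\<forall>h\<in>H. \<forall>u\<in>V. u v* h \<in> V) \<and> U \<subset> V \<and> V \<subseteq> W)"
  have "P W" unfolding P_def using Suc.prems by blast
  from ex_has_least_nat[of P, OF this, of vec.dim] obtain V where V: "P V" "\<And>V'. P V' \<Longrightarrow> vec.dim V \<le> vec.dim V'"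
    by blast
  have VP: "vec.subspace V" "\<And>h u. h \<in> H \<Longrightarrow> u \<in> V \<Longrightarrow> u v* h \<in> V" "U \<subset> V" "V \<subseteq> W"
    using V(1) unfolding P_def by auto
  have minimal: "E = V" if E: "vec.subspace E" "\<And>h u. h \<in> H \<Longrightarrow> u \<in> E - U \<Longrightarrow> u v* h \<in> E" "U \<subseteq> E" "E \<subseteq> V"
     "w \<in> E" "w \<notin> U" for E w
  proof -
    have "u v* h \<in> E" if "h \<in> H" "u \<in> E" for h u
      using E(2)[of h u] Suc.prems(6)[of h u] E(3) that by blast
    then have "P E" unfolding P_def using E VP(4) by blast
    then show ?thesis using vec.subspace_dim_equal[OF E(1) VP(1) E(4)] V(2) by blast
  qed
  have "\<exists>w\<in>V - U. \<forall>h\<in>D. \<exists>c. w v* h - c *s w \<in> U"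
    using D(3) Suc.prems(3,6) VP by (intro Suc.IH D(1,2,4) Suc.prems(5)) auto
  then obtain w0 where w0: "w0 \<in> V - U" "\<forall>d\<in>D. \<exists>c. w0 v* d - c *s w0 \<in> U" by blast
  then obtain \<theta> where \<theta>: "\<And>d. d \<in> D \<Longrightarrow> w0 v* d - \<theta> d *s w0 \<in> U" by metis
  define E where "E = {x \<in> V. \<forall>d\<in>D. x v* d - \<theta> d *s x \<in> U}"
  have "E = V"
  proof (rule minimal)
    show "w0 \<in> E" "w0 \<notin> U" using w0 \<theta> by (auto simp: E_def)
    show "E \<subseteq> V" by (auto simp: E_def)
    show "U \<subseteq> E"
    proof
      fix u assume u: "u \<in> U"
      have "u v* d - \<theta> d *s u \<in> U" if "d \<in> D" for d
        using Suc.prems(6)[of d u] D(3) that u by (intro subspace_rules(3,4)[OF Suc.prems(5)]) auto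
      then show "u \<in> E" using u VP(3) by (auto simp: E_def)
    qed
    show "vec.subspace E"
    proof (rule vec.subspaceI)
      show "0 \<in> E" using VP(1) Suc.prems(5) by (simp add: E_def subspace_rules)
    next
      fix x y assume "x \<in> E" "y \<in> E"
      then have "x + y \<in> V" "\<And>d. d \<in> D \<Longrightarrow> (x v* d - \<theta> d *s x) + (y v* d - \<theta> d *s y) \<in> U"
        unfolding E_def by (auto intro: subspace_rules(2)[OF VP(1)] subspace_rules(2)[OF Suc.prems(5)])
      then show "x + y \<in> E"
        unfolding E_def by (simp add: vector_matrix_left_distrib vec.scale_right_distrib algebra_simps)
    next
      fix c x assume x: "x \<in> E"
      have "(c *s x) v* d - \<theta> d *s (c *s x) = c *s (x v* d - \<theta> d *s x)" for d
        by (simp add: scalar_vector_matrix_assoc vec.scale_right_diff_distrib mult.commute)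
      then show "c *s x \<in> E"
        using x subspace_rules(4)[OF VP(1)] subspace_rules(4)[OF Suc.prems(5)] unfolding E_def
        by (simp only: mem_Collect_eq) blast
    qed
    fix h x assume h: "h \<in> H" and x: "x \<in> E - U"
    have "x v* h v* d - \<theta> d *s (x v* h) \<in> U" if d: "d \<in> D" for d
    proof (rule connected_orbit_eigenvector_mod[OF Suc.prems(1,2,5,6) _ _ _ _ h])
      show "u v* d \<in> U" if "u \<in> U" for u using Suc.prems(6) d D(3) that by blast
      show "x \<notin> U" using x by simp
      show "x v* d - \<theta> d *s x \<in> U" using x d by (simp add: E_def)
      fix k assume k: "k \<in> H"
      \<comment> \<open>Conjugates of \<open>d\<close> stay in the derived group, so
        \<open>x v* k\<close> is again an eigenvector of \<open>d\<close> modulo \<open>U\<close>;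
        connectedness fixes its eigenvalue.\<close>
      have "k ** d ** matrix_inv k \<in> D"
      proof -
        have "k ** d ** matrix_inv k ** matrix_inv d \<in> D"
          unfolding D_def using commutator_in_derived_GL[OF Suc.prems(1) k] d D(3) by blast
        from subgroup_GL_mult[OF D(1) this d] show ?thesis
          using gH(4)[of d] d D(3) by (simp add: matrix_mul_assoc[symmetric] subset_iff)
      qed
      then have "x v* (k ** d ** matrix_inv k) - \<theta> (k ** d ** matrix_inv k) *s x \<in> U"
        using x by (simp add: E_def)
      then have "(x v* (k ** d ** matrix_inv k) - \<theta> (k ** d ** matrix_inv k) *s x) v* k \<in> U"
        by (rule Suc.prems(6)[OF k])
      moreover have "x v* (k ** d ** matrix_inv k) v* k = x v* k v* d"
        unfolding vector_matrix_mul_assoc using gH(4)[OF k] by (simp add: matrix_mul_assoc[symmetric])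
      ultimately show "\<exists>m. x v* k v* d - m *s (x v* k) \<in> U"
        by (intro exI[of _ "\<theta> (k ** d ** matrix_inv k)"])
          (simp add: vector_matrix_mult_diff_distrib scalar_vector_matrix_assoc)
    qed
    then show "x v* h \<in> E" using VP(2)[OF h] x by (auto simp: E_def)
  qed
  then have scalar: "x v* d - \<theta> d *s x \<in> U" if "x \<in> V" "d \<in> D" for x d
    using that by (auto simp: E_def)
  have "\<exists>l. \<forall>x\<in>V. x v* g - l *s x \<in> U" if g: "g \<in> H" for g
  proof -
    obtain w l where w: "w \<in> V - U" "w v* g - l *s w \<in> U"
      using exists_eigenvector_mod[OF Suc.prems(5) VP(1,2) w0(1)] g by metis
    define E where "E = {x \<in> V. x v* g - l *s x \<in> U}"
    have "E = V"
    proof (rule minimal)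
      show "w \<in> E" "w \<notin> U" using w by (auto simp: E_def)
      show "E \<subseteq> V" by (auto simp: E_def)
      show "U \<subseteq> E"
      proof
        fix u assume u: "u \<in> U"
        have "u v* g - l *s u \<in> U"
          using Suc.prems(6)[OF g] u by (intro subspace_rules(3,4)[OF Suc.prems(5)]) auto
        then show "u \<in> E" using u VP(3) by (auto simp: E_def)
      qed
      show "vec.subspace E"
      proof (rule vec.subspaceI)
        show "0 \<in> E" using VP(1) Suc.prems(5) by (simp add: E_def subspace_rules)
      next
        fix x y assume "x \<in> E" "y \<in> E"
        then have "x + y \<in> V" "(x v* g - l *s x) + (y v* g - l *s y) \<in> U"
          unfolding E_def by (auto intro: subspace_rules(2)[OF VP(1)] subspace_rules(2)[OF Suc.prems(5)])
        then show "x + y \<in> E"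
          unfolding E_def by (simp add: vector_matrix_left_distrib vec.scale_right_distrib algebra_simps)
      next
        fix c x assume x: "x \<in> E"
        have "(c *s x) v* g - l *s (c *s x) = c *s (x v* g - l *s x)"
          by (simp add: scalar_vector_matrix_assoc vec.scale_right_diff_distrib mult.commute)
        then show "c *s x \<in> E"
          using x subspace_rules(4)[OF VP(1)] subspace_rules(4)[OF Suc.prems(5)] unfolding E_def
          by (simp only: mem_Collect_eq simp_thms)
      qed
      fix h x assume h: "h \<in> H" and x: "x \<in> E - U"
      have "x v* h v* g - l *s (x v* h) \<in> U"
      proof (rule connected_orbit_eigenvector_mod[OF Suc.prems(1,2,5,6) _ _ _ _ h])
        show "u v* g \<in> U" if "u \<in> U" for u using Suc.prems(6) g that by blast
        show "x \<notin> U" using x by simp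
        show "x v* g - l *s x \<in> U" using x by (simp add: E_def)
        fix k assume k: "k \<in> H"
        \<comment> \<open>The commutator \<open>d\<close> acts on \<open>V\<close> modulo
          \<open>U\<close> by a scalar, so moving \<open>k\<close> past \<open>g\<close> multiplies
          the eigenvalue by \<open>\<theta> d\<close>. Connectedness shows that it does not
          change.\<close>
        define d where "d = k ** g ** matrix_inv k ** matrix_inv g"
        have d: "d \<in> D" unfolding d_def D_def by (rule commutator_in_derived_GL[OF Suc.prems(1) k g])
        have kg: "k ** g = d ** g ** k"
        proof -
          have "d ** g ** k = k ** g ** (matrix_inv k ** (matrix_inv g ** g) ** k)"
            by (simp add: d_def matrix_mul_assoc)
          then show ?thesis using gH(4)[OF k] gH(4)[OF g] by simp
        qed
        have 1: "(x v* d - \<theta> d *s x) v* (g ** k) \<in> U"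
          using scalar[OF _ d, of x] x by (intro Suc.prems(6) mH g k) (auto simp: E_def)
        have 2: "\<theta> d *s ((x v* g - l *s x) v* k) \<in> U"
          using x by (intro subspace_rules(4)[OF Suc.prems(5)] Suc.prems(6)[OF k]) (auto simp: E_def)
        have "x v* k v* g = x v* d v* (g ** k)"
          by (simp add: vector_matrix_mul_assoc kg matrix_mul_assoc)
        then have "x v* k v* g - (\<theta> d * l) *s (x v* k) =
          (x v* d - \<theta> d *s x) v* (g ** k) + \<theta> d *s ((x v* g - l *s x) v* k)"
          by (simp add: vector_matrix_mult_diff_distrib scalar_vector_matrix_assoc
              vec.scale_right_diff_distrib vector_matrix_mul_assoc)
        also have "\<dots> \<in> U" by (rule subspace_rules(2)[OF Suc.prems(5) 1 2])
        finally show "\<exists>m. x v* k v* g - m *s (x v* k) \<in> U" by blast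
      qed
      then show "x v* h \<in> E" using VP(2)[OF h] x by (auto simp: E_def)
    qed
    then show ?thesis by (auto simp: E_def)
  qed
  then show ?case using w0(1) VP(4) by blast
qed

section \<open>Enlarging Borel subgroups\<close>

lemma poly_image_closure:
  fixes \<Phi> :: "'a::field^'n^'n \<Rightarrow> 'a^'n^'n"
  assumes "\<And>i j. (\<lambda>A. \<Phi> A $ i $ j) \<in> matrix_poly_funs"
    and "\<And>g. g \<in> S \<Longrightarrow> \<Phi> g \<in> zariski closure_of T" and "h \<in> zariski closure_of S"
  shows "\<Phi> h \<in> zariski closure_of T"
proof -
  have "\<Phi> ` (zariski closure_of S) \<subseteq> zariski closure_of (\<Phi> ` S)"
    by (rule continuous_map_image_closure_subset[OF continuous_map_zariski[OF assms(1)]])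
  also have "\<dots> \<subseteq> zariski closure_of T"
    by (rule closure_of_minimal) (use assms(2) in auto)
  finally show ?thesis using assms(3) by blast
qed

lemma invertible_det_square: "det g ^ 2 = 1 \<Longrightarrow> invertible (g :: 'a::field^'n^'n)"
  by (auto simp: invertible_det_nz)

lemma in_zariski_closure: "g \<in> S \<Longrightarrow> g \<in> zariski closure_of S"
  using closure_of_subset[of S zariski] by auto

text \<open>The closure is taken in one factor at a time: the left factor first stays in
  \<open>M\<close>, then moves to the closure. Inverses are polynomial by the condition on
  determinants.\<close>

lemma subgroup_zariski_closure:
  fixes M :: "('a::field^'n^'n) set"
  assumes M: "subgroup M GL" and det: "\<And>g. g \<in> M \<Longrightarrow> det g ^ 2 = 1"
  shows "subgroup (zariski closure_of M) GL"
proof (rule GL.subgroupI)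
  have det': "det g ^ 2 = 1" if "g \<in> zariski closure_of M" for g
    by (rule closure_of_det_square[OF det that])
  show "zariski closure_of M \<subseteq> carrier GL" using invertible_det_square[OF det'] by auto
  show "zariski closure_of M \<noteq> {}" using in_zariski_closure[OF subgroup_GL_one[OF M]] by blast
  fix g assume g: "g \<in> zariski closure_of M"
  have "adjugate_inv g \<in> zariski closure_of M"
  proof (rule poly_image_closure[OF _ _ g])
    show "(\<lambda>A. adjugate_inv A $ i $ j) \<in> matrix_poly_funs" for i j
      by (intro matrix_polys.adjugate_inv matrix_poly_funs.entry)
    show "adjugate_inv h \<in> zariski closure_of M" if "h \<in> M" for h
      using subgroup_GL_D(2)[OF M that] adjugate_inv(2)[OF det[OF that]] in_zariski_closure by metis
  qed
  then show "inv\<^bsub>GL\<^esub> g \<in> zariski closure_of M"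
    using det'[OF g] invertible_det_square[of g] by (simp add: adjugate_inv(2))
  fix h assume h: "h \<in> zariski closure_of M"
  have *: "k ** h \<in> zariski closure_of M" if k: "k \<in> M" for k
  proof (rule poly_image_closure[OF _ _ h])
    show "(\<lambda>A. (k ** A) $ i $ j) \<in> matrix_poly_funs" for i j
      by (intro matrix_polys.matrix_mult matrix_polys.const_fun matrix_poly_funs.entry)
    show "k ** g \<in> zariski closure_of M" if "g \<in> M" for g
      using subgroup_GL_mult[OF M k that] by (rule in_zariski_closure)
  qed
  have "g ** h \<in> zariski closure_of M"
  proof (rule poly_image_closure[OF _ _ g])
    show "(\<lambda>A. (A ** h) $ i $ j) \<in> matrix_poly_funs" for i j
      by (intro matrix_polys.matrix_mult matrix_polys.const_fun matrix_poly_funs.entry)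
  qed (rule *)
  then show "g \<otimes>\<^bsub>GL\<^esub> h \<in> zariski closure_of M" by simp
qed

lemma derived_closure_subset:
  fixes M :: "('a::field^'n^'n) set"
  assumes M: "subgroup M GL" and det: "\<And>g. g \<in> M \<Longrightarrow> det g ^ 2 = 1"
  shows "derived GL (zariski closure_of M) \<subseteq> zariski closure_of (derived GL M)"
proof -
  have D: "subgroup (derived GL M) GL" "derived GL M \<subseteq> M"
    using GL.derived_is_subgroup[OF subgroup.subset[OF M]] derived_GL_subset[OF M] by auto
  have det': "det g ^ 2 = 1" if "g \<in> zariski closure_of M" for g
    by (rule closure_of_det_square[OF det that])
  let ?c = "\<lambda>g h. g ** h ** adjugate_inv g ** adjugate_inv h"
  have 1: "?c g h \<in> zariski closure_of (derived GL M)" if g: "g \<in> M" and h: "h \<in> zariski closure_of M" for g h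
  proof (rule poly_image_closure[OF _ _ h])
    show "(\<lambda>A. ?c g A $ i $ j) \<in> matrix_poly_funs" for i j
      by (intro matrix_polys.matrix_mult matrix_polys.adjugate_inv matrix_polys.const_fun matrix_poly_funs.entry)
    show "?c g h \<in> zariski closure_of (derived GL M)" if "h \<in> M" for h
      using commutator_in_derived_GL[OF M g that] adjugate_inv(2)[OF det[OF g]] adjugate_inv(2)[OF det[OF that]]
      by (simp add: in_zariski_closure)
  qed
  have 2: "?c g h \<in> zariski closure_of (derived GL M)" if g: "g \<in> zariski closure_of M" and h: "h \<in> zariski closure_of M" for g h
  proof (rule poly_image_closure[OF _ _ g])
    show "(\<lambda>A. ?c A h $ i $ j) \<in> matrix_poly_funs" for i j
      by (intro matrix_polys.matrix_mult matrix_polys.adjugate_inv matrix_polys.const_fun matrix_poly_funs.entry)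
  qed (rule 1[OF _ h])
  show ?thesis
    unfolding derived_def[of GL "zariski closure_of M"]
  proof (rule GL.generate_subgroup_incl)
    show "subgroup (zariski closure_of (derived GL M)) GL"
      by (rule subgroup_zariski_closure[OF D(1)]) (use D(2) det in auto)
    show "derived_set GL (zariski closure_of M) \<subseteq> zariski closure_of (derived GL M)"
    proof clarify
      fix g h assume gh: "g \<in> zariski closure_of M" "h \<in> zariski closure_of M"
      show "g \<otimes>\<^bsub>GL\<^esub> h \<otimes>\<^bsub>GL\<^esub> inv\<^bsub>GL\<^esub> g \<otimes>\<^bsub>GL\<^esub> inv\<^bsub>GL\<^esub> h \<in> zariski closure_of (derived GL M)"
        using 2[OF gh] gh[THEN det'] by (simp add: invertible_det_square adjugate_inv(2))
    qed
  qed
qed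

lemma exp_derived_GL:
  assumes "subgroup H GL"
  shows "subgroup ((derived GL ^^ n) H) GL" "(derived GL ^^ n) H \<subseteq> H"
proof -
  show *: "subgroup ((derived GL ^^ n) H) GL" for n by (rule GL.exp_of_derived_is_subgroup[OF assms])
  show "(derived GL ^^ n) H \<subseteq> H"
    by (induction n) (use derived_GL_subset[OF *] in auto)
qed

lemma exp_derived_closure:
  fixes M :: "('a::field^'n^'n) set"
  assumes M: "subgroup M GL" and det: "\<And>g. g \<in> M \<Longrightarrow> det g ^ 2 = 1"
  shows "(derived GL ^^ n) (zariski closure_of M) \<subseteq> zariski closure_of ((derived GL ^^ n) M)"
proof (induction n)
  case (Suc n)
  have "(derived GL ^^ Suc n) (zariski closure_of M) \<subseteq> derived GL (zariski closure_of ((derived GL ^^ n) M))"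
    using GL.mono_derived[OF Suc] by simp
  also have "\<dots> \<subseteq> zariski closure_of (derived GL ((derived GL ^^ n) M))"
    using exp_derived_GL[OF M] det by (intro derived_closure_subset) auto
  finally show ?case by simp
qed simp

lemma solvable_GL_iff:
  fixes B :: "('a::field^'n^'n) set"
  assumes B: "subgroup B GL"
  shows "solvable (GL\<lparr>carrier := B\<rparr>) \<longleftrightarrow> (\<exists>n. (derived GL ^^ n) B = {mat 1})"
proof -
  interpret B: group "GL\<lparr>carrier := B\<rparr>" by (rule subgroup.subgroup_is_group[OF B GL.is_group])
  have "(derived (GL\<lparr>carrier := B\<rparr>) ^^ n) B = (derived GL ^^ n) B" for n
    by (induction n) (simp_all add: GL.derived_consistent[OF exp_derived_GL(2)[OF B] B])
  then show ?thesis using B.solvable_iff_trivial_derived_seq by simp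
qed

text \<open>A Borel subgroup is maximal among closed groups, so \<open>M\<close> is replaced by its
  closure. This is still connected and inside \<open>G\<close>, and solvable because its derived
  series stays in the closures of the derived series of \<open>M\<close>.\<close>

lemma borel_maximal:
  fixes B :: "('a::field^'n^'n) set"
  assumes G: "linear_algebraic_group G" "\<And>g. g \<in> G \<Longrightarrow> det g ^ 2 = 1" and B: "borel_subgroup G B"
    and M: "subgroup M GL" "M \<subseteq> G" "B \<subseteq> M" "connectedin zariski M" "(derived GL ^^ n) M = {mat 1}"
  shows "M = B"
proof -
  let ?N = "zariski closure_of M"
  have det: "det g ^ 2 = 1" if "g \<in> M" for g using G(2) M(2) that by blast
  have N: "subgroup ?N GL" by (rule subgroup_zariski_closure[OF M(1) det])
  obtain G' where G': "closedin zariski G'" "G = G' \<inter> carrier GL"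
    using G(1) unfolding linear_algebraic_group_def closedin_subtopology by blast
  have "?N \<subseteq> G"
    using closure_of_minimal[OF _ G'(1), of M] M(2) subgroup.subset[OF N] unfolding G'(2) by blast
  moreover have "connected_solvable ?N"
    unfolding connected_solvable_def linear_algebraic_group_def
  proof (intro conjI N)
    show "closedin (subtopology zariski (carrier GL)) ?N"
      using subgroup.subset[OF N] by (intro closedin_subset_topspace) auto
    show "connectedin zariski ?N" by (rule connectedin_closure_of[OF M(4)])
    have one: "closedin zariski {mat 1 :: 'a^'n^'n}"
      unfolding closedin_zariski
    proof (intro exI conjI)
      let ?F = "(\<lambda>(i, j) A. A $ i $ j - mat 1 $ i $ j) ` UNIV"
      show "?F \<subseteq> matrix_poly_funs"
        by (auto intro!: matrix_polys.diff matrix_polys.const_fun matrix_poly_funs.entry)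
      show "{mat 1} = zero_locus ?F" by (auto simp: zero_locus_def vec_eq_iff)
    qed
    have "(derived GL ^^ n) ?N \<subseteq> zariski closure_of {mat 1}"
      using exp_derived_closure[OF M(1) det, of n] M(5) by simp
    then have "(derived GL ^^ n) ?N \<subseteq> {mat 1}" using one by (simp add: closure_of_closedin)
    then have "(derived GL ^^ n) ?N = {mat 1}"
      using subgroup_GL_one[OF exp_derived_GL(1)[OF N], of n] by blast
    then show "solvable (GL\<lparr>carrier := ?N\<rparr>)" unfolding solvable_GL_iff[OF N] by blast
  qed
  moreover have "B \<subseteq> ?N" using M(3) in_zariski_closure by blast
  ultimately have "?N = B" using B unfolding borel_subgroup_def by blast
  then show ?thesis using M(3) in_zariski_closure by blast
qed

text \<open>\<open>R\<close> plays the role of having the same image in a quotient group, without a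
  quotient being formed.\<close>

lemma generate_related:
  fixes R :: "('a::field^'n^'n) \<Rightarrow> ('a^'n^'n) \<Rightarrow> bool"
  assumes R: "R (mat 1) (mat 1)" "\<And>g b g' b'. R g b \<Longrightarrow> R g' b' \<Longrightarrow> R (g ** g') (b ** b')"
      "\<And>g b. R g b \<Longrightarrow> invertible g \<Longrightarrow> invertible b \<Longrightarrow> R (matrix_inv g) (matrix_inv b)"
    and B: "subgroup B GL" and S: "S \<subseteq> carrier GL" "\<And>s. s \<in> S \<Longrightarrow> \<exists>b\<in>B. R s b"
    and g: "g \<in> generate GL S"
  shows "\<exists>b\<in>B. R g b"
  using g
proof (induction rule: generate.induct)
  case one
  then show ?case using R(1) subgroup_GL_one[OF B] by auto
next
  case (incl h)
  then show ?case by (rule S(2))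
next
  case (inv h)
  then obtain b where b: "b \<in> B" "R h b" using S(2) by blast
  moreover have "invertible h" using inv S(1) by auto
  ultimately show ?case
    using R(3)[OF b(2) _ subgroup_GL_D(1)[OF B b(1)]] subgroup_GL_D(2)[OF B b(1)] by auto
next
  case (eng g h)
  then show ?case using R(2) subgroup_GL_mult[OF B] by (metis mult_GL)
qed

text \<open>Commutators of related elements are related. Once the derived series of \<open>B\<close>
  has reached the identity, the corresponding derived group of \<open>M\<close> is trivial in the
  quotient that \<open>R\<close> stands for.\<close>

lemma exp_derived_related:
  fixes R :: "('a::field^'n^'n) \<Rightarrow> ('a^'n^'n) \<Rightarrow> bool"
  assumes R: "R (mat 1) (mat 1)" "\<And>g b g' b'. R g b \<Longrightarrow> R g' b' \<Longrightarrow> R (g ** g') (b ** b')"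
      "\<And>g b. R g b \<Longrightarrow> invertible g \<Longrightarrow> invertible b \<Longrightarrow> R (matrix_inv g) (matrix_inv b)"
    and B: "subgroup B GL" and M: "subgroup M GL" "\<And>g. g \<in> M \<Longrightarrow> \<exists>b\<in>B. R g b"
    and g: "g \<in> (derived GL ^^ n) M"
  shows "\<exists>b\<in>(derived GL ^^ n) B. R g b"
  using g
proof (induction n arbitrary: g)
  case 0
  then show ?case using M(2) by simp
next
  case (Suc n)
  note Mn = exp_derived_GL[OF M(1), of n] and Bn = exp_derived_GL[OF B, of n]
  have "\<exists>b\<in>derived GL ((derived GL ^^ n) B). R g b"
  proof (rule generate_related[where R = R, OF R])
    show "subgroup (derived GL ((derived GL ^^ n) B)) GL"
      by (rule GL.derived_is_subgroup[OF subgroup.subset[OF Bn(1)]])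
    show "derived_set GL ((derived GL ^^ n) M) \<subseteq> carrier GL"
      by (rule GL.derived_set_in_carrier[OF subgroup.subset[OF Mn(1)]])
    show "g \<in> generate GL (derived_set GL ((derived GL ^^ n) M))"
      using Suc.prems unfolding funpow.simps o_apply derived_def[of GL "(derived GL ^^ n) M"] .
    fix s assume "s \<in> derived_set GL ((derived GL ^^ n) M)"
    then obtain h k where hk: "h \<in> (derived GL ^^ n) M" "k \<in> (derived GL ^^ n) M"
      and s: "s = h ** k ** matrix_inv h ** matrix_inv k"
      using subgroup_GL_D(1)[OF Mn(1)] by auto
    obtain b c where b: "b \<in> (derived GL ^^ n) B" "R h b" and c: "c \<in> (derived GL ^^ n) B" "R k c"
      using Suc.IH hk by blast
    have "R s (b ** c ** matrix_inv b ** matrix_inv c)"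
      unfolding s using b c hk subgroup_GL_D(1)[OF Mn(1)] subgroup_GL_D(1)[OF Bn(1)]
      by (intro R(2,3)) auto
    then show "\<exists>b\<in>derived GL ((derived GL ^^ n) B). R s b"
      using commutator_in_derived_GL[OF Bn(1) b(1) c(1)] by blast
  qed auto
  then show ?case by simp
qed

section \<open>Determinant and rank of a letter\<close>

lemma letter_mult:
  assumes z: "pair (fst z) (snd z) = 0" "pair (fst z') (snd z') = 0" "opposite z z'" and s: "s \<noteq> 0" "t \<noteq> 0"
  shows "letter z z' s ** letter z z' t = letter z z' (s * t)"
proof (rule vector_matrix_eqI)
  fix v
  let ?k = "pair (fst z) (snd z')" and ?k' = "pair (fst z') (snd z)"
  have k: "?k \<noteq> 0" "?k' \<noteq> 0" using z(3) by (auto simp: opposite_def)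
  have 1: "pair (v v* letter z z' s) (snd z') = s * pair v (snd z')"
    "pair (v v* letter z z' s) (snd z) = pair v (snd z) / s"
    using z k s by (simp_all add: vector_letter pair_simps field_simps)
  have 2: "(s - 1) + (t - 1) * s = s * t - 1" "(1 / s - 1) + (1 / t - 1) / s = 1 / (s * t) - 1"
    using s by (simp_all add: field_simps)
  have "v v* (letter z z' s ** letter z z' t) = v
     + (((s - 1) + (t - 1) * s) / ?k * pair v (snd z')) *s fst z
     + (((1 / s - 1) + (1 / t - 1) / s) / ?k' * pair v (snd z)) *s fst z'"
    unfolding vector_matrix_mul_assoc[symmetric] vector_letter[of "v v* _"] 1
    unfolding vector_letter
    by (simp add: vec_eq_iff add_divide_distrib diff_divide_distrib algebra_simps)
  also have "\<dots> = v v* letter z z' (s * t)"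
    unfolding 2 vector_letter ..
  finally show "v v* (letter z z' s ** letter z z' t) = v v* letter z z' (s * t)" .
qed

lemma letter_1 [simp]: "letter z z' 1 = mat 1"
  by (rule vector_matrix_eqI) (simp add: vector_letter)

text \<open>A letter depends only on the lines spanned by its vectors and functionals, which allows
  pairings to be normalised.\<close>

lemma letter_scale:
  assumes "c \<noteq> 0" "d \<noteq> 0" "c' \<noteq> 0" "d' \<noteq> 0"
  shows "letter (c *s fst z, d *s snd z) (c' *s fst z', d' *s snd z') s = letter z z' s"
proof (rule vector_matrix_eqI)
  fix v
  have e: "a / (y * (x * k)) * (y * u) * x = a / k * u" if "x \<noteq> 0" "y \<noteq> 0" for a x y k u :: 'a
    using that by simp
  show "v v* letter (c *s fst z, d *s snd z) (c' *s fst z', d' *s snd z') s = v v* letter z z' s"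
    unfolding vector_letter fst_conv snd_conv pair_scale_left pair_scale_right vec.scale_scale
    by (simp only: e assms not_False_eq_True)
qed

text \<open>
  For normalised flags, the letter with parameter \<open>1/t\<close> is the product of the involutions
  \<open>switch z z' 1\<close> and \<open>switch z z' t\<close>. For the flags of an orthogonal group these are reflections.
\<close>

definition switch :: "('a::field, 'n::finite) flag \<Rightarrow> ('a, 'n) flag \<Rightarrow> 'a \<Rightarrow> 'a^'n^'n" where
  "switch z z' t = mat 1
     + outer ((1 / (t * pair (fst z) (snd z'))) *s (snd z - t *s snd z')) (fst z - t *s fst z')"

lemma vector_switch: "v v* switch z z' t =
    v + ((pair v (snd z) - t * pair v (snd z')) / (t * pair (fst z) (snd z'))) *s (fst z - t *s fst z')"
  unfolding switch_def vector_matrix_mult_add_rdistrib vector_outer pair_scale_right pair_diff_right by simp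

lemma switch_switch:
  assumes z: "pair (fst z) (snd z) = 0" "pair (fst z') (snd z') = 0" "opposite z z'"
      "pair (fst z) (snd z') = pair (fst z') (snd z)" and t: "t \<noteq> 0"
  shows "switch z z' t ** switch z z' t = mat 1"
proof (rule vector_matrix_eqI)
  fix v
  let ?k = "pair (fst z') (snd z)"
  have k: "?k \<noteq> 0" using z(3) by (auto simp: opposite_def)
  define a where "a = (pair v (snd z) - t * pair v (snd z')) / (t * ?k)"
  have s: "v v* switch z z' t = v + a *s (fst z - t *s fst z')"
    by (simp add: vector_switch a_def z(4))
  have "(pair (v v* switch z z' t) (snd z) - t * pair (v v* switch z z' t) (snd z')) / (t * ?k) = - a"
  proof -
    have "pair (v v* switch z z' t) (snd z) - t * pair (v v* switch z z' t) (snd z')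
      = (pair v (snd z) - t * pair v (snd z')) - 2 * a * (t * ?k)"
      unfolding s by (simp add: pair_simps z algebra_simps)
    moreover have "pair v (snd z) - t * pair v (snd z') = a * (t * ?k)" using k t by (simp add: a_def)
    ultimately have "pair (v v* switch z z' t) (snd z) - t * pair (v v* switch z z' t) (snd z') = - a * (t * ?k)"
      by simp
    then show ?thesis using k t by simp
  qed
  then have "v v* (switch z z' t ** switch z z' t) = v v* switch z z' t + (- a) *s (fst z - t *s fst z')"
    unfolding vector_matrix_mul_assoc[symmetric] vector_switch[of "v v* _"] z(4) by simp
  then show "v v* (switch z z' t ** switch z z' t) = v v* mat 1"
    unfolding s by (simp add: vec.scale_minus_left)
qed

lemma switch_mult_letter:
  assumes z: "pair (fst z) (snd z) = 0" "pair (fst z') (snd z') = 0" "opposite z z'"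
      "pair (fst z) (snd z') = pair (fst z') (snd z)" and t: "t \<noteq> 0"
  shows "switch z z' 1 ** switch z z' t = letter z z' (1 / t)"
proof (rule vector_matrix_eqI)
  fix v
  let ?k = "pair (fst z') (snd z)"
  have k: "?k \<noteq> 0" using z(3) by (auto simp: opposite_def)
  let ?a = "pair v (snd z)" and ?b = "pair v (snd z')"
  have s: "v v* switch z z' 1 = v + ((?a - ?b) / ?k) *s (fst z - fst z')"
    by (simp add: vector_switch z(4))
  have "pair (v v* switch z z' 1) (snd z) = ?b" "pair (v v* switch z z' 1) (snd z') = ?a"
    unfolding s using k by (simp_all add: pair_simps z)
  then have "v v* (switch z z' 1 ** switch z z' t)
     = v + ((?a - ?b) / ?k) *s (fst z - fst z') + ((?b - t * ?a) / (t * ?k)) *s (fst z - t *s fst z')"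
    unfolding vector_matrix_mul_assoc[symmetric] vector_switch[of "v v* _"] z(4) by (simp add: s)
  also have "\<dots> = v v* letter z z' (1 / t)"
    unfolding vector_letter z(4) using k t by (simp add: vec_eq_iff field_simps)
  finally show "v v* (switch z z' 1 ** switch z z' t) = v v* letter z z' (1 / t)" .
qed

lemma exists_square_root: "\<exists>y :: 'a::alg_closed_field. y ^ 2 = x"
proof -
  have "degree [:- x, 0, 1:] > 0" by simp
  then obtain y where "poly [:- x, 0, 1:] y = 0" using alg_closed_imp_poly_has_root by blast
  then show ?thesis by (intro exI[of _ y]) (simp add: power2_eq_square eq_neg_iff_add_eq_0[symmetric])
qed

text \<open>The letters of a fixed pair of flags are multiplicative in the parameter, and
  \<open>s\<close> has a square root. As a square of a product of involutions, the letter visibly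
  has determinant 1.\<close>

lemma letter_eq_square:
  fixes z z' :: "('a::alg_closed_field, 'n::finite) flag"
  assumes z: "pair (fst z) (snd z) = 0" "pair (fst z') (snd z') = 0" "opposite z z'"
      "pair (fst z) (snd z') = pair (fst z') (snd z)" and s: "s \<noteq> 0"
  obtains t where "t \<noteq> 0"
    "letter z z' s = switch z z' 1 ** switch z z' t ** (switch z z' 1 ** switch z z' t)"
proof -
  obtain y where y: "y ^ 2 = s" using exists_square_root by blast
  then have "y \<noteq> 0" using s by auto
  have "letter z z' s = letter z z' y ** letter z z' y"
    using y \<open>y \<noteq> 0\<close> by (simp add: letter_mult[OF z(1-3)] power2_eq_square)
  also have "letter z z' y = switch z z' 1 ** switch z z' (1 / y)"
    using switch_mult_letter[OF z, of "1 / y"] \<open>y \<noteq> 0\<close> by simp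
  finally show ?thesis using \<open>y \<noteq> 0\<close> by (intro that[of "1 / y"]) auto
qed

lemma det_letter:
  fixes z z' :: "('a::alg_closed_field, 'n::finite) flag"
  assumes z: "pair (fst z) (snd z) = 0" "pair (fst z') (snd z') = 0" "opposite z z'" and s: "s \<noteq> 0"
  shows "det (letter z z' s) = 1"
proof -
  \<comment> \<open>Scaling one functional by this factor makes the two pairings equal, the
    condition under which \<open>switch\<close> is an involution.\<close>
  let ?c = "pair (fst z) (snd z') / pair (fst z') (snd z)"
  define y where "y = (fst z, ?c *s snd z)"
  have c: "?c \<noteq> 0" using z(3) by (auto simp: opposite_def)
  have eq: "letter z z' s = letter y z' s"
    using letter_scale[of 1 ?c 1 1 z z' s] c by (simp add: y_def)
  have y: "pair (fst y) (snd y) = 0" "opposite y z'" "pair (fst y) (snd z') = pair (fst z') (snd y)"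
    using z c by (auto simp: y_def opposite_def pair_simps)
  obtain t where t: "t \<noteq> 0" "letter y z' s = switch y z' 1 ** switch y z' t ** (switch y z' 1 ** switch y z' t)"
    using letter_eq_square[OF y(1) z(2) y(2,3) s] by metis
  have "det (switch y z' u) * det (switch y z' u) = 1" if "u \<noteq> 0" for u
    using switch_switch[OF y(1) z(2) y(2,3) that] by (metis det_mul det_I)
  from this[of 1] this[OF t(1)] have
    "det (switch y z' 1) * det (switch y z' t) * (det (switch y z' 1) * det (switch y z' t)) = 1"
    by (simp add: mult.left_commute mult.assoc[symmetric])
  then show ?thesis unfolding eq t(2) det_mul .
qed

text \<open>The row space lies in the span of \<open>p\<close> and \<open>p'\<close>. It contains
  \<open>p\<close> because \<open>q'\<close> vanishes at \<open>v\<close>, and then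
  \<open>p'\<close> by means of \<open>v'\<close>.\<close>

lemma rank_two_outer:
  fixes p p' q q' :: "'a::field^'n"
  assumes p: "\<And>a b. a *s p + b *s p' = 0 \<Longrightarrow> a = 0 \<and> b = 0"
    and v: "pair v q \<noteq> 0" "pair v q' = 0" and v': "pair v' q' \<noteq> 0"
  shows "rank (outer q p + outer q' p') = 2"
proof -
  let ?M = "outer q p + outer q' p'"
  have M: "x v* ?M = pair x q *s p + pair x q' *s p'" for x
    by (simp add: vector_matrix_mult_add_rdistrib vector_outer)
  have row: "row i ?M = axis i 1 v* ?M" for i
    unfolding M by (simp add: row_def outer_def vec_eq_iff pair_commute[of "axis i 1"])
  have span_rows: "x v* ?M \<in> vec.span (rows ?M)" for x
  proof -
    have "x v* ?M = (\<Sum>i\<in>UNIV. x $ i *s row i ?M)"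
      by (simp add: vector_matrix_mult_def row_def vec_eq_iff)
    also have "\<dots> \<in> vec.span (rows ?M)"
      by (intro vec.span_sum vec.span_scale vec.span_base) (auto simp: rows_def)
    finally show ?thesis .
  qed
  have "pair v q *s p \<in> vec.span (rows ?M)" using span_rows[of v] unfolding M by (simp add: v)
  from vec.span_scale[OF this, of "inverse (pair v q)"] have pin: "p \<in> vec.span (rows ?M)" using v by simp
  have "v' v* ?M - pair v' q *s p \<in> vec.span (rows ?M)"
    by (intro vec.span_diff span_rows vec.span_scale pin)
  then have "pair v' q' *s p' \<in> vec.span (rows ?M)" unfolding M by simp
  from vec.span_scale[OF this, of "inverse (pair v' q')"] have pin': "p' \<in> vec.span (rows ?M)" using v' by simp
  have pp: "p \<noteq> p'" using p[of 1 "-1"] by auto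
  have ind: "vec.independent {p, p'}"
  proof -
    have "p' \<noteq> 0" using p[of 0 1] by auto
    then have "vec.independent {p'}" by (simp add: vec.independent_insert)
    moreover have "p \<notin> vec.span {p'}"
    proof
      assume "p \<in> vec.span {p'}"
      then obtain k where "p = k *s p'" by (auto simp: vec.span_singleton)
      then show False using p[of 1 "-k"] by (simp add: vec.scale_minus_left)
    qed
    ultimately show ?thesis by (simp add: vec.independent_insert)
  qed
  have "vec.span {p, p'} = vec.span (rows ?M)"
  proof
    show "vec.span {p, p'} \<subseteq> vec.span (rows ?M)"
      using pin pin' by (intro vec.span_minimal) auto
    have "row i ?M \<in> vec.span {p, p'}" for i
      unfolding row M by (intro vec.span_add vec.span_scale vec.span_base) auto
    then show "vec.span (rows ?M) \<subseteq> vec.span {p, p'}"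
      by (intro vec.span_minimal) (auto simp: rows_def)
  qed
  from vec.dim_eq_card[OF this ind] show ?thesis
    using pp by (simp add: row_rank_def_gen)
qed

text \<open>For \<open>s \<noteq> 1\<close> the difference is a sum of two rank one maps with
  independent images and functionals. The parity is the condition that defines \<open>SO\<close> in
  characteristic 2 and even dimension.\<close>

lemma even_rank_letter:
  assumes z: "pair (fst z) (snd z) = 0" "pair (fst z') (snd z') = 0" "opposite z z'" and s: "s \<noteq> 0"
  shows "even (rank (letter z z' s - mat 1))"
proof (cases "s = 1")
  case True
  have "rank (0 :: 'a^'b^'b) = 0"
    by (simp add: row_rank_def_gen rows_def row_def zero_vec_def[symmetric])
  then show ?thesis using True by simp
next
  case False
  let ?k = "pair (fst z) (snd z')" and ?k' = "pair (fst z') (snd z)"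
  have k: "?k \<noteq> 0" "?k' \<noteq> 0" using z(3) by (auto simp: opposite_def)
  have s': "1 / s - 1 \<noteq> 0" "s - 1 \<noteq> 0" using False s by (auto simp: field_simps)
  have "letter z z' s - mat 1 = outer (((s - 1) / ?k) *s snd z') (fst z) + outer (((1 / s - 1) / ?k') *s snd z) (fst z')"
    by (simp add: letter_def)
  moreover have "rank (outer (((s - 1) / ?k) *s snd z') (fst z) + outer (((1 / s - 1) / ?k') *s snd z) (fst z')) = 2"
  proof (rule rank_two_outer)
    show "a = 0 \<and> b = 0" if "a *s fst z + b *s fst z' = 0" for a b
    proof -
      have "pair (a *s fst z + b *s fst z') (snd z') = 0" "pair (a *s fst z + b *s fst z') (snd z) = 0"
        using that by (simp_all add: pair_simps)
      then show ?thesis using k z by (simp add: pair_simps)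
    qed
    show "pair (fst z) (((s - 1) / ?k) *s snd z') \<noteq> 0" "pair (fst z) (((1 / s - 1) / ?k') *s snd z) = 0"
      "pair (fst z') (((1 / s - 1) / ?k') *s snd z) \<noteq> 0"
      using k z s' by (simp_all add: pair_simps)
  qed
  ultimately show ?thesis by simp
qed

section \<open>Rational curves of flags\<close>

text \<open>The primed curves are the same curve in the coordinate \<open>1 / s\<close>, up to
  scalars that do not affect the vanishing of a test. The second flag is thus the point at infinity,
  and a test nonzero there is nonzero at some finite parameter too.\<close>

lemma finite_zeros_curve:
  fixes P P' S S' :: "'a::alg_closed_field \<Rightarrow> 'a^'n"
  assumes P: "\<And>i. (\<lambda>s. P s $ i) \<in> poly_funs" "\<And>i. (\<lambda>s. S s $ i) \<in> poly_funs"
    and P': "\<And>i. (\<lambda>s. P' s $ i) \<in> poly_funs" "\<And>i. (\<lambda>s. S' s $ i) \<in> poly_funs"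
    and inv: "\<And>s. s \<noteq> 0 \<Longrightarrow> P s = s ^ k *s P' (1 / s)" "\<And>s. s \<noteq> 0 \<Longrightarrow> S s = s ^ l *s S' (1 / s)"
    and f: "f \<in> flag_tests" "f (P 0, S 0) \<noteq> 0 \<or> f (P' 0, S' 0) \<noteq> 0"
  shows "finite {s. f (P s, S s) = 0}"
proof -
  have fp: "(\<lambda>s. f (A s, D s)) \<in> poly_funs" if "\<And>i. (\<lambda>s. A s $ i) \<in> poly_funs" "\<And>i. (\<lambda>s. D s $ i) \<in> poly_funs"
    for A D :: "'a \<Rightarrow> 'a^'n"
    using f(1) that unfolding flag_tests_def
    by (auto intro!: poly_funs.pair poly_funs.vector_matrix_mult poly_funs.const_fun)
  have fs: "f (c *s p, d *s q) = 0 \<longleftrightarrow> f (p, q) = 0" if "c \<noteq> 0" "d \<noteq> 0" for c d p q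
    using f(1) that unfolding flag_tests_def by (auto simp: pair_simps scalar_vector_matrix_assoc)
  have rev: "f (P s, S s) = 0 \<longleftrightarrow> f (P' (1 / s), S' (1 / s)) = 0" if "s \<noteq> 0" for s
    using that by (simp add: inv fs)
  have "\<exists>s. f (P s, S s) \<noteq> 0"
  proof (cases "f (P 0, S 0) = 0")
    case True
    then have "finite {s. f (P' s, S' s) = 0}"
      using f(2) by (intro finite_zeros_poly_funs[OF fp[OF P'], of 0]) auto
    then have "finite ({s. f (P' s, S' s) = 0} \<union> {0})" by simp
    from ex_new_if_finite[OF infinite_alg_closed this] obtain s where "f (P' s, S' s) \<noteq> 0" "s \<noteq> 0" by auto
    then show ?thesis using rev[of "1 / s"] by (intro exI[of _ "1 / s"]) simp
  qed auto
  then obtain s where "f (P s, S s) \<noteq> 0" by blast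
  then show ?thesis by (rule finite_zeros_poly_funs[OF fp[OF P]])
qed

section \<open>Points over a subfield\<close>

locale subfield_set =
  fixes K :: "'a::field set"
  assumes zero: "0 \<in> K" and one: "1 \<in> K"
    and add: "x \<in> K \<Longrightarrow> y \<in> K \<Longrightarrow> x + y \<in> K" and uminus: "x \<in> K \<Longrightarrow> - x \<in> K"
    and mult: "x \<in> K \<Longrightarrow> y \<in> K \<Longrightarrow> x * y \<in> K" and inverse: "x \<in> K \<Longrightarrow> inverse x \<in> K"
begin

lemma diff: "x \<in> K \<Longrightarrow> y \<in> K \<Longrightarrow> x - y \<in> K"
  using add[OF _ uminus] by simp

lemma divide: "x \<in> K \<Longrightarrow> y \<in> K \<Longrightarrow> x / y \<in> K"
  using mult[OF _ inverse] by (simp add: divide_inverse)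

lemma sum: "(\<And>i. i \<in> I \<Longrightarrow> f i \<in> K) \<Longrightarrow> (\<Sum>i\<in>I. f i) \<in> K"
  by (induction I rule: infinite_finite_induct) (auto intro: zero add)

lemma pair: "(\<And>i. u $ i \<in> K) \<Longrightarrow> (\<And>i. v $ i \<in> K) \<Longrightarrow> pair u v \<in> K"
  unfolding pair_def by (intro sum mult)

lemma matrix_mult: "(\<And>i j. A $ i $ j \<in> K) \<Longrightarrow> (\<And>i j. C $ i $ j \<in> K) \<Longrightarrow> (A ** C) $ i $ j \<in> K"
  unfolding matrix_matrix_mult_def by (simp, intro sum mult)

lemma mat_1: "(mat 1 :: 'a^'n^'n) $ i $ j \<in> K"
  by (simp add: mat_def zero one)

lemma letter:
  assumes "\<And>i. fst z $ i \<in> K" "\<And>i. snd z $ i \<in> K" "\<And>i. fst z' $ i \<in> K" "\<And>i. snd z' $ i \<in> K" "s \<in> K"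
  shows "letter z z' s $ i $ j \<in> K"
  unfolding letter_def outer_def
  by (simp, intro add mat_1 mult divide diff pair assms one)

end

lemma subfield_imp_subfield_set:
  fixes K :: "'a::field set"
  assumes "subfield K ring_of_type_algebra" shows "subfield_set K"
proof -
  interpret R: field "ring_of_type_algebra :: 'a ring" by (rule field_from_type_algebra)
  note sub = subdomainE[OF subfield.axioms(1)[OF assms]]
  have units: "Units (ring_of_type_algebra\<lparr>carrier := K\<rparr>) = K - {0}"
    using subfield.subfield_Units[OF assms] by (simp add: ring_of_type_algebra_def)
  have neg: "\<ominus>\<^bsub>ring_of_type_algebra\<^esub> x = - x" for x :: 'a
    by (rule R.minus_equality) (simp_all add: ring_of_type_algebra_def)
  show ?thesis
  proof
    show "0 \<in> K" "1 \<in> K" using sub by (simp_all add: ring_of_type_algebra_def)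
    fix x assume x: "x \<in> K"
    show "- x \<in> K" using sub(5)[OF x] by (simp add: neg)
    show "inverse x \<in> K"
    proof (cases "x = 0")
      case True then show ?thesis using sub by (simp add: ring_of_type_algebra_def)
    next
      case False
      then have "x \<in> Units (ring_of_type_algebra\<lparr>carrier := K\<rparr>)" using x units by simp
      then obtain y where "y \<in> K" "x * y = 1" by (auto simp: Units_def ring_of_type_algebra_def)
      then show ?thesis using inverse_unique by metis
    qed
    fix y assume y: "y \<in> K"
    show "x + y \<in> K" using sub(7)[OF x y] by (simp add: ring_of_type_algebra_def)
    show "x * y \<in> K" using sub(6)[OF x y] by (simp add: ring_of_type_algebra_def)
  qed
qed

text \<open>
  Opposite flags are parametrised by vectors \<open>p, p'\<close> and functionals \<open>\<alpha>, \<beta>\<close>; the functionals of the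
  flags are \<open>q = \<alpha>(p) \<beta> - \<beta>(p) \<alpha>\<close> and \<open>q' = \<beta>(p') \<alpha> - \<alpha>(p') \<beta>\<close>.
\<close>

lemma letter_in_closure_of_rational:
  fixes z z' :: "('a::field, 'n::finite) flag"
  assumes inf: "infinite K" and K: "subfield_set K"
    and \<Gamma>: "\<And>z z' :: ('a, 'n) flag. \<And>s. (\<And>i. fst z $ i \<in> K) \<Longrightarrow> (\<And>i. snd z $ i \<in> K) \<Longrightarrow> (\<And>i. fst z' $ i \<in> K) \<Longrightarrow>
       (\<And>i. snd z' $ i \<in> K) \<Longrightarrow> s \<in> K \<Longrightarrow> s \<noteq> 0 \<Longrightarrow> pair (fst z) (snd z) = 0 \<Longrightarrow> pair (fst z') (snd z') = 0 \<Longrightarrow>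
       opposite z z' \<Longrightarrow> letter z z' s \<in> \<Gamma>"
    and z: "pair (fst z) (snd z) = 0" "pair (fst z') (snd z') = 0" "opposite z z'" and s: "s \<noteq> 0"
  shows "letter z z' s \<in> zariski closure_of \<Gamma>"
  unfolding in_zariski_closure_iff
proof (intro ballI impI)
  interpret K: subfield_set K by (rule K)
  fix f :: "'a^'n^'n \<Rightarrow> 'a" assume f: "f \<in> matrix_poly_funs" "\<forall>A\<in>\<Gamma>. f A = 0"
  \<comment> \<open>All data are coordinates of one affine space: \<open>None\<close> is the
    parameter of the letter, and \<open>Some (i, k)\<close> is the entry \<open>i\<close> of one of
    the vectors \<open>p\<close>, \<open>p'\<close>, \<open>\<alpha>\<close>,
    \<open>\<beta>\<close>.\<close>
  define vec where "vec = (\<lambda>k (x :: ('n \<times> bool \<times> bool) option \<Rightarrow> 'a). (\<chi> i. x (Some (i, k))) :: 'a^'n)"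
  let ?p = "vec (True, True)" and ?p' = "vec (True, False)" and ?\<alpha> = "vec (False, True)" and ?\<beta> = "vec (False, False)"
  define q where "q = (\<lambda>x. pair (?p x) (?\<alpha> x) *s ?\<beta> x - pair (?p x) (?\<beta> x) *s ?\<alpha> x)"
  define q' where "q' = (\<lambda>x. pair (?p' x) (?\<beta> x) *s ?\<alpha> x - pair (?p' x) (?\<alpha> x) *s ?\<beta> x)"
  define \<Delta> where "\<Delta> = (\<lambda>x. pair (?p x) (?\<alpha> x) * pair (?p' x) (?\<beta> x) - pair (?p' x) (?\<alpha> x) * pair (?p x) (?\<beta> x))"
  define D where "D = (\<lambda>x. x None * \<Delta> x)"
  define N where "N = (\<lambda>x. smat (D x) (mat 1) + outer ((x None * (x None - 1)) *s q' x) (?p x)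
      + outer ((1 - x None) *s q x) (?p' x))"
  have pq: "pair (?p x) (q x) = 0" "pair (?p' x) (q' x) = 0" "pair (?p x) (q' x) = \<Delta> x" "pair (?p' x) (q x) = \<Delta> x" for x
    by (simp_all add: q_def q'_def \<Delta>_def pair_simps algebra_simps)
  have letter: "(\<chi> i j. N x $ i $ j / D x) = letter (?p x, q x) (?p' x, q' x) (x None)" if "D x \<noteq> 0" for x
  proof -
    have "x None * (x None - 1) / D x = (x None - 1) / \<Delta> x" "(1 - x None) / D x = (1 / x None - 1) / \<Delta> x"
      using that by (auto simp: D_def field_simps)
    moreover have "(D x * m + (a * b) * c + (d * e) * g) / D x = m + ((a / D x) * b) * c + ((d / D x) * e) * g"
      for m a b c d e g using that by (simp add: add_divide_distrib)
    ultimately have "N x $ i $ j / D x = letter (?p x, q x) (?p' x, q' x) (x None) $ i $ j" for i j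
      by (simp only: N_def letter_def outer_def smat_def vec_lambda_beta vector_add_component
          vector_smult_component fst_conv snd_conv pq)
    then show ?thesis by (simp add: vec_eq_iff)
  qed
  have vec: "(\<lambda>x. vec k x $ i) \<in> pfun" for k i by (simp add: vec_def pfun.var)
  have qp: "(\<lambda>x. q x $ i) \<in> pfun" "(\<lambda>x. q' x $ i) \<in> pfun" for i
    unfolding q_def q'_def vector_minus_component vector_smult_component
    by (intro pfun.diff pfun.mult pfun.pair vec)+
  have D: "D \<in> pfun" unfolding D_def \<Delta>_def by (intro pfun.mult pfun.diff pfun.var pfun.pair vec)
  have N: "(\<lambda>x. N x $ i $ j) \<in> pfun" for i j
    unfolding N_def vector_add_component
    by (intro pfun.add pfun.smat pfun.outer D pfun.const vec)
      (unfold vector_smult_component, (intro pfun.mult pfun.diff pfun.const pfun.var qp)+)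
  obtain d h where h: "h \<in> pfun" "\<And>x. D x \<noteq> 0 \<Longrightarrow> f (\<chi> i j. N x $ i $ j / D x) = h x / D x ^ d"
    using pfun.matrix_poly_comp_fraction[OF f(1) N D] by blast
  have hD: "h x * D x = 0" for x
  proof (rule pfun_zero_dense[where f = "\<lambda>x. h x * D x", OF _ inf])
    show "(\<lambda>x. h x * D x) \<in> pfun" by (intro pfun.mult h D)
    fix x :: "('n \<times> bool \<times> bool) option \<Rightarrow> 'a" assume x: "\<And>i. x i \<in> K"
    show "h x * D x = 0"
    proof (cases "D x = 0")
      case False
      have v: "vec k x $ i \<in> K" for k i by (simp add: vec_def x)
      have "q x $ i \<in> K" "q' x $ i \<in> K" for i
        unfolding q_def q'_def vector_minus_component vector_smult_component
        by (intro K.diff K.mult K.pair v)+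
      then have "letter (?p x, q x) (?p' x, q' x) (x None) \<in> \<Gamma>"
        using v x False by (intro \<Gamma>) (auto simp: pq opposite_def D_def)
      then have "f (\<chi> i j. N x $ i $ j / D x) = 0" using f(2) letter[OF False] by simp
      then show ?thesis using h(2)[OF False] False by simp
    qed simp
  qed
  \<comment> \<open>The given flags are recovered up to scalars by taking
    \<open>\<alpha> = snd z'\<close> and \<open>\<beta> = snd z\<close>.\<close>
  define x where "x = (\<lambda>k. case k of None \<Rightarrow> s
     | Some (i, k) \<Rightarrow> (if fst k then (if snd k then fst z else fst z') else (if snd k then snd z' else snd z)) $ i)"
  have vx: "?p x = fst z" "?p' x = fst z'" "?\<alpha> x = snd z'" "?\<beta> x = snd z" "x None = s"
    by (simp_all add: vec_def x_def)
  have qx: "q x = pair (fst z) (snd z') *s snd z" "q' x = pair (fst z') (snd z) *s snd z'"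
    by (simp_all add: q_def q'_def vx z)
  have "\<Delta> x = pair (fst z) (snd z') * pair (fst z') (snd z)" by (simp add: \<Delta>_def vx z)
  then have Dx: "D x \<noteq> 0" using z(3) s by (simp add: D_def vx opposite_def)
  then have "f (letter (?p x, q x) (?p' x, q' x) (x None)) = 0"
    using h(2)[OF Dx] hD[of x] letter[OF Dx] by simp
  moreover have "letter (?p x, q x) (?p' x, q' x) (x None) = letter z z' s"
    unfolding vx qx using letter_scale[of 1 "pair (fst z) (snd z')" 1 "pair (fst z') (snd z)" z z' s] z(3)
    by (simp add: opposite_def)
  ultimately show "f (letter z z' s) = 0" by simp
qed

text \<open>Together with the two flag vectors, a basis of the common kernel of the two functionals
  spans the space, so it has at least \<open>m - 2\<close> elements. Indices start at 1 because
  coordinate 0 is the parameter of the degeneration.\<close>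

lemma dual_coordinates:
  fixes z z' :: "('a::field, 'n::finite) flag"
  assumes z: "pair (fst z) (snd z) = 0" "pair (fst z') (snd z') = 0" "opposite z z'"
  obtains t a where "\<And>j. 0 < j \<Longrightarrow> j < CARD('n) - 1 \<Longrightarrow> pair (t j) (snd z) = 0 \<and> pair (t j) (snd z') = 0"
    "\<And>j k. 0 < j \<Longrightarrow> j < CARD('n) - 1 \<Longrightarrow> 0 < k \<Longrightarrow> k < CARD('n) - 1 \<Longrightarrow> pair (t j) (a k) = (if j = k then 1 else 0)"
    "\<And>k. 0 < k \<Longrightarrow> k < CARD('n) - 1 \<Longrightarrow> pair (fst z) (a k) = 0 \<and> pair (fst z') (a k) = 0"
proof -
  let ?m = "CARD('n)" and ?k = "pair (fst z) (snd z')" and ?k' = "pair (fst z') (snd z)"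
  have k: "?k \<noteq> 0" "?k' \<noteq> 0" using z(3) by (auto simp: opposite_def)
  define W where "W = {v. pair v (snd z) = 0 \<and> pair v (snd z') = 0}"
  have W: "vec.subspace W" by (rule vec.subspaceI) (auto simp: W_def pair_simps)
  obtain T where T: "T \<subseteq> W" "vec.independent T" "W \<subseteq> vec.span T" by (rule vec.basis_exists)
  have finT: "finite T" by (rule vec.finiteI_independent[OF T(2)])
  have "v \<in> vec.span ({fst z, fst z'} \<union> T)" for v
  proof -
    let ?w = "v - (pair v (snd z') / ?k) *s fst z - (pair v (snd z) / ?k') *s fst z'"
    have "?w \<in> W" using k z by (simp add: W_def pair_simps)
    then have w: "?w \<in> vec.span ({fst z, fst z'} \<union> T)" using T(3) vec.span_mono[of T "{fst z, fst z'} \<union> T"] by blast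
    have "?w + (pair v (snd z) / ?k') *s fst z' + (pair v (snd z') / ?k) *s fst z \<in> vec.span ({fst z, fst z'} \<union> T)"
      by (intro vec.span_add w vec.span_scale vec.span_base) auto
    then show ?thesis by simp
  qed
  then have "UNIV \<subseteq> vec.span ({fst z, fst z'} \<union> T)" by blast
  then have "vec.dim (UNIV :: ('a^'n) set) \<le> card ({fst z, fst z'} \<union> T)"
    by (rule vec.dim_le_card) (use finT in simp)
  then have "?m \<le> card ({fst z, fst z'} \<union> T)" unfolding vec_dim_card .
  also have "\<dots> \<le> card {fst z, fst z'} + card T" by (rule card_Un_le)
  also have "card {fst z, fst z'} \<le> 2" by (simp add: card_insert_if)
  finally have "?m - 2 \<le> card T" by simp
  then have "card {1..<?m - 1} \<le> card T" by simp
  then obtain t where t: "t ` {1..<?m - 1} \<subseteq> T" "inj_on t {1..<?m - 1}"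
    using card_le_inj[OF finite_atLeastLessThan finT] by metis
  have tT: "t j \<in> T" if "0 < j" "j < ?m - 1" for j using t(1) that by auto
  have "\<exists>a. pair (t k) a = 1 \<and> (\<forall>u\<in>{fst z, fst z'} \<union> (T - {t k}). pair u a = 0)" if k': "0 < k" "k < ?m - 1" for k
  proof -
    let ?U = "vec.span ({fst z, fst z'} \<union> (T - {t k}))"
    have "t k \<notin> ?U"
    proof
      assume "t k \<in> ?U"
      then obtain a where a: "t k - a *s fst z \<in> vec.span (insert (fst z') (T - {t k}))"
        by (auto simp: vec.span_insert)
      then obtain b where b: "t k - a *s fst z - b *s fst z' \<in> vec.span (T - {t k})"
        by (subst (asm) vec.span_insert) auto
      moreover have "vec.span (T - {t k}) \<subseteq> W" using T(1) W by (intro vec.span_minimal) auto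
      ultimately have "t k - a *s fst z - b *s fst z' \<in> W" by blast
      moreover have "t k \<in> W" using tT[OF k'] T(1) by blast
      ultimately have "a = 0" "b = 0" using k z by (auto simp: W_def pair_simps)
      with b have "t k \<in> vec.span (T - {t k})" by simp
      then show False using T(2) tT[OF k'] unfolding vec.dependent_def by blast
    qed
    then obtain q where q: "pair (t k) q \<noteq> 0" "\<And>u. u \<in> ?U \<Longrightarrow> pair u q = 0"
      using subspace_separate[OF vec.subspace_span] by metis
    then show ?thesis
      by (intro exI[of _ "inverse (pair (t k) q) *s q"]) (auto simp: pair_simps vec.span_base)
  qed
  then obtain a where a: "\<And>k. 0 < k \<Longrightarrow> k < ?m - 1 \<Longrightarrow> pair (t k) (a k) = 1 \<and>
     (\<forall>u\<in>{fst z, fst z'} \<union> (T - {t k}). pair u (a k) = 0)" by metis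
  show ?thesis
  proof (rule that[of t a])
    show "pair (t j) (snd z) = 0 \<and> pair (t j) (snd z') = 0" if "0 < j" "j < ?m - 1" for j
      using tT[OF that] T(1) by (auto simp: W_def)
    show "pair (t j) (a k) = (if j = k then 1 else 0)" if "0 < j" "j < ?m - 1" "0 < k" "k < ?m - 1" for j k
    proof (cases "j = k")
      case False
      then have "t j \<in> T - {t k}" using that tT t(2) by (auto simp: inj_on_def)
      then show ?thesis using a[of k] that False by auto
    qed (use a that in auto)
    show "pair (fst z) (a k) = 0 \<and> pair (fst z') (a k) = 0" if "0 < k" "k < ?m - 1" for k
      using a[OF that] by auto
  qed
qed

section \<open>The flags of the special linear group\<close>

definition all_flags :: "('a::field, 'n::finite) flag set" where
  "all_flags = {z. fst z \<noteq> 0 \<and> pair (fst z) (snd z) = 0}"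

text \<open>If the vectors are proportional, a line joins the functionals. Otherwise the vectors are
  joined by a line and the functionals by a quadratic curve on which the pairing vanishes
  identically.\<close>

lemma curve_connected_all_flags: "curve_connected (all_flags :: ('a::alg_closed_field, 'n::finite) flag set)"
  unfolding curve_connected_def
proof (intro ballI)
  fix z1 z2 :: "('a, 'n) flag" assume z: "z1 \<in> all_flags" "z2 \<in> all_flags"
  obtain p1 q1 p2 q2 where z_eq: "z1 = (p1, q1)" "z2 = (p2, q2)" by (cases z1; cases z2)
  have p: "p1 \<noteq> 0" "p2 \<noteq> 0" "pair p1 q1 = 0" "pair p2 q2 = 0" using z by (auto simp: all_flags_def z_eq)
  note pf = poly_funs.add_fun poly_funs.mult_fun poly_funs.power poly_funs.const_fun poly_funs_id
  show "\<exists>\<gamma> :: 'a \<Rightarrow> ('a, 'n) flag. (\<forall>s. \<gamma> s \<in> all_flags) \<and>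
      (\<forall>f\<in>flag_tests. f z1 \<noteq> 0 \<or> f z2 \<noteq> 0 \<longrightarrow> finite {s. f (\<gamma> s) = 0})"
  proof (cases "p2 \<in> vec.span {p1}")
    case True
    then obtain k where k: "p2 = k *s p1" by (auto simp: vec.span_singleton)
    then have "k \<noteq> 0" using p by auto
    show ?thesis
    proof (intro exI[of _ "\<lambda>s. (p1, q1 + s *s q2)"] conjI allI ballI impI)
      show "(p1, q1 + s *s q2) \<in> all_flags" for s
        using p k \<open>k \<noteq> 0\<close> by (auto simp: all_flags_def pair_simps)
      fix f :: "('a, 'n) flag \<Rightarrow> 'a" assume f: "f \<in> flag_tests" "f z1 \<noteq> 0 \<or> f z2 \<noteq> 0"
      have "f (p1, q2) = 0 \<longleftrightarrow> f (k *s p1, q2) = 0"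
        using f(1) \<open>k \<noteq> 0\<close> unfolding flag_tests_def by (auto simp: pair_simps scalar_vector_matrix_assoc)
      with f(2) have f2: "f (p1, q1 + 0 *s q2) \<noteq> 0 \<or> f (p1, 0 *s q1 + q2) \<noteq> 0" by (simp add: z_eq k)
      show "finite {s. f (p1, q1 + s *s q2) = 0}"
      proof (rule finite_zeros_curve[where P' = "\<lambda>_. p1" and S' = "\<lambda>s. s *s q1 + q2" and k = 0 and l = 1])
        show "(\<lambda>s. p1 $ i) \<in> poly_funs" "(\<lambda>s. p1 $ i) \<in> poly_funs" for i by (rule poly_funs.const_fun)+
        show "(\<lambda>s. (q1 + s *s q2) $ i) \<in> poly_funs" "(\<lambda>s. (s *s q1 + q2) $ i) \<in> poly_funs" for i
          unfolding vector_add_component vector_smult_component by (intro pf)+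
        show "p1 = s ^ 0 *s p1" for s by simp
        show "q1 + s *s q2 = s ^ 1 *s ((1 / s) *s q1 + q2)" if "s \<noteq> 0" for s
          using that by (simp add: vec.scale_right_distrib)
      qed (use f f2 in auto)
    qed
  next
    case False
    \<comment> \<open>The pairing along the curve is a polynomial in \<open>s\<close>; these are the
      conditions that its coefficients at \<open>s\<close> and \<open>s ^ 2\<close> vanish, solvable
      since \<open>p1\<close> and \<open>p2\<close> are independent.\<close>
    obtain b where b: "pair p1 b = - pair p2 q1" "pair p2 b = - pair p1 q2"
    proof -
      obtain u where u: "pair p2 u \<noteq> 0" "pair p1 u = 0"
        using subspace_separate[OF vec.subspace_span False] vec.span_base[of p1 "{p1}"] by (metis singletonI)
      have "p1 \<notin> vec.span {p2}"
      proof
        assume "p1 \<in> vec.span {p2}"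
        then obtain k where k: "p1 = k *s p2" by (auto simp: vec.span_singleton)
        then have "p2 = inverse k *s p1" using p by auto
        then show False using False by (auto simp: vec.span_singleton)
      qed
      then obtain v where v: "pair p1 v \<noteq> 0" "pair p2 v = 0"
        using subspace_separate[OF vec.subspace_span] vec.span_base[of p2 "{p2}"] by (metis singletonI)
      show ?thesis
        by (rule that[of "(- pair p2 q1 / pair p1 v) *s v + (- pair p1 q2 / pair p2 u) *s u"])
          (use u v in \<open>simp_all add: pair_simps pair_minus\<close>)
    qed
    show ?thesis
    proof (intro exI[of _ "\<lambda>s. (p1 + s *s p2, q1 + s *s b + s ^ 2 *s q2)"] conjI allI ballI impI)
      show "(p1 + s *s p2, q1 + s *s b + s ^ 2 *s q2) \<in> all_flags" for s
      proof -
        have "p1 + s *s p2 \<noteq> 0"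
        proof
          assume *: "p1 + s *s p2 = 0"
          then have "s \<noteq> 0" using p by auto
          have "p1 = (- s) *s p2" using * by (simp add: eq_neg_iff_add_eq_0 vec.scale_minus_left)
          then have "p2 = (- inverse s) *s p1" using \<open>s \<noteq> 0\<close> by simp
          moreover have "(- inverse s) *s p1 \<in> vec.span {p1}" by (intro vec.span_scale vec.span_base) simp
          ultimately show False using False by metis
        qed
        then show ?thesis
          using p b by (simp add: all_flags_def pair_simps power2_eq_square algebra_simps)
      qed
      fix f :: "('a, 'n) flag \<Rightarrow> 'a" assume f: "f \<in> flag_tests" "f z1 \<noteq> 0 \<or> f z2 \<noteq> 0"
      show "finite {s. f (p1 + s *s p2, q1 + s *s b + s ^ 2 *s q2) = 0}"
      proof (rule finite_zeros_curve[where P' = "\<lambda>s. s *s p1 + p2" and S' = "\<lambda>s. s ^ 2 *s q1 + s *s b + q2" and k = 1 and l = 2])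
        show "(\<lambda>s. (p1 + s *s p2) $ i) \<in> poly_funs" "(\<lambda>s. (q1 + s *s b + s ^ 2 *s q2) $ i) \<in> poly_funs"
          "(\<lambda>s. (s *s p1 + p2) $ i) \<in> poly_funs" "(\<lambda>s. (s ^ 2 *s q1 + s *s b + q2) $ i) \<in> poly_funs" for i
          unfolding vector_add_component vector_smult_component by (intro pf)+
        show "p1 + s *s p2 = s ^ 1 *s ((1 / s) *s p1 + p2)" if "s \<noteq> 0" for s
          using that by (simp add: vec.scale_right_distrib)
        show "q1 + s *s b + s ^ 2 *s q2 = s ^ 2 *s ((1 / s) ^ 2 *s q1 + (1 / s) *s b + q2)" if "s \<noteq> 0" for s
          using that by (simp add: vec.scale_right_distrib power2_eq_square)
      qed (use f in \<open>auto simp: z_eq\<close>)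
    qed
  qed
qed

text \<open>The functional is kept and the vector moves along the common kernel of both functionals,
  so the pairings with the opposite flag do not change.\<close>

lemma deformable_all_flags: "deformable (all_flags :: ('a::field, 'n::finite) flag set) (CARD('n) - 1)"
  unfolding deformable_def
proof (intro ballI impI)
  fix z z' :: "('a, 'n) flag" assume z: "z \<in> all_flags" "z' \<in> all_flags" "opposite z z'"
  let ?m = "CARD('n)" and ?k = "pair (fst z) (snd z')"
  have z0: "pair (fst z) (snd z) = 0" "pair (fst z') (snd z') = 0" using z by (auto simp: all_flags_def)
  obtain t a where t: "\<And>j. 0 < j \<Longrightarrow> j < ?m - 1 \<Longrightarrow> pair (t j) (snd z) = 0 \<and> pair (t j) (snd z') = 0"
    and ta: "\<And>j k. 0 < j \<Longrightarrow> j < ?m - 1 \<Longrightarrow> 0 < k \<Longrightarrow> k < ?m - 1 \<Longrightarrow> pair (t j) (a k) = (if j = k then 1 else 0)"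
    and za: "\<And>k. 0 < k \<Longrightarrow> k < ?m - 1 \<Longrightarrow> pair (fst z) (a k) = 0 \<and> pair (fst z') (a k) = 0"
    using dual_coordinates[OF z0 z(3)] by blast
  define I where "I = {1..<?m - 1}"
  define Z where "Z = (\<lambda>x. (fst z + (\<Sum>j\<in>I. x j *s t j), snd z))"
  have ps: "pair (\<Sum>j\<in>I. x j *s t j) q = (\<Sum>j\<in>I. x j * pair (t j) q)" for x q
    by (induction I rule: infinite_finite_induct) (simp_all add: pair_simps)
  have zq: "pair (\<Sum>j\<in>I. x j *s t j) (snd z) = 0" "pair (\<Sum>j\<in>I. x j *s t j) (snd z') = 0" for x
    unfolding ps using t by (auto intro!: sum.neutral simp: I_def)
  show "\<exists>Z :: (nat \<Rightarrow> 'a) \<Rightarrow> ('a, 'n) flag. \<exists>a.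
     (\<forall>i. (\<lambda>x. fst (Z x) $ i) \<in> pfun) \<and> (\<forall>i. (\<lambda>x. snd (Z x) $ i) \<in> pfun) \<and>
     (\<forall>x. Z x \<in> all_flags) \<and> Z (\<lambda>_. 0) = z \<and>
     (\<forall>x. pair (fst (Z x)) (snd z') = pair (fst z) (snd z')) \<and>
     (\<forall>x. pair (fst z') (snd (Z x)) = pair (fst z') (snd z)) \<and>
     (\<forall>x j. 0 < j \<longrightarrow> j < ?m - 1 \<longrightarrow> pair (fst (Z x)) (a j) = x j * pair (fst z) (snd z'))"
  proof (intro exI[of _ Z] exI[of _ "\<lambda>j. ?k *s a j"] conjI allI impI)
    show "(\<lambda>x. fst (Z x) $ i) \<in> pfun" for i
      unfolding Z_def fst_conv vector_add_component sum_component vector_smult_component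
      by (intro pfun.add pfun.const pfun.sum pfun.mult pfun.var)
    show "(\<lambda>x. snd (Z x) $ i) \<in> pfun" for i by (simp add: Z_def pfun.const)
    show k: "pair (fst (Z x)) (snd z') = ?k" for x by (simp add: Z_def pair_simps zq)
    show "Z x \<in> all_flags" for x
    proof -
      have "fst (Z x) \<noteq> 0" using k[of x] z(3) by (auto simp: opposite_def pair_simps)
      then show ?thesis by (simp add: all_flags_def) (simp add: Z_def pair_simps zq z0)
    qed
    show "Z (\<lambda>_. 0) = z" by (simp add: Z_def)
    show "pair (fst z') (snd (Z x)) = pair (fst z') (snd z)" for x by (simp add: Z_def)
    show "pair (fst (Z x)) (?k *s a j) = x j * ?k" if j: "0 < j" "j < ?m - 1" for x j
    proof -
      have "pair (\<Sum>i\<in>I. x i *s t i) (a j) = (\<Sum>i\<in>I. if i = j then x i else 0)"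
        unfolding ps using ta[OF _ _ j] by (intro sum.cong) (auto simp: I_def)
      also have "\<dots> = x j" using j by (simp add: I_def)
      finally show ?thesis using za[OF j] by (simp add: Z_def pair_simps mult.commute)
    qed
  qed
qed

section \<open>Quadratic forms\<close>

locale quadratic_form =
  fixes Q :: "'a::alg_closed_field^'n \<Rightarrow> 'a" and a :: "'n \<Rightarrow> 'n \<Rightarrow> 'a"
  assumes Q_eq: "Q v = (\<Sum>i\<in>UNIV. \<Sum>j\<in>UNIV. a i j * v $ i * v $ j)"
begin

text \<open>The matrix of the polar form \<open>Q (u + v) - Q u - Q v\<close>, which makes sense in
  every characteristic; its diagonal is \<open>2 * a i i\<close>.\<close>

definition gram :: "'a^'n^'n" where
  "gram = (\<chi> i j. a i j + a j i)"

definition J :: "'a^'n \<Rightarrow> 'a^'n" where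
  "J v = gram *v v"

definition B :: "'a^'n \<Rightarrow> 'a^'n \<Rightarrow> 'a" where
  "B u v = pair u (J v)"

lemma B_eq: "B u v = (\<Sum>i\<in>UNIV. \<Sum>j\<in>UNIV. (a i j + a j i) * u $ i * v $ j)"
  by (simp add: B_def J_def gram_def pair_def matrix_vector_mult_def sum_distrib_left mult_ac)

lemma Q_add: "Q (u + v) = Q u + Q v + B u v"
proof -
  have "B u v = (\<Sum>i\<in>UNIV. \<Sum>j\<in>UNIV. a i j * u $ i * v $ j) + (\<Sum>i\<in>UNIV. \<Sum>j\<in>UNIV. a j i * u $ i * v $ j)"
    by (simp add: B_eq distrib_right sum.distrib)
  also have "(\<Sum>i\<in>UNIV. \<Sum>j\<in>UNIV. a j i * u $ i * v $ j) = (\<Sum>i\<in>UNIV. \<Sum>j\<in>UNIV. a i j * v $ i * u $ j)"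
    by (subst sum.swap) (simp add: mult_ac)
  finally show ?thesis
    by (simp add: Q_eq algebra_simps sum.distrib)
qed

lemma Q_scale: "Q (c *s v) = c\<^sup>2 * Q v"
  by (simp add: Q_eq sum_distrib_left power2_eq_square mult_ac)

lemma B_commute: "B u v = B v u"
  using Q_add[of u v] Q_add[of v u] by (simp add: add.commute)

lemma B_linear: "B (u + v) w = B u w + B v w" "B (u - v) w = B u w - B v w" "B (c *s u) w = c * B u w"
  "B 0 w = 0" "B w (u + v) = B w u + B w v" "B w (u - v) = B w u - B w v" "B w (c *s u) = c * B w u" "B w 0 = 0"
proof -
  show *: "B (u + v) w = B u w + B v w" "B (u - v) w = B u w - B v w" "B (c *s u) w = c * B u w" "B 0 w = 0"
    for u v w c by (simp_all add: B_def pair_simps)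
  show "B w (u + v) = B w u + B w v" "B w (u - v) = B w u - B w v" "B w (c *s u) = c * B w u" "B w 0 = 0"
    unfolding B_commute[of w] by (rule * )+
qed

lemma Q_0 [simp]: "Q 0 = 0"
  using Q_scale[of 0 0] by simp

lemma B_self: "B v v = 2 * Q v"
proof -
  have "v + v = 2 *s v" unfolding vec_eq_iff vector_add_component vector_smult_component by simp
  then have "Q (v + v) = Q (2 *s v)" by simp
  then show ?thesis using Q_add[of v v] Q_scale[of 2 v] by simp
qed

lemma Q_diff: "Q (u - v) = Q u + Q v - B u v"
  using Q_add[of u "(-1) *s v"] Q_scale[of "-1" v] B_linear(7)[of u "-1" v] by (simp add: vec.scale_minus_left)

lemma pair_J [simp]: "pair u (J v) = B u v"
  by (simp add: B_def)

lemma J_linear: "J (u + v) = J u + J v" "J (u - v) = J u - J v" "J (c *s u) = c *s J u"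
proof -
  show "J (u + v) = J u + J v" "J (u - v) = J u - J v"
    by (simp_all add: J_def matrix_vector_right_distrib matrix_vector_mult_diff_distrib)
  show "J (c *s u) = c *s J u"
    by (simp add: J_def matrix_vector_mult_def vec_eq_iff sum_distrib_left mult.left_commute)
qed

lemma Q_fun_alg:
  assumes "fun_alg R" "\<And>i. (\<lambda>x. u x $ i) \<in> R"
  shows "(\<lambda>x. Q (u x)) \<in> R" "(\<lambda>x. J (u x) $ i) \<in> R"
proof -
  interpret fun_alg R by (rule assms(1))
  show "(\<lambda>x. Q (u x)) \<in> R" unfolding Q_eq by (intro sum mult_fun const_fun assms(2))
  show "(\<lambda>x. J (u x) $ i) \<in> R"
    unfolding J_def gram_def matrix_vector_mult_def by (simp, intro sum mult_fun const_fun assms(2))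
qed

lemma GO_D:
  assumes "g \<in> GO Q"
  shows "Q (v v* g) = Q v" "B (u v* g) (v v* g) = B u v" "invertible g"
proof -
  show *: "Q (v v* g) = Q v" "invertible g" for v using assms by (auto simp: GO_def)
  show "B (u v* g) (v v* g) = B u v"
    using Q_add[of "u v* g" "v v* g"] Q_add[of u v] *(1)[of "u + v"] *(1)
    by (simp add: vector_matrix_left_distrib)
qed

text \<open>Along a line with direction \<open>v\<close> the form is a polynomial of degree 2 in the
  parameter unless \<open>Q v = 0\<close>, and such a polynomial has a root.\<close>

lemma exists_isotropic:
  assumes "CARD('n) \<ge> 2" obtains u where "u \<noteq> 0" "Q u = 0"
proof -
  obtain i :: 'n where True by blast
  have "\<exists>j. j \<noteq> i"
  proof (rule ccontr)
    assume "\<not> ?thesis"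
    then have "UNIV = {i}" by auto
    then have "CARD('n) = card {i}" by simp
    then show False using assms by simp
  qed
  then obtain j where ij: "i \<noteq> j" by metis
  let ?u = "axis i 1 :: 'a^'n" and ?v = "axis j 1 :: 'a^'n"
  show ?thesis
  proof (cases "Q ?v = 0")
    case True then show ?thesis using that[of ?v] by (simp add: axis_eq_0_iff)
  next
    case False
    then have "degree [:Q ?u, B ?u ?v, Q ?v:] > 0" by simp
    then obtain l where "poly [:Q ?u, B ?u ?v, Q ?v:] l = 0" using alg_closed_imp_poly_has_root by blast
    then have "Q (?u + l *s ?v) = 0"
      by (simp add: Q_add Q_scale B_linear power2_eq_square algebra_simps)
    moreover have "(?u + l *s ?v) $ i = 1" using ij by (simp add: axis_def)
    then have "?u + l *s ?v \<noteq> 0" by (metis zero_index zero_neq_one)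
    ultimately show ?thesis by (rule that[rotated])
  qed
qed

end

section \<open>Nondegenerate forms and the cone of isotropic vectors\<close>

locale nondegenerate_form = quadratic_form Q a
  for Q :: "'a::alg_closed_field^'n \<Rightarrow> 'a" and a +
  assumes nondeg: "(\<And>v. B u v = 0) \<Longrightarrow> u = 0"
    and irred: "acts_irreducibly (SO Q)" and group: "linear_algebraic_group (SO Q)"
begin

lemma J_eq_0 [simp]: "J u = 0 \<longleftrightarrow> u = 0"
proof
  assume "J u = 0"
  then have "B v u = 0" for v unfolding B_def by (simp add: pair_simps)
  then show "u = 0" using nondeg[of u] B_commute by simp
qed (simp add: J_def)

lemma SO_subgroup: "subgroup (SO Q) GL"
  using group by (simp add: linear_algebraic_group_def)

lemma SO_GO: "g \<in> SO Q \<Longrightarrow> g \<in> GO Q"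
  by (simp add: SO_def)

lemma det_gram: "det gram \<noteq> 0"
proof -
  have "\<exists>A. A ** gram = mat 1"
    unfolding matrix_left_invertible_ker using J_eq_0 by (simp add: J_def)
  then have "invertible gram" unfolding invertible_def by (metis matrix_left_right_inverse)
  then show ?thesis by (simp add: invertible_det_nz)
qed

lemma det_GO: assumes "g \<in> GO Q" shows "det g ^ 2 = 1"
proof -
  have "g ** gram ** transpose g = gram"
  proof (rule vector_matrix_eqI, rule pair_eqI)
    fix v q
    have "pair (v v* (g ** gram ** transpose g)) q = B (v v* g) (q v* g)"
      by (simp only: B_def J_def vector_matrix_mul_assoc[symmetric] pair_vector_matrix transpose_matrix_vector)
    also have "\<dots> = pair (v v* gram) q"
      by (simp add: GO_D(2)[OF assms]) (simp add: B_def J_def pair_vector_matrix)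
    finally show "pair (v v* (g ** gram ** transpose g)) q = pair (v v* gram) q" .
  qed
  then have "det g * det gram * det g = det gram" by (metis det_mul det_transpose)
  then have "det g * det g * det gram = 1 * det gram" by (simp add: mult_ac)
  then show ?thesis using det_gram by (simp add: power2_eq_square)
qed

definition fl :: "'a^'n \<Rightarrow> ('a, 'n) flag" where
  "fl v = (v, J v)"

definition cone :: "('a, 'n) flag set" where
  "cone = fl ` {v. Q v = 0}"

lemma fl_simps [simp]: "fst (fl v) = v" "snd (fl v) = J v"
  by (simp_all add: fl_def)

lemma isotropic_self: "Q v = 0 \<Longrightarrow> B v v = 0"
  by (simp add: B_self)

lemma opposite_fl: "opposite (fl u) (fl v) \<longleftrightarrow> B u v \<noteq> 0"
  by (simp add: opposite_def B_commute[of v u])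

lemma vector_letter_fl: "x v* letter (fl u) (fl v) s =
  x + ((s - 1) / B u v * B x v) *s u + ((1 / s - 1) / B u v * B x u) *s v"
  by (simp add: vector_letter B_commute[of v u])

text \<open>The span of the isotropic vectors is invariant, hence it is the whole space.\<close>

lemma exists_isotropic_pair_nonzero:
  assumes "CARD('n) \<ge> 2" "q \<noteq> 0" obtains u where "Q u = 0" "pair u q \<noteq> 0"
proof -
  let ?W = "vec.span {v. Q v = 0}"
  have "v v* g \<in> ?W" if "g \<in> SO Q" "v \<in> ?W" for g v
    using that(2)
  proof (induction rule: vec.span_induct_alt)
    case base then show ?case by (simp add: vec.span_zero)
  next
    case (step c x y)
    have "x v* g \<in> ?W" using step(1) GO_D(1)[OF SO_GO[OF that(1)]] by (intro vec.span_base) simp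
    then show ?case
      using step by (simp add: vector_matrix_left_distrib scalar_vector_matrix_assoc vec.span_add vec.span_scale)
  qed
  then have "?W = {0} \<or> ?W = UNIV" using irred unfolding acts_irreducibly_def by (metis vec.subspace_span)
  moreover obtain u where "u \<noteq> 0" "Q u = 0" using exists_isotropic[OF assms(1)] by metis
  then have "?W \<noteq> {0}" using vec.span_base[of u "{v. Q v = 0}"] by auto
  ultimately have W: "?W = UNIV" by blast
  have "\<exists>u. Q u = 0 \<and> pair u q \<noteq> 0"
  proof (rule ccontr)
    assume "\<not> ?thesis"
    then have "?W \<subseteq> {v. pair v q = 0}"
      by (intro vec.span_minimal vec.subspaceI) (auto simp: pair_simps)
    then have "pair v q = pair v 0" for v using W by (auto simp: pair_simps)
    then have "q = 0" by (intro pair_eqI) (metis pair_commute)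
    with assms(2) show False by simp
  qed
  then show ?thesis using that by blast
qed

lemma exists_orthogonal:
  fixes p q :: "'a^'n"
  assumes "CARD('n) > 2" obtains w where "w \<noteq> 0" "pair w p = 0" "pair w q = 0"
proof -
  obtain c where c: "\<exists>i\<in>UNIV. c i \<noteq> (0::'a)" "\<forall>e\<in>UNIV. (\<Sum>i\<in>UNIV. (if e then p $ i else q $ i) * c i) = 0"
    using homogeneous_system_solution[of "UNIV :: bool set" "UNIV :: 'n set" "\<lambda>e i. if e then p $ i else q $ i"] assms
    by auto
  have "pair (\<chi> i. c i) p = 0" "pair (\<chi> i. c i) q = 0"
    using bspec[OF c(2), of True] bspec[OF c(2), of False] by (simp_all add: pair_def mult.commute)
  moreover have "(\<chi> i. c i) \<noteq> 0" using c(1) by (auto simp: vec_eq_iff)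
  ultimately show ?thesis using that by blast
qed

text \<open>Were the orthogonal space of \<open>u\<close> and \<open>v\<close> totally isotropic,
  any nonzero \<open>w\<close> in it would be orthogonal to everything. The value of
  \<open>Q t\<close> is the one for which \<open>u + s t + s^2 v\<close> is isotropic for every
  \<open>s\<close>.\<close>

lemma exists_orthogonal_anisotropic:
  assumes "CARD('n) > 2" "Q u = 0" "Q v = 0" "B u v \<noteq> 0"
  obtains t where "B t u = 0" "B t v = 0" "Q t = - B u v"
proof -
  have "\<exists>t. B t u = 0 \<and> B t v = 0 \<and> Q t \<noteq> 0"
  proof (rule ccontr)
    assume "\<not> ?thesis"
    then have iso: "Q t = 0" if "B t u = 0" "B t v = 0" for t using that by blast
    obtain w where w': "w \<noteq> 0" "pair w (J u) = 0" "pair w (J v) = 0"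
      by (rule exists_orthogonal[OF assms(1)])
    then have w: "w \<noteq> 0" "B w u = 0" "B w v = 0" by simp_all
    have "B w x = 0" for x
    proof -
      let ?y = "x - (B x v / B u v) *s u - (B x u / B u v) *s v"
      have y: "B ?y u = 0" "B ?y v = 0"
        using assms by (simp_all add: B_linear isotropic_self B_commute[of v u])
      have "Q (w + ?y) = 0" "Q w = 0" "Q ?y = 0"
        using w y by (intro iso; simp only: B_linear(1); simp)+
      then have "B w ?y = 0" using Q_add[of w ?y] by simp
      then show ?thesis using w by (simp add: B_linear)
    qed
    then show False using nondeg w(1) by blast
  qed
  then obtain t where t: "B t u = 0" "B t v = 0" "Q t \<noteq> 0" by blast
  obtain c where "c ^ 2 = - B u v / Q t" using exists_square_root by blast
  then show ?thesis using t by (intro that[of "c *s t"]) (simp_all add: B_linear Q_scale)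
qed

text \<open>Orthogonal isotropic vectors are joined by a line, others by the conic that
  \<open>exists_orthogonal_anisotropic\<close> provides.\<close>

lemma curve_connected_cone:
  assumes "CARD('n) > 2" shows "curve_connected cone"
  unfolding curve_connected_def
proof (intro ballI)
  fix z1 z2 assume "z1 \<in> cone" "z2 \<in> cone"
  then obtain u v where uv: "z1 = fl u" "z2 = fl v" "Q u = 0" "Q v = 0" by (auto simp: cone_def)
  note pf = poly_funs.add_fun poly_funs.mult_fun poly_funs.power poly_funs.const_fun poly_funs_id
  have curve: "\<exists>\<gamma> :: 'a \<Rightarrow> ('a, 'n) flag. (\<forall>s. \<gamma> s \<in> cone) \<and>
      (\<forall>f\<in>flag_tests. f z1 \<noteq> 0 \<or> f z2 \<noteq> 0 \<longrightarrow> finite {s. f (\<gamma> s) = 0})"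
    if P: "\<And>s. Q (P s) = 0" "\<And>i. (\<lambda>s. P s $ i) \<in> poly_funs" "\<And>i. (\<lambda>s. P' s $ i) \<in> poly_funs"
      "\<And>s. s \<noteq> 0 \<Longrightarrow> P s = s ^ k *s P' (1 / s)" "P 0 = u" "P' 0 = v" for P P' k
  proof (intro exI[of _ "\<lambda>s. fl (P s)"] conjI allI ballI impI)
    show "fl (P s) \<in> cone" for s using P(1) by (auto simp: cone_def)
    fix f assume f: "f \<in> flag_tests" "f z1 \<noteq> 0 \<or> f z2 \<noteq> 0"
    show "finite {s. f (fl (P s)) = 0}"
      unfolding fl_def
    proof (rule finite_zeros_curve[where P' = P' and S' = "\<lambda>s. J (P' s)" and k = k and l = k])
      show "(\<lambda>s. J (P s) $ i) \<in> poly_funs" "(\<lambda>s. J (P' s) $ i) \<in> poly_funs" for i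
        by (intro Q_fun_alg(2) poly_funs.fun_alg_axioms P)+
      show "J (P s) = s ^ k *s J (P' (1 / s))" if "s \<noteq> 0" for s
        using P(4)[OF that] by (metis J_linear(3))
    qed (use P f uv in \<open>auto simp: fl_def\<close>)
  qed
  show "\<exists>\<gamma> :: 'a \<Rightarrow> ('a, 'n) flag. (\<forall>s. \<gamma> s \<in> cone) \<and>
      (\<forall>f\<in>flag_tests. f z1 \<noteq> 0 \<or> f z2 \<noteq> 0 \<longrightarrow> finite {s. f (\<gamma> s) = 0})"
  proof (cases "B u v = 0")
    case True
    show ?thesis
    proof (rule curve[of "\<lambda>s. u + s *s v" "\<lambda>s. s *s u + v" 1])
      show "Q (u + s *s v) = 0" for s using True uv by (simp add: Q_add Q_scale B_linear)
      show "(\<lambda>s. (u + s *s v) $ i) \<in> poly_funs" "(\<lambda>s. (s *s u + v) $ i) \<in> poly_funs" for i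
        unfolding vector_add_component vector_smult_component by (intro pf)+
      show "u + s *s v = s ^ 1 *s ((1 / s) *s u + v)" if "s \<noteq> 0" for s
        using that by (simp add: vec.scale_right_distrib)
    qed simp_all
  next
    case False
    obtain t where t: "B t u = 0" "B t v = 0" "Q t = - B u v"
      using exists_orthogonal_anisotropic[OF assms uv(3,4) False] by metis
    show ?thesis
    proof (rule curve[of "\<lambda>s. u + s *s t + s ^ 2 *s v" "\<lambda>s. s ^ 2 *s u + s *s t + v" 2])
      show "Q (u + s *s t + s ^ 2 *s v) = 0" for s
        using t uv by (simp add: Q_add Q_scale B_linear B_commute[of u t])
      show "(\<lambda>s. (u + s *s t + s ^ 2 *s v) $ i) \<in> poly_funs" "(\<lambda>s. (s ^ 2 *s u + s *s t + v) $ i) \<in> poly_funs" for i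
        unfolding vector_add_component vector_smult_component by (intro pf)+
      show "u + s *s t + s ^ 2 *s v = s ^ 2 *s ((1 / s) ^ 2 *s u + (1 / s) *s t + v)" if "s \<noteq> 0" for s
        using that by (simp add: vec.scale_right_distrib power2_eq_square)
    qed simp_all
  qed
qed

text \<open>Stereographic projection: \<open>S x\<close> is orthogonal to \<open>p\<close> and
  \<open>p'\<close>, so \<open>Q (p + S x) = Q (S x)\<close>, and a multiple of \<open>p'\<close>
  corrects this to 0 without changing the pairing with \<open>p'\<close>.\<close>

lemma deformable_cone: "deformable cone (CARD('n) - 1)"
  unfolding deformable_def
proof (intro ballI impI)
  fix z z' :: "('a, 'n) flag" assume z: "z \<in> cone" "z' \<in> cone" "opposite z z'"
  then obtain p p' where p: "z = fl p" "z' = fl p'" "Q p = 0" "Q p' = 0" by (auto simp: cone_def)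
  have b: "B p p' \<noteq> 0" using z(3) by (simp add: p opposite_fl)
  let ?m = "CARD('n)"
  obtain t c where t: "\<And>j. 0 < j \<Longrightarrow> j < ?m - 1 \<Longrightarrow> B (t j) p = 0 \<and> B (t j) p' = 0"
    and tc: "\<And>j k. 0 < j \<Longrightarrow> j < ?m - 1 \<Longrightarrow> 0 < k \<Longrightarrow> k < ?m - 1 \<Longrightarrow> pair (t j) (c k) = (if j = k then 1 else 0)"
    and pc: "\<And>k. 0 < k \<Longrightarrow> k < ?m - 1 \<Longrightarrow> pair p (c k) = 0 \<and> pair p' (c k) = 0"
    using dual_coordinates[OF _ _ z(3)] by (auto simp: p isotropic_self)
  define I where "I = {1..<?m - 1}"
  define S where "S = (\<lambda>x. \<Sum>j\<in>I. x j *s t j)"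
  have ps: "pair (S x) q = (\<Sum>j\<in>I. x j * pair (t j) q)" for x q
    unfolding S_def by (induction I rule: infinite_finite_induct) (simp_all add: pair_simps)
  have Sp: "B (S x) p = 0" "B (S x) p' = 0" for x
    unfolding pair_J[symmetric] ps using t by (auto intro!: sum.neutral simp: I_def)
  have S: "(\<lambda>x. S x $ i) \<in> pfun" for i
    unfolding S_def sum_component vector_smult_component
    by (intro pfun.sum pfun.mult pfun.var pfun.const)
  define P where "P = (\<lambda>x. p + S x - (Q (S x) / B p p') *s p')"
  have P: "(\<lambda>x. P x $ i) \<in> pfun" for i
    unfolding P_def vector_minus_component vector_add_component vector_smult_component
    by (intro pfun.diff pfun.add pfun.mult pfun.divide_const pfun.const S Q_fun_alg(1) pfun.fun_alg_axioms)
  show "\<exists>Z :: (nat \<Rightarrow> 'a) \<Rightarrow> ('a, 'n) flag. \<exists>a.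
     (\<forall>i. (\<lambda>x. fst (Z x) $ i) \<in> pfun) \<and> (\<forall>i. (\<lambda>x. snd (Z x) $ i) \<in> pfun) \<and>
     (\<forall>x. Z x \<in> cone) \<and> Z (\<lambda>_. 0) = z \<and>
     (\<forall>x. pair (fst (Z x)) (snd z') = pair (fst z) (snd z')) \<and>
     (\<forall>x. pair (fst z') (snd (Z x)) = pair (fst z') (snd z)) \<and>
     (\<forall>x j. 0 < j \<longrightarrow> j < ?m - 1 \<longrightarrow> pair (fst (Z x)) (a j) = x j * pair (fst z) (snd z'))"
  proof (intro exI[of _ "\<lambda>x. fl (P x)"] exI[of _ "\<lambda>j. B p p' *s c j"] conjI allI impI)
    show "(\<lambda>x. fst (fl (P x)) $ i) \<in> pfun" "(\<lambda>x. snd (fl (P x)) $ i) \<in> pfun" for i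
      using P Q_fun_alg(2)[OF pfun.fun_alg_axioms P] by simp_all
    show k: "pair (fst (fl (P x))) (snd z') = pair (fst z) (snd z')" for x
      by (simp add: P_def p B_linear Sp isotropic_self)
    then show "pair (fst z') (snd (fl (P x))) = pair (fst z') (snd z)" for x
      by (simp add: p B_commute[of p'])
    show "fl (P x) \<in> cone" for x
      using b by (auto simp: cone_def P_def Q_diff Q_add Q_scale B_linear Sp p B_commute[of p "S x"])
    show "fl (P (\<lambda>_. 0)) = z" by (simp add: P_def S_def p)
    show "pair (fst (fl (P x))) (B p p' *s c j) = x j * pair (fst z) (snd z')" if j: "0 < j" "j < ?m - 1" for x j
    proof -
      have "pair (S x) (c j) = (\<Sum>i\<in>I. if i = j then x i else 0)"
        unfolding ps using tc[OF _ _ j] by (intro sum.cong) (auto simp: I_def)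
      also have "\<dots> = x j" using j by (simp add: I_def)
      finally show ?thesis using pc[OF j] by (simp add: P_def p pair_simps mult.commute)
    qed
  qed
qed

end

text \<open>Multiplied by \<open>s\<close>, the entries of the letter are polynomials in
  \<open>s\<close>, so the image of the punctured line is irreducible.\<close>

lemma connectedin_letters:
  fixes z z' :: "('a::alg_closed_field, 'n::finite) flag"
  shows "connectedin zariski (letter z z' ` {s. s \<noteq> 0})"
proof (rule irreducible_imp_connectedin, rule irreducible_closure_image[where \<phi> = "letter z z'" and P = "{s. s \<noteq> 0}"])
  have "1 \<in> {s::'a. s \<noteq> 0}" by simp
  then show "{s::'a. s \<noteq> 0} \<noteq> {}" by blast
  show "letter z z' ` {s. s \<noteq> 0} \<subseteq> zariski closure_of letter z z' ` {s. s \<noteq> 0}"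
    by (rule closure_of_subset) simp
  let ?k = "pair (fst z) (snd z')" and ?k' = "pair (fst z') (snd z)"
  define N where "N = (\<lambda>s. smat s (mat 1) + outer ((s * (s - 1) / ?k) *s snd z') (fst z) + outer (((1 - s) / ?k') *s snd z) (fst z'))"
  have N: "(\<lambda>s. N s $ i $ j) \<in> poly_funs" for i j
    unfolding N_def vector_add_component
    by (intro poly_funs.add_fun poly_funs.smat poly_funs.outer poly_funs.const_fun poly_funs_id)
      (unfold vector_smult_component, (intro poly_funs.mult_fun poly_funs.divide_const poly_funs.diff poly_funs.const_fun poly_funs_id)+)
  have letter: "(\<chi> i j. N s $ i $ j / s) = letter z z' s" if "s \<noteq> 0" for s
  proof -
    have 1: "s * (s - 1) / ?k / s = (s - 1) / ?k" "(1 - s) / ?k' / s = (1 / s - 1) / ?k'"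
      using that by (simp, simp add: diff_divide_distrib)
    have "(s * m + (a * b) * c + (d * e) * g) / s = m + ((a / s) * b) * c + ((d / s) * e) * g"
      for m a b c d e g :: 'a using that by (simp add: add_divide_distrib)
    then have "N s $ i $ j / s = letter z z' s $ i $ j" for i j
      by (simp only: N_def letter_def outer_def smat_def vec_lambda_beta vector_add_component
          vector_smult_component 1)
    then show ?thesis by (simp add: vec_eq_iff)
  qed
  fix f g :: "'a^'n^'n \<Rightarrow> 'a" and x y
  assume fg: "f \<in> matrix_poly_funs" "g \<in> matrix_poly_funs" and xy: "x \<in> {s. s \<noteq> 0}" "y \<in> {s. s \<noteq> 0}"
    "f (letter z z' x) \<noteq> 0" "g (letter z z' y) \<noteq> 0"
  obtain d h where h: "h \<in> poly_funs" "\<And>s. s \<noteq> 0 \<Longrightarrow> f (letter z z' s) = h s / s ^ d"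
    using poly_funs.matrix_poly_comp_fraction[OF fg(1) N poly_funs_id] letter by auto
  obtain d' h' where h': "h' \<in> poly_funs" "\<And>s. s \<noteq> 0 \<Longrightarrow> g (letter z z' s) = h' s / s ^ d'"
    using poly_funs.matrix_poly_comp_fraction[OF fg(2) N poly_funs_id] letter by auto
  have "h x \<noteq> 0" "h' y \<noteq> 0" using xy h(2) h'(2) by auto
  then have "finite ({s. h s = 0} \<union> {s. h' s = 0} \<union> {0})"
    using finite_zeros_poly_funs[OF h(1)] finite_zeros_poly_funs[OF h'(1)] by simp
  from ex_new_if_finite[OF infinite_alg_closed this] obtain s where "h s \<noteq> 0" "h' s \<noteq> 0" "s \<noteq> 0" by auto
  then show "\<exists>s\<in>{s. s \<noteq> 0}. f (letter z z' s) \<noteq> 0 \<and> g (letter z z' s) \<noteq> 0"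
    using h(2) h'(2) by (intro bexI[of _ s]) auto
qed simp

section \<open>Reflections\<close>

context nondegenerate_form
begin

text \<open>Division by \<open>Q x\<close> instead of \<open>B x x\<close> gives an isometry in
  every characteristic; in characteristic 2 it is an orthogonal transvection.\<close>

definition reflection :: "'a^'n \<Rightarrow> 'a^'n^'n" where
  "reflection x = mat 1 - outer ((1 / Q x) *s J x) x"

lemma vector_reflection: "v v* reflection x = v - (B v x / Q x) *s x"
  by (simp add: reflection_def vector_matrix_mult_diff_rdistrib vector_outer pair_scale_right)

lemma reflection_square: "Q x \<noteq> 0 \<Longrightarrow> reflection x ** reflection x = mat 1"
  by (rule vector_matrix_eqI)
    (simp add: vector_matrix_mul_assoc[symmetric] vector_reflection B_linear B_self vec_eq_iff field_simps)

lemma reflection_GO: assumes "Q x \<noteq> 0" shows "reflection x \<in> GO Q"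
proof -
  have "invertible (reflection x)" using reflection_square[OF assms] unfolding invertible_def by blast
  moreover have "Q (v v* reflection x) = Q v" for v
    using assms by (simp add: vector_reflection Q_diff Q_scale B_linear power2_eq_square)
  ultimately show ?thesis by (simp add: GO_def)
qed

lemma GO_mult: "g \<in> GO Q \<Longrightarrow> h \<in> GO Q \<Longrightarrow> g ** h \<in> GO Q"
  by (simp add: GO_def invertible_mult vector_matrix_mul_assoc[symmetric])

text \<open>Proportional vectors give equal reflections and rank 0; otherwise the difference is a
  sum of two rank one maps and has rank 2.\<close>

lemma even_rank_reflections:
  assumes x: "Q x \<noteq> 0" and y: "Q y \<noteq> 0"
  shows "even (rank (reflection x ** reflection y - mat 1))"
proof (cases "\<exists>k. y = k *s x")
  case True
  then obtain k where k: "y = k *s x" by blast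
  then have "k \<noteq> 0" using y by auto
  then have "reflection y = reflection x"
    by (intro vector_matrix_eqI) (simp add: vector_reflection k B_linear Q_scale power2_eq_square)
  then have "reflection x ** reflection y - mat 1 = 0" using reflection_square[OF x] by simp
  moreover have "rank (0 :: 'a^'n^'n) = 0"
    by (simp add: row_rank_def_gen rows_def row_def zero_vec_def[symmetric])
  ultimately show ?thesis by simp
next
  case False
  \<comment> \<open>\<open>w\<close> is the image of \<open>y\<close> under
    \<open>reflection x\<close>.\<close>
  define w where "w = y - (B x y / Q x) *s x"
  have "reflection x ** reflection y - mat 1 = outer ((- 1 / Q x) *s J x) x + outer ((- 1 / Q y) *s J w) y"
  proof (rule vector_matrix_eqI)
    fix v
    define c where "c = B v x / Q x"
    define k where "k = (B v y - c * B x y) / Q y"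
    have "v v* (reflection x ** reflection y - mat 1) = v - c *s x - k *s y - v"
      by (simp only: vector_matrix_mult_diff_rdistrib vector_matrix_mul_assoc[symmetric] vector_reflection
          B_linear c_def k_def vector_matrix_mul_rid)
    also have "\<dots> = (- c) *s x + (- k) *s y" by (simp add: vec.scale_minus_left)
    also have "- c = - 1 / Q x * B v x" by (simp add: c_def)
    also have "- k = - 1 / Q y * B v w" by (simp add: k_def c_def w_def B_linear mult.commute)
    finally show "v v* (reflection x ** reflection y - mat 1) =
        v v* (outer ((- 1 / Q x) *s J x) x + outer ((- 1 / Q y) *s J w) y)"
      by (simp only: vector_matrix_mult_add_rdistrib vector_outer pair_scale_right pair_J)
  qed
  moreover have "rank (outer ((- 1 / Q x) *s J x) x + outer ((- 1 / Q y) *s J w) y) = 2"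
  proof -
    have x0: "x \<noteq> 0" using x by auto
    have w0: "w \<noteq> 0" using False by (auto simp: w_def)
    have "J x \<notin> vec.span {J w}"
    proof
      assume "J x \<in> vec.span {J w}"
      then obtain k where "J x = J (k *s w)" by (auto simp: vec.span_singleton J_linear)
      then have "J (x - k *s w) = 0" by (simp add: J_linear(2))
      then have xk: "x = k *s w" unfolding J_eq_0 by simp
      then have "k \<noteq> 0" using x0 by auto
      then have "w = inverse k *s x" using xk by simp
      then have "y = (inverse k + B x y / Q x) *s x" unfolding w_def by (simp add: vec.scale_left_distrib diff_eq_eq)
      then show False using False by blast
    qed
    then obtain v where v: "pair (J x) v \<noteq> 0" "\<And>u. u \<in> vec.span {J w} \<Longrightarrow> pair u v = 0"
      using subspace_separate[OF vec.subspace_span] by metis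
    have "pair (J w) v = 0" using v(2) by (simp add: vec.span_base)
    with v have v: "B v x \<noteq> 0" "B v w = 0" by (simp_all add: pair_commute[of _ v])
    obtain v' where v': "B v' w \<noteq> 0" using nondeg[of w] w0 B_commute by metis
    show ?thesis
    proof (rule rank_two_outer)
      show "k = 0 \<and> l = 0" if "k *s x + l *s y = 0" for k l
      proof -
        have "l = 0"
        proof (rule ccontr)
          assume l: "l \<noteq> 0"
          have "l *s y = (- k) *s x" using that by (simp add: eq_neg_iff_add_eq_0 add.commute vec.scale_minus_left)
          then have "inverse l *s (l *s y) = inverse l *s ((- k) *s x)" by simp
          then have "y = (inverse l * (- k)) *s x" using l by (simp only: vec.scale_scale) simp
          then show False using False by blast
        qed
        with that x0 show ?thesis by simp
      qed
      show "pair v ((- 1 / Q x) *s J x) \<noteq> 0" "pair v ((- 1 / Q y) *s J w) = 0" "pair v' ((- 1 / Q y) *s J w) \<noteq> 0"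
        using v v' x y by (simp_all only: pair_scale_right pair_J) simp_all
    qed
  qed
  ultimately show ?thesis by simp
qed

text \<open>Determinants of involutions square to 1, so the square has determinant 1. In
  characteristic 2 and even dimension already \<open>g\<close> is in the group, by the parity of the
  rank of \<open>g - mat 1\<close>.\<close>

lemma reflections_square_SO:
  assumes x: "Q x \<noteq> 0" and y: "Q y \<noteq> 0"
  defines "g \<equiv> reflection x ** reflection y"
  shows "g ** g \<in> SO Q" "det (g ** g) = 1"
proof -
  have sq: "det (reflection u) * det (reflection u) = 1" if "Q u \<noteq> 0" for u
    using reflection_square[OF that] by (metis det_mul det_I)
  have "det (g ** g) = (det (reflection x) * det (reflection x)) * (det (reflection y) * det (reflection y))"
    unfolding g_def det_mul by (simp only: mult_ac)
  then show d: "det (g ** g) = 1" by (simp add: sq x y)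
  have g: "g \<in> GO Q" unfolding g_def using x y by (intro GO_mult reflection_GO)
  show "g ** g \<in> SO Q"
  proof (cases "CHAR('a) = 2 \<and> even CARD('n)")
    case True
    then have "g \<in> SO Q" using g even_rank_reflections[OF x y] by (simp add: SO_def g_def)
    then show ?thesis by (intro subgroup_GL_mult[OF SO_subgroup])
  next
    case False
    then show ?thesis using d GO_mult[OF g g] by (auto simp: SO_def)
  qed
qed

text \<open>The pair of vectors ranges over an open part of affine space, where points over the
  infinite field \<open>K\<close> are dense. The denominator of the map is
  \<open>(Q x * Q y)^2\<close>.\<close>

lemma reflections_in_closure:
  assumes inf: "infinite K" and K: "subfield_set K" and aK: "\<And>i j. a i j \<in> K"
    and x: "Q x \<noteq> 0" and y: "Q y \<noteq> 0"
  defines "g \<equiv> reflection x ** reflection y"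
  shows "g ** g \<in> zariski closure_of {h \<in> SO Q. (\<forall>i j. h $ i $ j \<in> K) \<and> det h = 1}"
  unfolding in_zariski_closure_iff
proof (intro ballI impI)
  interpret K: subfield_set K by (rule K)
  let ?\<Gamma> = "{h \<in> SO Q. (\<forall>i j. h $ i $ j \<in> K) \<and> det h = 1}"
  fix f :: "'a^'n^'n \<Rightarrow> 'a" assume f: "f \<in> matrix_poly_funs" "\<forall>A\<in>?\<Gamma>. f A = 0"
  define u where "u = (\<lambda>k (t :: ('n \<times> bool) \<Rightarrow> 'a). (\<chi> i. t (i, k)) :: 'a^'n)"
  define R where "R = (\<lambda>v. smat (Q v) (mat 1) - outer (J v) v)"
  define D where "D = (\<lambda>t. (Q (u True t) * Q (u False t))\<^sup>2)"
  define N where "N = (\<lambda>t. R (u True t) ** R (u False t) ** (R (u True t) ** R (u False t)))"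
  let ?g = "\<lambda>t. reflection (u True t) ** reflection (u False t)"
  have R: "reflection v = smat (1 / Q v) (R v)" if "Q v \<noteq> 0" for v
    using that by (simp add: reflection_def R_def smat_def outer_def vec_eq_iff diff_divide_distrib)
  have g: "(\<chi> i j. N t $ i $ j / D t) = ?g t ** ?g t" if "D t \<noteq> 0" for t
  proof -
    have "Q (u True t) \<noteq> 0" "Q (u False t) \<noteq> 0" using that by (auto simp: D_def)
    then have "?g t ** ?g t = smat (1 / D t) (N t)"
      by (simp add: R smat_mult smat_smat N_def D_def power2_eq_square mult_ac)
    then show ?thesis by (simp add: smat_def)
  qed
  have u: "(\<lambda>t. u k t $ i) \<in> pfun" for k i by (simp add: u_def pfun.var)
  have Qu: "(\<lambda>t. Q (u k t)) \<in> pfun" "(\<lambda>t. J (u k t) $ i) \<in> pfun" for k i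
    by (intro Q_fun_alg pfun.fun_alg_axioms u)+
  have D: "D \<in> pfun" unfolding D_def by (intro pfun.power pfun.mult Qu)
  have "(\<lambda>t. R (u k t) $ i $ j) \<in> pfun" for k i j
    unfolding R_def vector_minus_component
    by (intro pfun.diff pfun.smat pfun.outer Qu u pfun.const)
  then have N: "(\<lambda>t. N t $ i $ j) \<in> pfun" for i j
    unfolding N_def by (intro pfun.matrix_mult)
  obtain d h where h: "h \<in> pfun" "\<And>t. D t \<noteq> 0 \<Longrightarrow> f (\<chi> i j. N t $ i $ j / D t) = h t / D t ^ d"
    using pfun.matrix_poly_comp_fraction[OF f(1) N D] by blast
  have hD: "h t * D t = 0" for t
  proof (rule pfun_zero_dense[where f = "\<lambda>t. h t * D t", OF _ inf])
    show "(\<lambda>t. h t * D t) \<in> pfun" by (intro pfun.mult h D)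
    fix t :: "('n \<times> bool) \<Rightarrow> 'a" assume t: "\<And>i. t i \<in> K"
    show "h t * D t = 0"
    proof (cases "D t = 0")
      case False
      then have Qt: "Q (u True t) \<noteq> 0" "Q (u False t) \<noteq> 0" by (auto simp: D_def)
      have v: "u k t $ i \<in> K" for k i by (simp add: u_def t)
      have "Q (u k t) \<in> K" for k unfolding Q_eq by (intro K.sum K.mult aK v)
      moreover have "J (u k t) $ i \<in> K" for k i
        unfolding J_def gram_def matrix_vector_mult_def by (simp, intro K.sum K.mult K.add aK v)
      ultimately have "reflection (u k t) $ i $ j \<in> K" for k i j
        unfolding reflection_def outer_def by (simp, intro K.diff K.mat_1 K.mult K.divide K.one v)
      then have "(?g t ** ?g t) $ i $ j \<in> K" for i j by (intro K.matrix_mult)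
      then have "?g t ** ?g t \<in> ?\<Gamma>" using reflections_square_SO[OF Qt] by simp
      then have "f (?g t ** ?g t) = 0" using f(2) by blast
      then have "f (\<chi> i j. N t $ i $ j / D t) = 0" using g[OF False] by simp
      then show ?thesis using h(2)[OF False] False by simp
    qed simp
  qed
  define t where "t = (\<lambda>(i, k). if k then x $ i else y $ i)"
  have ut: "u True t = x" "u False t = y" by (simp_all add: u_def t_def)
  have Dt: "D t \<noteq> 0" using x y by (simp add: D_def ut)
  have "f (?g t ** ?g t) = 0" using h(2)[OF Dt] hD[of t] Dt g[OF Dt] by simp
  then show "f (g ** g) = 0" by (simp add: ut g_def)
qed

lemma letter_fl_in_closure:
  assumes inf: "infinite K" and K: "subfield_set K" and aK: "\<And>i j. a i j \<in> K"
    and p: "Q p = 0" "Q p' = 0" "B p p' \<noteq> 0" and s: "s \<noteq> 0"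
  shows "letter (fl p) (fl p') s \<in> zariski closure_of {h \<in> SO Q. (\<forall>i j. h $ i $ j \<in> K) \<and> det h = 1}"
proof -
  have Qt: "Q (p - t *s p') = - t * B p p'" for t using p by (simp add: Q_diff Q_scale B_linear)
  \<comment> \<open>Since \<open>Q (p - t p') = - t B p p'\<close> is nonzero for
    \<open>t \<noteq> 0\<close>, the involutions of the letter are reflections in anisotropic
    vectors.\<close>
  have sw: "switch (fl p) (fl p') t = reflection (p - t *s p')" for t
  proof (rule vector_matrix_eqI)
    fix v
    have "v v* switch (fl p) (fl p') t = v + ((B v p - t * B v p') / (t * B p p')) *s (p - t *s p')"
      by (simp only: vector_switch fl_simps pair_J)
    also have "(B v p - t * B v p') / (t * B p p') = - (B v (p - t *s p') / Q (p - t *s p'))"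
      by (simp only: Qt B_linear mult_minus_left divide_minus_right minus_minus)
    also have "v + (- (B v (p - t *s p') / Q (p - t *s p'))) *s (p - t *s p') = v v* reflection (p - t *s p')"
      by (simp only: vector_reflection vec.scale_minus_left) simp
    finally show "v v* switch (fl p) (fl p') t = v v* reflection (p - t *s p')" .
  qed
  have "pair (fst (fl p)) (snd (fl p)) = 0" "pair (fst (fl p')) (snd (fl p')) = 0" "opposite (fl p) (fl p')"
      "pair (fst (fl p)) (snd (fl p')) = pair (fst (fl p')) (snd (fl p))"
    using p by (simp_all add: isotropic_self opposite_fl B_commute[of p' p])
  from letter_eq_square[OF this s] obtain t where t: "t \<noteq> 0" "letter (fl p) (fl p') s =
      switch (fl p) (fl p') 1 ** switch (fl p) (fl p') t ** (switch (fl p) (fl p') 1 ** switch (fl p) (fl p') t)" by metis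
  show ?thesis
    unfolding t(2) sw by (rule reflections_in_closure[OF inf K aK]) (use t(1) p Qt[of 1] Qt[of t] in simp_all)
qed

text \<open>The previous closure statement is applied with the whole field as \<open>K\<close>, and
  \<open>SO Q\<close> is closed among the invertible matrices.\<close>

lemma letter_fl_SO:
  assumes p: "Q p = 0" "Q p' = 0" "B p p' \<noteq> 0" and s: "s \<noteq> 0"
  shows "letter (fl p) (fl p') s \<in> SO Q"
proof -
  have "subfield_set (UNIV :: 'a set)" by unfold_locales auto
  from letter_fl_in_closure[OF infinite_alg_closed this _ assms]
  have "letter (fl p) (fl p') s \<in> zariski closure_of {h \<in> SO Q. (\<forall>i j. h $ i $ j \<in> UNIV) \<and> det h = 1}" by simp
  also have "\<dots> \<subseteq> zariski closure_of (SO Q)" by (rule closure_of_mono) auto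
  finally have l: "letter (fl p) (fl p') s \<in> zariski closure_of (SO Q)" .
  obtain G' where G': "closedin zariski G'" "SO Q = G' \<inter> carrier GL"
    using group unfolding linear_algebraic_group_def closedin_subtopology by blast
  have "zariski closure_of (SO Q) \<subseteq> G'" by (rule closure_of_minimal) (use G' in auto)
  moreover have "invertible (letter (fl p) (fl p') s)"
    using closure_of_det_square[OF det_GO[OF SO_GO] l] by (rule invertible_det_square)
  ultimately show ?thesis using l G'(2) by auto
qed

end

section \<open>Borel subgroups of the orthogonal group\<close>

lemma connected_solvable_D:
  assumes "connected_solvable B"
  obtains n where "subgroup B GL" "connectedin zariski B" "(derived GL ^^ n) B = {mat 1}"
  using assms solvable_GL_iff unfolding connected_solvable_def linear_algebraic_group_def by metis

context nondegenerate_form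
begin

definition line_group :: "'a^'n \<Rightarrow> ('a^'n^'n) set" where
  "line_group u = {g \<in> GO Q. (\<exists>c. u v* g = c *s u)}"

text \<open>
  Two elements of the stabiliser of the line through \<open>u\<close> are related if they act in the same way on
  the quotient of the orthogonal space of \<open>u\<close> by \<open>u\<close>.
\<close>

definition same_quotient :: "'a^'n \<Rightarrow> 'a^'n^'n \<Rightarrow> 'a^'n^'n \<Rightarrow> bool" where
  "same_quotient u g h \<longleftrightarrow> g \<in> line_group u \<and> h \<in> line_group u \<and>
     (\<forall>x. B x u = 0 \<longrightarrow> (\<exists>c. x v* g - x v* h = c *s u))"

lemma line_group_D:
  assumes "g \<in> line_group u" "u \<noteq> 0" obtains c where "c \<noteq> 0" "u v* g = c *s u"
proof -
  obtain c where c: "u v* g = c *s u" using assms by (auto simp: line_group_def)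
  have "c \<noteq> 0"
  proof
    assume "c = 0"
    then have "u v* g v* matrix_inv g = 0" using c by simp
    moreover have "invertible g" using assms GO_D(3) by (auto simp: line_group_def)
    ultimately show False using assms(2) by (simp add: vector_matrix_mul_assoc matrix_inv_mult)
  qed
  then show ?thesis using c that by blast
qed

lemma line_group_orthogonal:
  assumes "g \<in> line_group u" "u \<noteq> 0" "B x u = 0" shows "B (x v* g) u = 0"
proof -
  obtain c where c: "c \<noteq> 0" "u v* g = c *s u" using line_group_D[OF assms(1,2)] by metis
  have "B (x v* g) (u v* g) = 0" using GO_D(2)[of g x u] assms by (simp add: line_group_def)
  then show ?thesis using c by (simp add: B_linear)
qed

lemma GO_inv: assumes "g \<in> GO Q" shows "matrix_inv g \<in> GO Q"
proof -
  note inv = matrix_inv_mult[OF GO_D(3)[OF assms]]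
  have "Q (v v* matrix_inv g) = Q v" for v
    using GO_D(1)[OF assms, of "v v* matrix_inv g"] by (simp add: vector_matrix_mul_assoc inv)
  moreover have "invertible (matrix_inv g)" using inv unfolding invertible_def by blast
  ultimately show ?thesis by (simp add: GO_def)
qed

lemma line_group_mult:
  assumes "g \<in> line_group u" "h \<in> line_group u" shows "g ** h \<in> line_group u"
proof -
  obtain c d where "u v* g = c *s u" "u v* h = d *s u" using assms by (auto simp: line_group_def)
  then have "u v* (g ** h) = (c * d) *s u"
    by (simp add: vector_matrix_mul_assoc[symmetric] scalar_vector_matrix_assoc)
  then show ?thesis using assms GO_mult by (auto simp: line_group_def)
qed

lemma line_group_inv:
  assumes "g \<in> line_group u" "u \<noteq> 0" shows "matrix_inv g \<in> line_group u"
proof -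
  obtain c where c: "c \<noteq> 0" "u v* g = c *s u" using line_group_D[OF assms] by metis
  have g: "g \<in> GO Q" using assms by (simp add: line_group_def)
  have "(u v* g) v* matrix_inv g = u"
    by (simp only: vector_matrix_mul_assoc matrix_inv_mult[OF GO_D(3)[OF g]] vector_matrix_mul_rid)
  then have "c *s (u v* matrix_inv g) = u" by (simp add: c scalar_vector_matrix_assoc)
  then have "inverse c *s (c *s (u v* matrix_inv g)) = inverse c *s u" by simp
  then have "u v* matrix_inv g = inverse c *s u" using c(1) by simp
  then show ?thesis using GO_inv[OF g] by (auto simp: line_group_def)
qed

lemma same_quotient_mult:
  assumes "u \<noteq> 0" "same_quotient u g h" "same_quotient u g' h'"
  shows "same_quotient u (g ** g') (h ** h')"
  unfolding same_quotient_def
proof (intro conjI allI impI)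
  have l: "g \<in> line_group u" "h \<in> line_group u" "g' \<in> line_group u" "h' \<in> line_group u"
    using assms by (auto simp: same_quotient_def)
  show "g ** g' \<in> line_group u" "h ** h' \<in> line_group u" using l line_group_mult by auto
  fix x assume x: "B x u = 0"
  obtain c where c: "x v* g - x v* h = c *s u" using assms(2) x by (auto simp: same_quotient_def)
  obtain d where d: "x v* h v* g' - x v* h v* h' = d *s u"
    using assms(3) line_group_orthogonal[OF l(2) assms(1) x] by (auto simp: same_quotient_def)
  obtain k where k: "u v* g' = k *s u" using l(3) by (auto simp: line_group_def)
  have "x v* (g ** g') - x v* (h ** h') = (x v* g - x v* h) v* g' + (x v* h v* g' - x v* h v* h')"
    by (simp add: vector_matrix_mul_assoc[symmetric] vector_matrix_mult_diff_distrib)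
  also have "\<dots> = (c * k + d) *s u"
    by (simp add: c d k scalar_vector_matrix_assoc vec.scale_left_distrib)
  finally show "\<exists>c. x v* (g ** g') - x v* (h ** h') = c *s u" by blast
qed

lemma same_quotient_inv:
  assumes "u \<noteq> 0" "same_quotient u g h" "invertible g" "invertible h"
  shows "same_quotient u (matrix_inv g) (matrix_inv h)"
  unfolding same_quotient_def
proof (intro conjI allI impI)
  have l: "g \<in> line_group u" "h \<in> line_group u" using assms by (auto simp: same_quotient_def)
  show l': "matrix_inv g \<in> line_group u" "matrix_inv h \<in> line_group u" using l line_group_inv assms(1) by auto
  fix x assume x: "B x u = 0"
  let ?y = "x v* matrix_inv h"
  have yh: "?y v* h = x" by (simp add: vector_matrix_mul_assoc matrix_inv_mult assms)
  obtain c where c: "?y v* g - ?y v* h = c *s u"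
    using assms(2) line_group_orthogonal[OF l'(2) assms(1) x] by (auto simp: same_quotient_def)
  obtain k where k: "u v* matrix_inv g = k *s u" using l'(1) by (auto simp: line_group_def)
  have "(?y v* g - ?y v* h) v* matrix_inv g = ?y - x v* matrix_inv g"
    unfolding yh by (simp add: vector_matrix_mult_diff_distrib vector_matrix_mul_assoc[of _ g] matrix_inv_mult assms(3))
  then have "?y - x v* matrix_inv g = (c * k) *s u" by (simp add: c k scalar_vector_matrix_assoc)
  then have "x v* matrix_inv g - ?y = (- (c * k)) *s u" by (simp add: vec.scale_minus_left) (metis minus_diff_eq)
  then show "\<exists>c. x v* matrix_inv g - x v* matrix_inv h = c *s u" by blast
qed

lemma line_group_one: "mat 1 \<in> line_group u"
proof -
  have "invertible (mat 1 :: 'a^'n^'n)" unfolding invertible_def by (intro exI[of _ "mat 1"]) simp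
  then show ?thesis by (auto simp: line_group_def GO_def intro: exI[of _ 1])
qed

lemma same_quotient_refl: "g \<in> line_group u \<Longrightarrow> same_quotient u g g"
  by (auto simp: same_quotient_def intro: exI[of _ 0])

text \<open>Such an element \<open>k\<close> is determined by the displacement
  \<open>z k = y v* k - y\<close> of one vector with \<open>B y u = 1\<close>: on the orthogonal
  space of \<open>u\<close> it subtracts \<open>B x (z k) *s u\<close>. Under composition
  displacements add, up to a multiple of \<open>u\<close> that is symmetric in the two
  elements.\<close>

lemma unipotent_commute:
  assumes u: "u \<noteq> 0" "Q u = 0"
    and g: "same_quotient u g (mat 1)" "u v* g = u" and h: "same_quotient u h (mat 1)" "u v* h = u"
  shows "g ** h = h ** g"
proof -
  obtain y0 where "B u y0 \<noteq> 0" using nondeg u(1) by blast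
  define y where "y = (1 / B u y0) *s y0"
  have y: "B y u = 1" using \<open>B u y0 \<noteq> 0\<close> by (simp add: y_def B_linear B_commute[of y0 u])
  define z where "z = (\<lambda>k. y v* k - y)"
  have key: "x v* k = x - B x (z k) *s u" "B (z k) u = 0"
    if k: "same_quotient u k (mat 1)" "u v* k = u" and x: "B x u = 0" for k x
  proof -
    have kG: "k \<in> GO Q" using k by (simp add: same_quotient_def line_group_def)
    have "B (y v* k) u = B y u" using GO_D(2)[OF kG, of y u] k(2) by simp
    then show zu: "B (z k) u = 0" by (simp add: z_def B_linear)
    obtain l where "x v* k - x v* mat 1 = l *s u" using k(1) x by (auto simp: same_quotient_def)
    then have l: "x v* k = x + l *s u" by (simp add: diff_eq_eq add.commute)
    have "B (x v* k) (y v* k) = B x y" by (rule GO_D(2)[OF kG])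
    moreover have "y v* k = y + z k" by (simp add: z_def)
    ultimately have "B x (z k) + l = 0"
      unfolding l using zu y by (simp add: B_linear B_commute[of u] add.commute)
    then show "x v* k = x - B x (z k) *s u"
      unfolding l by (simp add: add_eq_0_iff vec.scale_minus_left)
  qed
  have gh: "x v* k v* k' = x - B x (z k) *s u - B x (z k') *s u"
    if "same_quotient u k (mat 1)" "u v* k = u" "same_quotient u k' (mat 1)" "u v* k' = u" "B x u = 0" for k k' x
    using key(1)[OF that(1,2,5)] key(1)[OF that(3,4,5)] that(4)
    by (simp add: vector_matrix_mult_diff_distrib scalar_vector_matrix_assoc)
  have ygh: "y v* k v* k' = y + z k' + z k - B (z k) (z k') *s u"
    if k: "same_quotient u k (mat 1)" "u v* k = u" "same_quotient u k' (mat 1)" "u v* k' = u" for k k'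
  proof -
    have "B 0 u = 0" by (simp add: B_linear)
    from key(2)[OF k(1,2) this] have "B (z k) u = 0" .
    have "y v* k = y + z k" by (simp add: z_def)
    then have "y v* k v* k' = y v* k' + z k v* k'" by (simp add: vector_matrix_left_distrib)
    also have "\<dots> = y + z k' + (z k - B (z k) (z k') *s u)"
      using key(1)[OF k(3,4) \<open>B (z k) u = 0\<close>] by (simp add: z_def)
    finally show ?thesis by simp
  qed
  show ?thesis
  proof (rule vector_matrix_eqI)
    fix v
    define x where "x = v - B v u *s y"
    have x: "B x u = 0" by (simp add: x_def B_linear y)
    have v: "v = x + B v u *s y" by (simp add: x_def)
    have split: "v v* k v* k' = x v* k v* k' + B v u *s (y v* k v* k')" for k k'
      by (subst v) (simp add: vector_matrix_left_distrib scalar_vector_matrix_assoc)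
    show "v v* (g ** h) = v v* (h ** g)"
      unfolding vector_matrix_mul_assoc[symmetric] split
      unfolding gh[OF g h x] gh[OF h g x] ygh[OF g h] ygh[OF h g] B_commute[of "z h" "z g"]
      by (simp add: algebra_simps)
  qed
qed

text \<open>Letters with first vector \<open>u\<close> act trivially on the orthogonal space of
  \<open>u\<close> modulo \<open>u\<close>. The connected group \<open>M\<close> generated by them
  and \<open>Bo\<close> therefore acts there as \<open>Bo\<close> does, and what acts trivially
  there is solvable; maximality then gives \<open>M = Bo\<close>.\<close>

lemma borel_contains_letters:
  assumes Bo: "borel_subgroup (SO Q) Bo" and u: "u \<noteq> 0" "Q u = 0" "common_eigenvector Bo u"
    and v: "Q v = 0" "B u v \<noteq> 0" and s: "s \<noteq> 0"
  shows "letter (fl u) (fl v) s \<in> Bo"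
proof -
  have cs: "connected_solvable Bo" and BoG: "Bo \<subseteq> SO Q" using Bo by (auto simp: borel_subgroup_def)
  obtain n where Bn: "subgroup Bo GL" "connectedin zariski Bo" "(derived GL ^^ n) Bo = {mat 1}"
    using connected_solvable_D[OF cs] by metis
  define L where "L = {letter (fl u) (fl v) s |v s. Q v = 0 \<and> B u v \<noteq> 0 \<and> s \<noteq> 0}"
  have LG: "L \<subseteq> SO Q" unfolding L_def using letter_fl_SO u(2) by blast
  have S: "Bo \<union> L \<subseteq> carrier GL" "Bo \<union> L \<subseteq> SO Q"
    using LG BoG subgroup.subset[OF SO_subgroup] by auto
  define M where "M = generate GL (Bo \<union> L)"
  have M: "subgroup M GL" unfolding M_def by (rule GL.generate_is_subgroup[OF S(1)])
  have SM: "Bo \<union> L \<subseteq> M" unfolding M_def by (auto intro: generate.incl)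
  have MG: "M \<subseteq> SO Q" unfolding M_def by (rule GL.generate_subgroup_incl[OF S(2) SO_subgroup])
  have conn: "connectedin zariski M"
    unfolding M_def
  proof (rule connectedin_generate[OF S(1)])
    fix g assume g: "g \<in> Bo \<union> L"
    show "\<exists>C. connectedin zariski C \<and> C \<subseteq> generate GL (Bo \<union> L) \<and> mat 1 \<in> C \<and> g \<in> C"
    proof (cases "g \<in> Bo")
      case True
      then show ?thesis
        using Bn(2) subgroup_GL_one[OF Bn(1)] SM unfolding M_def by (intro exI[of _ Bo]) auto
    next
      case False
      then obtain v s where vs: "g = letter (fl u) (fl v) s" "Q v = 0" "B u v \<noteq> 0" "s \<noteq> 0"
        using g by (auto simp: L_def)
      let ?C = "letter (fl u) (fl v) ` {s. s \<noteq> 0}"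
      have "?C \<subseteq> L" unfolding L_def using vs(2,3) by blast
      then have "?C \<subseteq> generate GL (Bo \<union> L)" using SM unfolding M_def by blast
      moreover have "mat 1 \<in> ?C" by (rule image_eqI[of _ _ 1]) simp_all
      moreover have "g \<in> ?C" using vs by blast
      ultimately show ?thesis using connectedin_letters[of "fl u" "fl v"] by blast
    qed
  qed
  have BoL: "b \<in> line_group u" if "b \<in> Bo" for b
    using that BoG SO_GO u(3) by (auto simp: line_group_def common_eigenvector_def)
  have "\<exists>b\<in>Bo. same_quotient u g b" if "g \<in> M" for g
  proof (rule generate_related[where R = "same_quotient u" and S = "Bo \<union> L"])
    show "same_quotient u (mat 1) (mat 1)" by (rule same_quotient_refl[OF line_group_one])
    show "g \<in> generate GL (Bo \<union> L)" using that by (simp add: M_def)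
    fix g assume "g \<in> Bo \<union> L"
    then consider "g \<in> Bo" | v s where "g = letter (fl u) (fl v) s" "Q v = 0" "B u v \<noteq> 0" "s \<noteq> 0"
      by (auto simp: L_def)
    then show "\<exists>b\<in>Bo. same_quotient u g b"
    proof cases
      case 1 then show ?thesis using same_quotient_refl BoL by blast
    next
      case 2
      have "u v* g = s *s u"
        unfolding 2(1) vector_letter_fl using 2 by (simp add: isotropic_self u vec.scale_left_diff_distrib)
      then have "g \<in> line_group u"
        using letter_fl_SO[OF u(2) 2(2,3,4)] SO_GO by (auto simp: line_group_def 2(1))
      moreover have "\<exists>c. x v* g - x v* mat 1 = c *s u" if "B x u = 0" for x
        unfolding 2(1) vector_letter_fl using that by auto
      ultimately show ?thesis
        using subgroup_GL_one[OF Bn(1)] line_group_one by (intro bexI[of _ "mat 1"]) (auto simp: same_quotient_def)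
    qed
  qed (use Bn(1) S(1) same_quotient_mult[OF u(1)] same_quotient_inv[OF u(1)] in auto)
  note MB = this
  \<comment> \<open>After \<open>n\<close> derivations the action modulo \<open>u\<close> is
    trivial, the next commutators also fix \<open>u\<close>, and by \<open>unipotent_commute\<close>
    one more derivation ends the series.\<close>
  define M1 where "M1 = (derived GL ^^ n) M"
  have M1: "subgroup M1 GL" "M1 \<subseteq> M" unfolding M1_def by (rule exp_derived_GL[OF M])+
  have M1q: "same_quotient u g (mat 1)" if "g \<in> M1" for g
  proof -
    have "\<exists>b\<in>(derived GL ^^ n) Bo. same_quotient u g b"
      by (rule exp_derived_related[where R = "same_quotient u" and M = M])
        (use that Bn(1) M MB same_quotient_refl[OF line_group_one] same_quotient_mult[OF u(1)]
          same_quotient_inv[OF u(1)] in \<open>auto simp: M1_def\<close>)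
    then show ?thesis by (simp add: Bn(3))
  qed
  define M2 where "M2 = derived GL M1"
  have M2: "subgroup M2 GL" "M2 \<subseteq> M1"
    unfolding M2_def by (rule GL.derived_is_subgroup[OF subgroup.subset[OF M1(1)]]) (rule derived_GL_subset[OF M1(1)])
  have fixu: "subgroup {g \<in> M1. u v* g = u} GL"
  proof (rule GL.subgroupI)
    show "{g \<in> M1. u v* g = u} \<subseteq> carrier GL" using subgroup.subset[OF M1(1)] by blast
    show "{g \<in> M1. u v* g = u} \<noteq> {}" using subgroup_GL_one[OF M1(1)] by auto
    fix g assume g: "g \<in> {g \<in> M1. u v* g = u}"
    then have g': "invertible g" "matrix_inv g \<in> M1" "g ** matrix_inv g = mat 1"
      using subgroup_GL_D[OF M1(1)] by auto
    have "u v* matrix_inv g = (u v* g) v* matrix_inv g" using g by simp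
    also have "\<dots> = u" by (simp only: vector_matrix_mul_assoc g' vector_matrix_mul_rid)
    finally show "inv\<^bsub>GL\<^esub> g \<in> {g \<in> M1. u v* g = u}" using g' by simp
    fix h assume "h \<in> {g \<in> M1. u v* g = u}"
    then show "g \<otimes>\<^bsub>GL\<^esub> h \<in> {g \<in> M1. u v* g = u}"
      using g subgroup_GL_mult[OF M1(1)] by (simp add: vector_matrix_mul_assoc[symmetric])
  qed
  have com: "u v* (g ** h ** matrix_inv g ** matrix_inv h) = u" if gh: "g \<in> M1" "h \<in> M1" for g h
  proof -
    obtain c d where c: "u v* g = c *s u" and d: "u v* h = d *s u"
      using M1q[OF gh(1)] M1q[OF gh(2)] by (auto simp: same_quotient_def line_group_def)
    have "u v* (g ** h) = u v* (h ** g)"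
      by (simp add: vector_matrix_mul_assoc[symmetric] c d scalar_vector_matrix_assoc mult.commute)
    then have "u v* (g ** h ** matrix_inv g ** matrix_inv h) = u v* (h ** (g ** matrix_inv g) ** matrix_inv h)"
      by (simp add: matrix_mul_assoc) (simp add: vector_matrix_mul_assoc[symmetric])
    then show ?thesis using subgroup_GL_D(3)[OF M1(1)] gh by simp
  qed
  have "M2 \<subseteq> {g \<in> M1. u v* g = u}"
    unfolding M2_def derived_def
  proof (rule GL.generate_subgroup_incl[OF _ fixu])
    show "derived_set GL M1 \<subseteq> {g \<in> M1. u v* g = u}"
    proof clarify
      fix g h assume gh: "g \<in> M1" "h \<in> M1"
      have "g ** h ** matrix_inv g ** matrix_inv h \<in> M1"
        using commutator_in_derived_GL[OF M1(1) gh] M2(2) unfolding M2_def by blast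
      then show "g \<otimes>\<^bsub>GL\<^esub> h \<otimes>\<^bsub>GL\<^esub> inv\<^bsub>GL\<^esub> g \<otimes>\<^bsub>GL\<^esub> inv\<^bsub>GL\<^esub> h \<in> M1 \<and>
          u v* (g \<otimes>\<^bsub>GL\<^esub> h \<otimes>\<^bsub>GL\<^esub> inv\<^bsub>GL\<^esub> g \<otimes>\<^bsub>GL\<^esub> inv\<^bsub>GL\<^esub> h) = u"
        using com[OF gh] subgroup_GL_D(1)[OF M1(1)] gh by simp
    qed
  qed
  then have M2u: "same_quotient u g (mat 1)" "u v* g = u" if "g \<in> M2" for g
    using that M1q by auto
  have "derived GL M2 \<subseteq> {mat 1}"
    unfolding derived_def
  proof (rule GL.generate_subgroup_incl)
    show "subgroup {mat 1} (GL :: ('a^'n^'n) monoid)" using GL.triv_subgroup by simp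
    show "derived_set GL M2 \<subseteq> {mat 1}"
    proof clarify
      fix g h assume gh: "g \<in> M2" "h \<in> M2"
      have "g ** h = h ** g" using M2u[OF gh(1)] M2u[OF gh(2)] by (intro unipotent_commute[OF u(1,2)])
      then have "g ** h ** matrix_inv g ** matrix_inv h = h ** (g ** matrix_inv g) ** matrix_inv h"
        by (simp add: matrix_mul_assoc)
      then show "g \<otimes>\<^bsub>GL\<^esub> h \<otimes>\<^bsub>GL\<^esub> inv\<^bsub>GL\<^esub> g \<otimes>\<^bsub>GL\<^esub> inv\<^bsub>GL\<^esub> h = mat 1"
        using subgroup_GL_D[OF M2(1)] gh by simp
    qed
  qed
  then have "derived GL M2 = {mat 1}"
    using subgroup_GL_one[OF GL.derived_is_subgroup[OF subgroup.subset[OF M2(1)]]] by blast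
  then have D: "(derived GL ^^ Suc (Suc n)) M = {mat 1}" by (simp add: M2_def M1_def)
  have "M = Bo"
    by (rule borel_maximal[OF group det_GO[OF SO_GO] Bo M MG _ conn D]) (use SM in auto)
  moreover have "letter (fl u) (fl v) s \<in> L" unfolding L_def using v s by blast
  ultimately show ?thesis using SM by blast
qed

end

lemma dual_basis_eq_pair:
  fixes e :: "nat \<Rightarrow> 'a::field^'n"
  assumes inj: "inj_on e {1..CARD('n)}" and ind: "vec.independent (e ` {1..CARD('n)})"
    and span: "vec.span (e ` {1..CARD('n)}) = UNIV"
    and q: "\<And>i. i \<in> {1..CARD('n)} \<Longrightarrow> i \<noteq> CARD('n) \<Longrightarrow> pair (e i) q = 0" "pair (e CARD('n)) q \<noteq> 0"
  shows "dual_basis e CARD('n) x = pair x q / pair (e CARD('n)) q"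
proof -
  let ?m = "CARD('n)" and ?E = "e ` {1..CARD('n)}"
  have m: "?m \<in> {1..?m}" by (simp add: Suc_leI)
  have "x = (\<Sum>b\<in>?E. vec.representation ?E x b *s b)"
    using vec.sum_representation_eq[OF ind, of x ?E] span by simp
  then have "pair x q = pair (\<Sum>b\<in>?E. vec.representation ?E x b *s b) q" by simp
  also have "\<dots> = (\<Sum>b\<in>?E. vec.representation ?E x b * pair b q)"
  proof -
    have "pair (\<Sum>b\<in>A. f b *s b) q = (\<Sum>b\<in>A. f b * pair b q)" for A f
      by (induction A rule: infinite_finite_induct) (simp_all add: pair_simps)
    then show ?thesis .
  qed
  also have "\<dots> = (\<Sum>i\<in>{1..?m}. vec.representation ?E x (e i) * pair (e i) q)"
    by (rule sum.reindex[OF inj, unfolded o_def])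
  also have "\<dots> = (\<Sum>i\<in>{?m}. vec.representation ?E x (e i) * pair (e i) q)"
    using q m by (intro sum.mono_neutral_right) auto
  finally show ?thesis using q(2) by (simp add: dual_basis_def)
qed

section \<open>Weight vectors and opposite Borel subgroups\<close>

context nondegenerate_form
begin

lemma generic_scalar: "finite A \<Longrightarrow> \<exists>s :: 'a. s \<notin> A"
  using ex_new_if_finite[OF infinite_alg_closed] by blast

lemma exists_generic_isotropic:
  assumes "CARD('n) > 2" "u \<noteq> 0" "v \<noteq> 0"
  obtains x where "Q x = 0" "B x u \<noteq> 0" "B x v \<noteq> 0"
proof -
  let ?F = "{\<lambda>z :: ('a, 'n) flag. pair (fst z) (J u), \<lambda>z. pair (fst z) (J v)}"
  have ex: "\<exists>z\<in>cone. pair (fst z) (J x) \<noteq> 0" if "x \<noteq> 0" for x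
  proof -
    have "CARD('n) \<ge> 2" "J x \<noteq> 0" using assms(1) that by auto
    then obtain y where "Q y = 0" "pair y (J x) \<noteq> 0" by (rule exists_isotropic_pair_nonzero)
    then show ?thesis by (intro bexI[of _ "fl y"]) (auto simp: cone_def)
  qed
  have "\<exists>z\<in>cone. \<forall>f\<in>?F. f z \<noteq> 0"
  proof (rule common_nonzero_flag[OF curve_connected_cone[OF assms(1)]])
    show "cone \<noteq> {}" using ex[OF assms(2)] by blast
    show "?F \<subseteq> flag_tests" unfolding flag_tests_def by blast
    show "\<exists>z\<in>cone. f z \<noteq> 0" if "f \<in> ?F" for f using that ex[OF assms(2)] ex[OF assms(3)] by blast
  qed simp
  then show ?thesis using that by (auto simp: cone_def)
qed

text \<open>Mapping \<open>z\<close> into its own line and mapping it into the line of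
  \<open>z'\<close> are closed conditions, exclusive unless the lines coincide. Connectedness leaves
  the one that the identity satisfies.\<close>

lemma line_eigenvector_connected:
  assumes H: "subgroup H GL" "connectedin zariski H"
    and z: "\<And>h. h \<in> H \<Longrightarrow> (\<exists>c. z v* h = c *s z) \<or> (\<exists>c. z v* h = c *s z')" and "z \<noteq> 0" "h \<in> H"
  shows "\<exists>c. z v* h = c *s z"
proof -
  define L where "L = (\<lambda>b. vec.span {if b then z else z'})"
  have L: "x \<in> L b \<longleftrightarrow> (\<exists>c. x = c *s (if b then z else z'))" for x b
    by (auto simp: L_def vec.span_singleton)
  show ?thesis
  proof (cases "z' \<in> L True \<or> z \<in> L False")
    case True
    then have "z' \<in> L True"
    proof
      assume "z \<in> L False"
      then obtain c where c: "z = c *s z'" by (auto simp: L)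
      then have "c \<noteq> 0" using \<open>z \<noteq> 0\<close> by auto
      then have "z' = inverse c *s z" using c by simp
      then show ?thesis unfolding L by (intro exI[of _ "inverse c"]) simp
    qed
    then obtain d where "z' = d *s z" by (auto simp: L)
    then show ?thesis using z[OF \<open>h \<in> H\<close>] by auto
  next
    case False
    have nz: "z v* h \<noteq> 0" if "h \<in> H" for h
    proof
      assume "z v* h = 0"
      then have "z v* h v* matrix_inv h = 0" by simp
      then show False using \<open>z \<noteq> 0\<close> subgroup_GL_D(3)[OF H(1) that] by (simp add: vector_matrix_mul_assoc)
    qed
    have "H \<subseteq> {h. z v* h \<in> L True}"
    proof (rule connectedin_finite_cover[OF H(2), of "UNIV :: bool set" "\<lambda>b. {h. z v* h \<in> L b}" True "mat 1"])
      show "closedin zariski {h. z v* h \<in> L b}" for b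
        unfolding L_def
        by (intro closedin_subspace_preimage vec.subspace_span matrix_polys.vector_matrix_mult
            matrix_polys.const_fun matrix_poly_funs.entry)
      show "H \<subseteq> (\<Union>b\<in>UNIV. {h. z v* h \<in> L b})"
        using z by (auto simp: L UNIV_bool)
      have "{h. z v* h \<in> L True} \<inter> {h. z v* h \<in> L False} \<inter> H = {}"
      proof -
        have False if h: "h \<in> H" "z v* h = c *s z" "z v* h = d *s z'" for h c d
        proof -
          have "d \<noteq> 0" using nz[OF h(1)] h(3) by auto
          have "d *s z' = c *s z" using h(2,3) by simp
          then have "inverse d *s (d *s z') = inverse d *s (c *s z)" by simp
          then have "z' = (inverse d * c) *s z" using \<open>d \<noteq> 0\<close> by simp
          then have "z' \<in> L True" unfolding L by (intro exI[of _ "inverse d * c"]) simp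
          with \<open>\<not> (z' \<in> L True \<or> z \<in> L False)\<close> show False by blast
        qed
        then show ?thesis by (auto simp: L)
      qed
      then show "{h. z v* h \<in> L b} \<inter> {h. z v* h \<in> L b'} \<inter> H = {}" if "b \<noteq> b'" for b b'
        using that by (cases b; cases b') auto
      show "mat 1 \<in> H" by (rule subgroup_GL_one[OF H(1)])
      show "mat 1 \<in> {h. z v* h \<in> L True}" unfolding L by (auto intro: exI[of _ 1])
    qed auto
    then show ?thesis using \<open>h \<in> H\<close> by (auto simp: L)
  qed
qed

text \<open>
  A Borel subgroup with an anisotropic eigenvector \<open>e\<close> stabilises, by the Lie-Kolchin theorem applied
  to the orthogonal space of \<open>e\<close>, a plane through \<open>e\<close> on which the form has at most two isotropic
  lines. It fixes these, hence contains the letters of \<open>borel_contains_letters\<close>, and these do not fix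
  the line through \<open>e\<close>.
\<close>

lemma borel_eigenvector_isotropic:
  assumes m: "CARD('n) > 2" and Bo: "borel_subgroup (SO Q) Bo" and e: "common_eigenvector Bo e"
  shows "Q e = 0"
proof (rule ccontr)
  assume Qe: "Q e \<noteq> 0"
  have e0: "e \<noteq> 0" using Qe by auto
  have cs: "connected_solvable Bo" and BoG: "Bo \<subseteq> SO Q" using Bo by (auto simp: borel_subgroup_def)
  obtain n where Bn: "subgroup Bo GL" "connectedin zariski Bo" "(derived GL ^^ n) Bo = {mat 1}"
    using connected_solvable_D[OF cs] by metis
  have BoGO: "h \<in> GO Q" if "h \<in> Bo" for h using that BoG SO_GO by blast
  have eh: "\<exists>c. e v* h = c *s e" if "h \<in> Bo" for h using e that by (simp add: common_eigenvector_def)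
  have eigval: "c\<^sup>2 = 1" if "h \<in> GO Q" "e v* h = c *s e" for h c
    using GO_D(1)[OF that(1), of e] Qe that(2) by (simp add: Q_scale)
  define W where "W = {x. B x e = 0}"
  \<comment> \<open>As \<open>B e e = 2 * Q e\<close>, the subspace \<open>U\<close> is zero except
    in characteristic 2, where it is the line of \<open>e\<close>.\<close>
  define U where "U = {x \<in> W. \<exists>c. x = c *s e}"
  have W: "vec.subspace W" unfolding W_def by (rule vec.subspaceI) (simp_all add: B_linear)
  have U: "vec.subspace U"
    unfolding U_def
  proof (rule vec.subspaceI)
    show "0 \<in> {x \<in> W. \<exists>c. x = c *s e}" using subspace_rules(1)[OF W] by (auto intro: exI[of _ 0])
    fix x y assume x: "x \<in> {x \<in> W. \<exists>c. x = c *s e}"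
    then obtain c where c: "x = c *s e" by blast
    have "k *s x = (k * c) *s e" for k by (simp add: c)
    then show "k *s x \<in> {x \<in> W. \<exists>c. x = c *s e}" for k using x subspace_rules(4)[OF W] by blast
    assume y: "y \<in> {x \<in> W. \<exists>c. x = c *s e}"
    then obtain d where "y = d *s e" by blast
    then have "x + y = (c + d) *s e" by (simp add: c vec.scale_left_distrib)
    then show "x + y \<in> {x \<in> W. \<exists>c. x = c *s e}" using x y subspace_rules(2)[OF W] by blast
  qed
  have Winv: "x v* h \<in> W" if h: "h \<in> Bo" and x: "x \<in> W" for h x
  proof -
    obtain c where c: "e v* h = c *s e" using eh[OF h] by blast
    then have "c \<noteq> 0" using eigval[OF BoGO[OF h]] by (metis power_zero_numeral zero_neq_one)
    have "B (x v* h) (e v* h) = 0" using GO_D(2)[OF BoGO[OF h]] x by (simp add: W_def)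
    then show ?thesis using c \<open>c \<noteq> 0\<close> by (simp add: W_def B_linear)
  qed
  have Uinv: "x v* h \<in> U" if h: "h \<in> Bo" and x: "x \<in> U" for h x
  proof -
    obtain c d where "e v* h = c *s e" "x = d *s e" using eh[OF h] x by (auto simp: U_def)
    then have "x v* h = (d * c) *s e" by (simp add: scalar_vector_matrix_assoc)
    moreover have "x \<in> W" using x by (simp add: U_def)
    ultimately show ?thesis unfolding U_def using Winv[OF h \<open>x \<in> W\<close>] by blast
  qed
  have "U \<subset> W"
  proof -
    obtain i where i: "e $ i \<noteq> 0" using e0 by (auto simp: vec_eq_iff)
    \<comment> \<open>Two linear conditions leave a nonzero vector in dimension above 2; the
      vanishing coordinate keeps it off the line of \<open>e\<close>.\<close>
    obtain w where w: "w \<noteq> 0" "pair w (J e) = 0" "pair w (axis i 1) = 0" by (rule exists_orthogonal[OF m])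
    have "w \<notin> U"
    proof
      assume "w \<in> U"
      then obtain c where c: "w = c *s e" by (auto simp: U_def)
      then have "c = 0" using w(3) i by simp
      then show False using c w(1) by simp
    qed
    moreover have "w \<in> W" using w(2) by (simp add: W_def)
    ultimately show ?thesis by (auto simp: U_def)
  qed
  from lie_kolchin[OF Bn(1,2) _ Bn(3) U Uinv W Winv this] det_GO[OF BoGO]
  obtain f where f: "f \<in> W - U" "\<forall>h\<in>Bo. \<exists>c. f v* h - c *s f \<in> U" by blast
  have fh: "\<exists>c d. f v* h = c *s f + d *s e" if h: "h \<in> Bo" for h
  proof -
    obtain c where "f v* h - c *s f \<in> U" using bspec[OF f(2) h] by blast
    then obtain d where "f v* h - c *s f = d *s e" unfolding U_def by blast
    then have "f v* h = c *s f + d *s e" by (simp add: diff_eq_eq add.commute)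
    then show ?thesis by blast
  qed
  have fe: "B f e = 0" "B e f = 0" using f(1) by (auto simp: W_def B_commute[of e])
  have f0: "f \<noteq> 0" using f(1) subspace_rules(1)[OF U] by auto
  have "\<exists>z. z \<noteq> 0 \<and> Q z = 0 \<and> common_eigenvector Bo z"
  proof (cases "Q f = 0")
    case True
    have "\<exists>c. f v* h = c *s f" if h: "h \<in> Bo" for h
    proof -
      obtain c d where cd: "f v* h = c *s f + d *s e" using fh[OF h] by blast
      have "Q (f v* h) = 0" using GO_D(1)[OF BoGO[OF h]] True by simp
      then have "d = 0" unfolding cd using Qe True by (simp add: Q_add Q_scale B_linear fe)
      then show ?thesis using cd by auto
    qed
    then show ?thesis using True f0 by (auto simp: common_eigenvector_def)
  next
    case False
    \<comment> \<open>With this \<open>l\<close> every isotropic vector of the plane lies on the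
      line of \<open>e + l f\<close> or of \<open>e - l f\<close>; in characteristic 2 the two lines
      coincide.\<close>
    obtain l where l: "l ^ 2 = - Q e / Q f" using exists_square_root by blast
    then have lQ: "l\<^sup>2 * Q f = - Q e" using False by simp
    have l0: "l \<noteq> 0" using lQ Qe by auto
    define z where "z = e + l *s f"
    define z' where "z' = e - l *s f"
    have Qz: "Q z = 0" using lQ by (simp add: z_def Q_add Q_scale B_linear fe)
    have z0: "z \<noteq> 0"
    proof
      assume "z = 0"
      then have "l *s f = (- 1) *s e" by (simp add: z_def add_eq_0_iff vec.scale_minus_left)
      then have "inverse l *s (l *s f) = inverse l *s ((- 1) *s e)" by simp
      then have "f = (inverse l * (- 1)) *s e" using l0 by (simp only: vec.scale_scale) simp
      then have "f \<in> U" using f(1) unfolding U_def by blast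
      then show False using f(1) by blast
    qed
    have "\<exists>c. z v* h = c *s z" if h: "h \<in> Bo" for h
    proof (rule line_eigenvector_connected[OF Bn(1,2) _ z0 h, of z'])
      fix h assume h: "h \<in> Bo"
      obtain k where k: "e v* h = k *s e" using eh[OF h] by blast
      obtain c d where cd: "f v* h = c *s f + d *s e" using fh[OF h] by blast
      let ?\<alpha> = "k + l * d" and ?\<beta> = "l * c"
      have zh: "z v* h = ?\<alpha> *s e + ?\<beta> *s f"
        by (simp add: z_def vector_matrix_left_distrib scalar_vector_matrix_assoc k cd
            vec.scale_right_distrib vec.scale_left_distrib)
      have "Q (z v* h) = 0" using GO_D(1)[OF BoGO[OF h]] Qz by simp
      then have "?\<alpha>\<^sup>2 * Q e + ?\<beta>\<^sup>2 * Q f = 0" unfolding zh by (simp only: Q_add[of "?\<alpha> *s e"] Q_scale B_linear(3,7) fe mult_zero_right add_0_right)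
      moreover have "Q e = - (l\<^sup>2 * Q f)" using lQ by simp
      ultimately have "(?\<beta>\<^sup>2 - (l * ?\<alpha>)\<^sup>2) * Q f = 0" by (simp only: power_mult_distrib left_diff_distrib) (simp add: algebra_simps)
      then have "?\<beta>\<^sup>2 = (l * ?\<alpha>)\<^sup>2" using False by simp
      then have "?\<beta> = l * ?\<alpha> \<or> ?\<beta> = - (l * ?\<alpha>)" by (simp only: power2_eq_iff)
      then have "z v* h = ?\<alpha> *s z \<or> z v* h = ?\<alpha> *s z'"
      proof
        assume b: "?\<beta> = l * ?\<alpha>"
        have "z v* h = ?\<alpha> *s z"
          unfolding zh b unfolding z_def by (simp only: vec.scale_right_distrib vec.scale_scale mult.commute[of l])
        then show ?thesis by blast
      next
        assume b: "?\<beta> = - (l * ?\<alpha>)"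
        have "z v* h = ?\<alpha> *s z'"
          unfolding zh z'_def b
          by (simp only: vec.scale_right_diff_distrib vec.scale_scale vec.scale_minus_left mult.commute[of l]) simp
        then show ?thesis by blast
      qed
      then show "(\<exists>c. z v* h = c *s z) \<or> (\<exists>c. z v* h = c *s z')" by blast
    qed
    then show ?thesis using z0 Qz by (auto simp: common_eigenvector_def)
  qed
  then obtain z where z: "z \<noteq> 0" "Q z = 0" "common_eigenvector Bo z" by blast
  obtain v where v: "Q v = 0" "B v e \<noteq> 0" "B v z \<noteq> 0"
    using exists_generic_isotropic[OF m e0 z(1)] by metis
  \<comment> \<open>The letter multiplies \<open>B e v\<close> by \<open>s\<close>, so it would
    scale \<open>e\<close> by \<open>s\<close>, whereas an eigenvalue at an anisotropic vector has
    square 1.\<close>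
  obtain s :: 'a where s: "s \<notin> {0, 1, -1}" using generic_scalar[of "{0, 1, -1}"] by auto
  have zv: "B z v \<noteq> 0" using v(3) by (simp add: B_commute)
  let ?g = "letter (fl z) (fl v) s"
  have g: "?g \<in> Bo" using s zv by (intro borel_contains_letters[OF Bo z v(1)]) auto
  then obtain c where c: "e v* ?g = c *s e" using eh by blast
  have "B (e v* ?g) v = s * B e v"
    unfolding vector_letter_fl using zv v(1) by (simp add: B_linear isotropic_self diff_divide_distrib algebra_simps)
  then have "c * B e v = s * B e v" using c by (simp add: B_linear)
  then have "c = s" using v(2) by (simp add: B_commute[of e])
  moreover have "c\<^sup>2 = 1" using eigval[OF BoGO[OF g] c] .
  ultimately show False using s by (simp add: power2_eq_1_iff)
qed

text \<open>These are Eichler transformations, without quadratic term as \<open>x\<close> is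
  isotropic. Each is a product of two letters with the same first vector \<open>u\<close>, inverse
  parameters, and second vectors \<open>v\<close> and \<open>v + x\<close>; the parameter is
  \<open>1 + k\<close>.\<close>

lemma borel_contains_transvection:
  assumes Bo: "borel_subgroup (SO Q) Bo" and u: "u \<noteq> 0" "Q u = 0" "common_eigenvector Bo u"
    and x: "Q x = 0" "B u x = 0" "x \<notin> vec.span {u}" and k: "k \<noteq> 0" "k \<noteq> -1"
  obtains E where "E \<in> Bo" "\<And>y. y v* E = y + k *s (B y x *s u - B y u *s x)"
proof -
  have "J u \<notin> vec.span {J x}"
  proof
    assume "J u \<in> vec.span {J x}"
    then obtain c where "J u = J (c *s x)" by (auto simp: vec.span_singleton J_linear)
    then have "J (u - c *s x) = 0" by (simp add: J_linear(2))
    then have c: "u = c *s x" unfolding J_eq_0 by simp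
    then have "c \<noteq> 0" using u(1) by auto
    then have "x = inverse c *s u" using c by simp
    then show False using x(3) by (auto simp: vec.span_singleton)
  qed
  then obtain y0 where y0: "pair (J u) y0 \<noteq> 0" "\<And>w. w \<in> vec.span {J x} \<Longrightarrow> pair w y0 = 0"
    using subspace_separate[OF vec.subspace_span] by metis
  have "pair (J x) y0 = 0" using y0(2) by (simp add: vec.span_base)
  with y0(1) have By0: "B y0 u \<noteq> 0" "B y0 x = 0" by (simp_all add: pair_commute[of _ y0])
  define y where "y = (1 / B y0 u) *s y0"
  have y: "B y u = 1" "B y x = 0" using By0 by (simp_all add: y_def B_linear)
  \<comment> \<open>\<open>v\<close> completes \<open>u\<close> to a hyperbolic pair orthogonal to
    \<open>x\<close>, so \<open>v + x\<close> is isotropic as well.\<close>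
  define v where "v = y - Q y *s u"
  have v: "Q v = 0" "B v u = 1" "B v x = 0" "B u v = 1" "B x v = 0"
    using y u x by (simp_all add: v_def Q_diff Q_scale B_linear isotropic_self B_commute[of u y] B_commute[of x y] B_commute[of x u])
  define v' where "v' = v + x"
  have v': "Q v' = 0" "B u v' = 1"
    using v x by (simp_all add: v'_def Q_add B_linear)
  define s where "s = 1 + k"
  have s: "s \<noteq> 0" "1 / s \<noteq> 0" using k(2) by (auto simp: s_def add_eq_0_iff)
  let ?E = "letter (fl u) (fl v) (1 / s) ** letter (fl u) (fl v') s"
  have cs: "subgroup Bo GL" using connected_solvable_D Bo unfolding borel_subgroup_def by metis
  have "?E \<in> Bo"
    using s v v' by (intro subgroup_GL_mult[OF cs] borel_contains_letters[OF Bo u]) auto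
  moreover have "yy v* ?E = yy + k *s (B yy x *s u - B yy u *s x)" for yy
  proof -
    define w where "w = yy + ((1 / s - 1) * B yy v) *s u + ((s - 1) * B yy u) *s v"
    have w: "yy v* letter (fl u) (fl v) (1 / s) = w"
      by (simp add: vector_letter_fl v(4) w_def)
    have wu: "B w u = s * B yy u" using u v by (simp add: w_def B_linear isotropic_self algebra_simps)
    have wv: "B w v' = B yy v / s + B yy x"
      using u v x s by (simp add: w_def v'_def B_linear isotropic_self algebra_simps)
    have "yy v* ?E = w + ((s - 1) * (B yy v / s + B yy x)) *s u + ((1 / s - 1) * (s * B yy u)) *s v'"
      unfolding vector_matrix_mul_assoc[symmetric] w by (simp add: vector_letter_fl v'(2) wu wv)
    also have "\<dots> = yy + ((1 / s - 1) * B yy v + (s - 1) * (B yy v / s + B yy x)) *s u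
        + ((s - 1) * B yy u + (1 / s - 1) * (s * B yy u)) *s v + ((1 / s - 1) * (s * B yy u)) *s x"
      by (simp add: w_def v'_def vec.scale_left_distrib vec.scale_right_distrib)
    also have "(1 / s - 1) * B yy v + (s - 1) * (B yy v / s + B yy x) = k * B yy x"
    proof -
      have "(1 / s - 1) * B yy v + (s - 1) * (B yy v / s) = 0"
        using s(1) by (simp add: left_diff_distrib diff_divide_distrib)
      then have "(1 / s - 1) * B yy v + (s - 1) * (B yy v / s + B yy x) = (s - 1) * B yy x"
        by (simp only: distrib_left add.assoc[symmetric]) simp
      then show ?thesis by (simp add: s_def)
    qed
    also have "(1 / s - 1) * (s * B yy u) = - (k * B yy u)" using s by (simp add: field_simps s_def)
    also have "(s - 1) * B yy u + - (k * B yy u) = 0" by (simp add: s_def)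
    finally show ?thesis by (simp add: vec.scale_right_diff_distrib vec.scale_minus_left)
  qed
  ultimately show ?thesis using that by blast
qed

theorem dual_basis_lowest_weight:
  assumes m: "CARD('n) > 2" and T: "weight_basis (SO Q) T e"
  shows "Q (e 1) = 0" "B (e CARD('n)) (e 1) \<noteq> 0"
    "dual_basis e CARD('n) x = B x (e 1) / B (e CARD('n)) (e 1)"
proof -
  let ?m = "CARD('n)" and ?E = "e ` {1..CARD('n)}"
  have inj: "inj_on e {1..?m}" and ind: "vec.independent ?E" and span: "vec.span ?E = UNIV"
    and eig: "\<And>i. i \<in> {1..?m} \<Longrightarrow> common_eigenvector T (e i)"
    using T by (auto simp: weight_basis_def)
  obtain B1 B2 where B12: "borel_subgroup (SO Q) B1" "borel_subgroup (SO Q) B2" "B1 \<inter> B2 = T"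
    "common_eigenvector B1 (e 1)" "common_eigenvector B2 (e ?m)"
    using T unfolding weight_basis_def opposite_borels_def by (elim conjE exE) (rule that)
  have m1: "1 \<in> {1..?m}" "?m \<in> {1..?m}" "?m \<noteq> 1" using m by auto
  let ?u = "e 1" and ?x = "e ?m"
  show Qu: "Q ?u = 0" by (rule borel_eigenvector_isotropic[OF m B12(1,4)])
  have Qx: "Q ?x = 0" by (rule borel_eigenvector_isotropic[OF m B12(2,5)])
  have nz: "?u \<noteq> 0" "?x \<noteq> 0" using B12 by (auto simp: common_eigenvector_def)
  have notspan: "e i \<notin> vec.span (e ` I)" if "i \<in> {1..?m}" "I \<subseteq> {1..?m}" "i \<notin> I" for i I
  proof
    assume ei: "e i \<in> vec.span (e ` I)"
    have sub: "e ` I \<subseteq> ?E - {e i}"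
    proof
      fix y assume "y \<in> e ` I"
      then obtain j where j: "j \<in> I" "y = e j" by blast
      have jm: "j \<in> {1..?m}" by (rule subsetD[OF that(2) j(1)])
      have "j \<noteq> i" using j(1) that(3) by metis
      then have "e j \<noteq> e i" using inj_onD[OF inj _ jm that(1)] by metis
      then show "y \<in> ?E - {e i}" unfolding j(2) using imageI[OF jm, of e] by simp
    qed
    have "e i \<in> vec.span (?E - {e i})" by (rule subsetD[OF vec.span_mono[OF sub] ei])
    moreover have "e i \<in> ?E" using that(1) by blast
    ultimately show False using ind[unfolded vec.dependent_def] by (metis (no_types))
  qed
  have xu: "?x \<notin> vec.span {?u}" "?u \<notin> vec.span {?x}"
    using notspan[of ?m "{1}"] notspan[of 1 "{?m}"] m1 by auto
  show Bxu: "B ?x ?u \<noteq> 0"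
  proof
    \<comment> \<open>Exchanging \<open>?u\<close> and \<open>?x\<close> and the sign of
      \<open>k\<close> gives the same Eichler transformation, so it lies in both Borel subgroups,
      hence in \<open>T\<close>. Having every \<open>e i\<close> as an eigenvector, it forces all of
      them to be orthogonal to \<open>?u\<close>.\<close>
    assume Bxu: "B ?x ?u = 0"
    then have Bux: "B ?u ?x = 0" by (simp add: B_commute)
    obtain k :: 'a where k: "k \<notin> {0, 1, -1}" using generic_scalar[of "{0, 1, -1}"] by auto
    obtain E where E: "E \<in> B1" "\<And>y. y v* E = y + k *s (B y ?x *s ?u - B y ?u *s ?x)"
      using borel_contains_transvection[OF B12(1) nz(1) Qu B12(4) Qx Bux xu(1), of k] k by auto
    have k': "- k \<noteq> 0" "- k \<noteq> - 1" using k by auto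
    obtain E' where E': "E' \<in> B2" "\<And>y. y v* E' = y + (- k) *s (B y ?u *s ?x - B y ?x *s ?u)"
      using borel_contains_transvection[OF B12(2) nz(2) Qx B12(5) Qu Bxu xu(2) k'] by metis
    have "E' = E"
      by (rule vector_matrix_eqI) (simp add: E E' vec.scale_right_diff_distrib vec.scale_minus_left)
    then have ET: "E \<in> T" using E(1) E'(1) B12(3) by blast
    have "B (e i) ?u = 0" if i: "i \<in> {1..?m}" for i
    proof -
      obtain c where c: "e i v* E = c *s e i" using eig[OF i] ET by (auto simp: common_eigenvector_def)
      then have eq: "k *s (B (e i) ?x *s ?u - B (e i) ?u *s ?x) = (c - 1) *s e i"
        unfolding E(2) by (simp add: vec.scale_left_diff_distrib eq_diff_eq add.commute)
      show ?thesis
      proof (cases "c = 1")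
        case True
        then have "k *s (B (e i) ?x *s ?u - B (e i) ?u *s ?x) = 0" unfolding eq by simp
        then have "B (e i) ?x *s ?u - B (e i) ?u *s ?x = 0" unfolding vec.scale_eq_0_iff using k by blast
        then have "B (e i) ?x *s ?u = B (e i) ?u *s ?x" by simp
        show ?thesis
        proof (rule ccontr)
          assume n: "B (e i) ?u \<noteq> 0"
          have "inverse (B (e i) ?u) *s (B (e i) ?u *s ?x) = inverse (B (e i) ?u) *s (B (e i) ?x *s ?u)"
            using \<open>B (e i) ?x *s ?u = B (e i) ?u *s ?x\<close> by simp
          then have "?x = (inverse (B (e i) ?u) * B (e i) ?x) *s ?u" using n by simp
          then show False using xu(1) unfolding vec.span_singleton by blast
        qed
      next
        case False
        have "B ((c - 1) *s e i) ?u = 0"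
          unfolding eq[symmetric] using Qu Bxu by (simp add: B_linear isotropic_self)
        then show ?thesis using False by (simp add: B_linear)
      qed
    qed
    then have sub: "?E \<subseteq> {y. B y ?u = 0}" by auto
    have "vec.span ?E \<subseteq> {y. B y ?u = 0}"
      by (rule vec.span_minimal[OF sub]) (rule vec.subspaceI; simp add: B_linear)
    then have "B y ?u = 0" for y unfolding span by blast
    then have "B ?u y = 0" for y using B_commute[of ?u y] by simp
    then show False using nondeg nz(1) by blast
  qed
  obtain s :: 'a where s: "s \<notin> {0, 1}" using generic_scalar[of "{0, 1}"] by auto
  \<comment> \<open>Swapping the flags inverts the parameter, so this letter lies in both Borel
    subgroups and in \<open>T\<close>. As \<open>e i\<close> is an eigenvector, the multiple of
    \<open>?x\<close> that the letter adds to it must be zero by independence, and its coefficient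
    contains \<open>B (e i) ?u\<close>.\<close>
  let ?g = "letter (fl ?u) (fl ?x) s"
  have Bux: "B ?u ?x \<noteq> 0" using Bxu by (simp add: B_commute)
  have "?g \<in> B1" using s by (intro borel_contains_letters[OF B12(1) nz(1) Qu B12(4) Qx Bux]) auto
  moreover have "letter (fl ?x) (fl ?u) (1 / s) \<in> B2"
    using s by (intro borel_contains_letters[OF B12(2) nz(2) Qx B12(5) Qu Bxu]) auto
  ultimately have gT: "?g \<in> T" using B12(3) letter_swap[of "fl ?x" "fl ?u" s] by (metis IntI letter_swap)
  have orth: "B (e i) ?u = 0" if i: "i \<in> {1..?m}" "i \<noteq> ?m" for i
  proof (cases "i = 1")
    case True then show ?thesis using isotropic_self[OF Qu] by simp
  next
    case False
    obtain c where c: "e i v* ?g = c *s e i" using eig[OF i(1)] gT by (auto simp: common_eigenvector_def)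
    let ?k = "(1 / s - 1) / B ?u ?x * B (e i) ?u"
    have "?k = 0"
    proof (rule ccontr)
      assume k: "?k \<noteq> 0"
      have "e i + ((s - 1) / B ?u ?x * B (e i) ?x) *s ?u + ?k *s ?x = c *s e i"
        using c unfolding vector_letter_fl .
      then have "?k *s ?x = (c - 1) *s e i - ((s - 1) / B ?u ?x * B (e i) ?x) *s ?u"
        by (simp add: vec.scale_left_diff_distrib eq_diff_eq add_ac)
      also have "\<dots> \<in> vec.span (e ` {1, i})"
        by (intro vec.span_diff vec.span_scale vec.span_base) auto
      finally have "?x \<in> vec.span (e ` {1, i})"
        by (rule subspace_scale_cancel[OF vec.subspace_span _ k])
      then show False using notspan[of ?m "{1, i}"] i m1 by auto
    qed
    moreover have "1 / s - 1 \<noteq> 0" using s by (auto simp: field_simps)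
    ultimately show ?thesis using Bux s by auto
  qed
  have "dual_basis e ?m x = pair x (J ?u) / pair ?x (J ?u)"
    by (rule dual_basis_eq_pair[OF inj ind span]) (use orth Bxu in auto)
  then show "dual_basis e ?m x = B x ?u / B ?x ?u" by simp
qed

end

section \<open>The bound for nondegenerate forms and for the zero form\<close>

context nondegenerate_form
begin

text \<open>In dimension 2 the isotropic vectors form two lines; a connected group fixes each of
  them, against irreducibility.\<close>

lemma card_gt_2:
  assumes conn: "connectedin zariski (SO Q)" and m: "CARD('n) \<ge> 2" shows "CARD('n) > 2"
proof (rule ccontr)
  assume "\<not> CARD('n) > 2"
  then have m2: "CARD('n) = 2" using m by simp
  obtain u where u: "u \<noteq> 0" "Q u = 0" using exists_isotropic[OF m] by metis
  obtain y0 where y0: "B u y0 \<noteq> 0" using nondeg u(1) by blast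
  define y where "y = (1 / B u y0) *s y0"
  have y: "B u y = 1" using y0 by (simp add: y_def B_linear)
  define v where "v = y - Q y *s u"
  have v: "Q v = 0" "B u v = 1" "B v u = 1"
    using y u by (simp_all add: v_def Q_diff Q_scale B_linear isotropic_self B_commute[of y u])
  have vu: "v \<notin> vec.span {u}"
  proof
    assume "v \<in> vec.span {u}"
    then obtain c where "v = c *s u" by (auto simp: vec.span_singleton)
    then have "B u v = 0" using u by (simp add: B_linear isotropic_self)
    then show False using v by simp
  qed
  have "vec.independent {u}" using u(1) by (simp add: vec.independent_insert)
  then have ind: "vec.independent {v, u}" using vu by (simp add: vec.independent_insert)
  have "v \<noteq> u" using vu by (auto simp: vec.span_base)
  then have "vec.dim (UNIV :: ('a^'n) set) \<le> card {v, u}" unfolding vec_dim_card m2 by simp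
  then have span: "UNIV \<subseteq> vec.span {v, u}" by (intro vec.card_ge_dim_independent ind) auto
  have iso: "(\<exists>c. x = c *s u) \<or> (\<exists>c. x = c *s v)" if x: "Q x = 0" for x
  proof -
    have "x \<in> vec.span {v, u}" using span by blast
    then obtain k where "x - k *s v \<in> vec.span {u}" by (auto simp: vec.span_insert)
    then obtain l where l: "x - k *s v = l *s u" by (auto simp: vec.span_singleton)
    then have xe: "x = k *s v + l *s u" by (simp add: diff_eq_eq add.commute)
    then have "k * l = 0" using x u v by (auto simp: Q_add Q_scale B_linear)
    then show ?thesis using xe by auto
  qed
  have "\<exists>c. u v* g = c *s u" if g: "g \<in> SO Q" for g
  proof (rule line_eigenvector_connected[OF SO_subgroup conn _ u(1) g])
    fix h assume h: "h \<in> SO Q"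
    show "(\<exists>c. u v* h = c *s u) \<or> (\<exists>c. u v* h = c *s v)"
      by (rule iso) (simp add: GO_D(1)[OF SO_GO[OF h]] u)
  qed
  then have "\<forall>g\<in>SO Q. \<forall>x\<in>vec.span {u}. x v* g \<in> vec.span {u}"
    by (auto simp: vec.span_singleton scalar_vector_matrix_assoc) (metis rangeI vector_space_over_itself.scale_scale vec.scale_scale)
  then have "vec.span {u} = {0} \<or> vec.span {u} = UNIV"
    using irred vec.subspace_span[of "{u}"] unfolding acts_irreducibly_def by blast
  moreover have "vec.span {u} \<noteq> {0}" using u(1) vec.span_base[of u "{u}"] by auto
  ultimately show False using vu by blast
qed

theorem zariski_dim_word_image_SO:
  assumes K: "subfield_set K" "infinite K" "\<And>i j. a i j \<in> K" and m: "CARD('n) > 2"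
    and T: "weight_basis (SO Q) T e" and w: "w \<in> words (GO Q) r" "word_length w \<ge> 1"
    and small: "tomanov_small (SO Q) e \<inter> critical_constants w = {}"
  shows "enat (CARD('n) - 1) \<le> zariski_dim (word_image w r (rational_points K (SO Q)))"
proof (rule zariski_dim_word_image_ge[where C = cone and \<Gamma> = "{h \<in> SO Q. (\<forall>i j. h $ i $ j \<in> K) \<and> det h = 1}" and E = "GO Q"])
  show "curve_connected cone" by (rule curve_connected_cone[OF m])
  show "deformable cone (CARD('n) - 1)" by (rule deformable_cone)
  have m2: "CARD('n) \<ge> 2" using m by simp
  show "\<exists>z\<in>cone. pair (fst z) q \<noteq> 0" if "q \<noteq> 0" for q
    using exists_isotropic_pair_nonzero[OF m2 that] by (force simp: cone_def)
  show "\<exists>z\<in>cone. pair q (snd z) \<noteq> 0" if "q \<noteq> 0" for q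
  proof -
    have "J q \<noteq> 0" using that by simp
    then obtain u where "Q u = 0" "pair u (J q) \<noteq> 0" by (rule exists_isotropic_pair_nonzero[OF m2])
    then show ?thesis by (intro bexI[of _ "fl u"]) (auto simp: cone_def B_commute[of q u])
  qed
  show "pair (fst z) (snd z) = 0" if "z \<in> cone" for z
    using that by (auto simp: cone_def isotropic_self)
  show "{h \<in> SO Q. (\<forall>i j. h $ i $ j \<in> K) \<and> det h = 1} \<subseteq> rational_points K (SO Q)"
    by (auto simp: rational_points_def)
  show "det g ^ 2 = 1" if "g \<in> {h \<in> SO Q. (\<forall>i j. h $ i $ j \<in> K) \<and> det h = 1}" for g using that by simp
  show "letter z z' s \<in> zariski closure_of {h \<in> SO Q. (\<forall>i j. h $ i $ j \<in> K) \<and> det h = 1}"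
    if "z \<in> cone" "z' \<in> cone" "opposite z z'" "s \<noteq> 0" for z z' s
    using that letter_fl_in_closure[OF K(2,1,3)] by (auto simp: cone_def opposite_fl)
  show "w \<in> words (GO Q) r" "1 \<le> word_length w" "1 \<le> CARD('n) - 1" using w m by auto
  show "invertible c" if "c \<in> GO Q" for c using GO_D(3)[OF that] .
  fix c assume c: "c \<in> critical_constants w"
  have "c \<in> GO Q"
  proof -
    obtain j i \<epsilon> where j: "Suc j < length (snd w)" "snd w ! j = (i, \<epsilon>, c)"
      using c unfolding critical_constants_def word_length_def by blast
    then have "(i, \<epsilon>, c) \<in> set (snd w)" using nth_mem[of j "snd w"] by simp
    then show ?thesis using w(1) by (auto simp: words_def)
  qed
  moreover have "c \<notin> tomanov_small (SO Q) e" using c small by blast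
  ultimately obtain g where g: "g \<in> SO Q" "dual_basis e CARD('n) (e 1 v* (matrix_inv g ** c ** g)) \<noteq> 0"
    using GO_D(3)[of c] by (auto simp: tomanov_small_def)
  \<comment> \<open>Conjugation by \<open>g\<close> amounts to moving the isotropic vector
    \<open>e 1\<close>: up to a nonzero factor the Tomanov condition at \<open>g\<close> is the
    critical pairing \<open>B (?p v* c) ?p\<close>.\<close>
  let ?p = "e 1 v* matrix_inv g"
  have gi: "matrix_inv g \<in> GO Q" using GO_inv[OF SO_GO[OF g(1)]] .
  have "B (e 1 v* (matrix_inv g ** c ** g)) (e 1) \<noteq> 0"
    using g(2) dual_basis_lowest_weight(3)[OF m T] by auto
  moreover have "B (e 1 v* (matrix_inv g ** c ** g)) (e 1) = B (?p v* c) ?p"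
  proof -
    have "B (e 1 v* (matrix_inv g ** c ** g)) (e 1) = B ((?p v* c) v* g) (?p v* g)"
      using subgroup_GL_D(4)[OF SO_subgroup g(1)] by (simp add: vector_matrix_mul_assoc matrix_mul_assoc)
    then show ?thesis using GO_D(2)[OF SO_GO[OF g(1)]] by simp
  qed
  moreover have "Q ?p = 0" using GO_D(1)[OF gi] dual_basis_lowest_weight(1)[OF m T] by simp
  ultimately show "\<exists>z\<in>cone. pair (fst z v* c) (snd z) \<noteq> 0"
    by (intro bexI[of _ "fl ?p"]) (auto simp: cone_def)
qed

end

text \<open>Every invertible matrix preserves the zero form, and a letter satisfies both conditions
  between which \<open>SO\<close> distinguishes, on the determinant and on the rank.\<close>

lemma letter_in_zero_form_SO:
  fixes z z' :: "('a::alg_closed_field, 'n::finite) flag"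
  assumes z: "pair (fst z) (snd z) = 0" "pair (fst z') (snd z') = 0" "opposite z z'" "s \<noteq> 0"
  shows "letter z z' s \<in> SO (\<lambda>_. 0)"
proof -
  have "invertible (letter z z' s)" by (simp add: invertible_det_nz det_letter[OF z])
  then show ?thesis using even_rank_letter[OF z] det_letter[OF z] by (simp add: SO_def GO_def)
qed

theorem zariski_dim_word_image_zero_form:
  fixes w :: "('a::alg_closed_field^'n^'n) cword" and e :: "nat \<Rightarrow> 'a^'n"
  assumes K: "subfield_set K" "infinite K" and m: "CARD('n) \<ge> 2"
    and group: "subgroup (SO (\<lambda>_::'a^'n. 0::'a)) GL"
    and T: "weight_basis (SO (\<lambda>_. 0)) T e" and w: "w \<in> words (GO (\<lambda>_. 0)) r" "word_length w \<ge> 1"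
    and small: "tomanov_small (SO (\<lambda>_. 0)) e \<inter> critical_constants w = {}"
  shows "enat (CARD('n) - 1) \<le> zariski_dim (word_image w r (rational_points K (SO (\<lambda>_. 0))))"
proof -
  let ?G = "SO (\<lambda>_::'a^'n. 0::'a)"
  let ?\<Gamma> = "{h \<in> ?G. (\<forall>i j. h $ i $ j \<in> K) \<and> det h = 1}"
  show ?thesis
  proof (rule zariski_dim_word_image_ge[where C = all_flags and \<Gamma> = ?\<Gamma> and E = "GO (\<lambda>_. 0)"])
    show "curve_connected (all_flags :: ('a, 'n) flag set)" by (rule curve_connected_all_flags)
    show "deformable (all_flags :: ('a, 'n) flag set) (CARD('n) - 1)" by (rule deformable_all_flags)
    show "\<exists>z\<in>all_flags. pair (fst z) q \<noteq> 0" if "q \<noteq> 0" for q :: "'a^'n"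
    proof -
      obtain i where i: "q $ i \<noteq> 0" using \<open>q \<noteq> 0\<close> by (auto simp: vec_eq_iff)
      have "(axis i 1, 0) \<in> (all_flags :: ('a, 'n) flag set)" by (simp add: all_flags_def pair_simps axis_eq_0_iff)
      moreover have "pair (axis i 1) q \<noteq> 0" using i by (simp add: pair_commute[of "axis i 1"])
      ultimately show ?thesis by force
    qed
    show "\<exists>z\<in>all_flags. pair q (snd z) \<noteq> 0" if "q \<noteq> 0" for q :: "'a^'n"
    proof -
      obtain i where i: "q $ i \<noteq> 0" using \<open>q \<noteq> 0\<close> by (auto simp: vec_eq_iff)
      have "\<exists>j. j \<noteq> i"
      proof (rule ccontr)
        assume "\<not> ?thesis"
        then have "UNIV = {i}" by auto
        then have "CARD('n) = card {i}" by simp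
        then show False using m by simp
      qed
      then obtain j where "j \<noteq> i" by blast
      then have "(axis j 1, axis i 1) \<in> (all_flags :: ('a, 'n) flag set)"
        by (simp add: all_flags_def axis_eq_0_iff) (simp add: axis_def)
      then show ?thesis using i by force
    qed
    show "pair (fst z) (snd z) = 0" if "z \<in> all_flags" for z :: "('a, 'n) flag" using that by (simp add: all_flags_def)
    show "?\<Gamma> \<subseteq> rational_points K ?G" by (auto simp: rational_points_def)
    show "det g ^ 2 = 1" if "g \<in> ?\<Gamma>" for g using that by simp
    show "letter z z' s \<in> zariski closure_of ?\<Gamma>"
      if z: "z \<in> all_flags" "z' \<in> all_flags" "opposite z z'" "s \<noteq> 0" for z z' :: "('a, 'n) flag" and s
    proof (rule letter_in_closure_of_rational[OF K(2,1)])
      show "letter x x' t \<in> ?\<Gamma>"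
        if "\<And>i. fst x $ i \<in> K" "\<And>i. snd x $ i \<in> K" "\<And>i. fst x' $ i \<in> K" "\<And>i. snd x' $ i \<in> K"
          "t \<in> K" "t \<noteq> 0" "pair (fst x) (snd x) = 0" "pair (fst x') (snd x') = 0" "opposite x x'"
        for x x' :: "('a, 'n) flag" and t
        using letter_in_zero_form_SO[of x x' t] det_letter[of x x' t] subfield_set.letter[OF K(1), of x x' t] that by auto
    qed (use z in \<open>auto simp: all_flags_def\<close>)
    show "w \<in> words (GO (\<lambda>_. 0)) r" "1 \<le> word_length w" "1 \<le> CARD('n) - 1" using w m by auto
    show "invertible c" if "c \<in> GO (\<lambda>_::'a^'n. 0::'a)" for c using that by (simp add: GO_def)
    fix c assume c: "c \<in> critical_constants w"
    have "invertible c"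
    proof -
      obtain j i \<epsilon> where j: "Suc j < length (snd w)" "snd w ! j = (i, \<epsilon>, c)"
        using c unfolding critical_constants_def word_length_def by blast
      then have "(i, \<epsilon>, c) \<in> set (snd w)" using nth_mem[of j "snd w"] by simp
      then show ?thesis using w(1) by (auto simp: words_def GO_def)
    qed
    moreover have "c \<notin> tomanov_small ?G e" using c small by blast
    ultimately obtain g where g: "g \<in> ?G" "dual_basis e CARD('n) (e 1 v* (matrix_inv g ** c ** g)) \<noteq> 0"
      by (auto simp: tomanov_small_def)
    let ?m = "CARD('n)" and ?E = "e ` {1..CARD('n)}"
    have inj: "inj_on e {1..?m}" and ind: "vec.independent ?E" and span: "vec.span ?E = UNIV"
      using T by (auto simp: weight_basis_def)
    have mm: "?m \<in> {1..?m}" "1 \<in> {1..?m}" "1 \<noteq> ?m" using m by auto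
    have "e ?m \<notin> vec.span (?E - {e ?m})" using ind mm(1) unfolding vec.dependent_def by blast
    then obtain q where q: "pair (e ?m) q \<noteq> 0" "\<And>x. x \<in> vec.span (?E - {e ?m}) \<Longrightarrow> pair x q = 0"
      using subspace_separate[OF vec.subspace_span] by metis
    have q0: "pair (e i) q = 0" if i: "i \<in> {1..?m}" "i \<noteq> ?m" for i
    proof (rule q(2), rule vec.span_base)
      have "e i \<noteq> e ?m" using inj_onD[OF inj _ i(1) mm(1)] i(2) by metis
      then show "e i \<in> ?E - {e ?m}" using imageI[OF i(1), of e] by simp
    qed
    \<comment> \<open>The critical flag consists of \<open>e 1\<close> and the functional
      \<open>q\<close> of the last basis vector, both moved by \<open>g\<close>. The functional
      vanishes at the vector because the dimension is at least 2.\<close>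
    let ?p = "e 1 v* matrix_inv g"
    note gi = subgroup_GL_D[OF group g(1)]
    have "pair (e 1 v* (matrix_inv g ** c ** g)) q \<noteq> 0"
      using g(2) dual_basis_eq_pair[OF inj ind span q0 q(1)] by auto
    then have "pair (?p v* c) (g *v q) \<noteq> 0"
      by (simp add: pair_vector_matrix[symmetric] vector_matrix_mul_assoc matrix_mul_assoc)
    moreover have "pair ?p (g *v q) = 0"
      unfolding pair_vector_matrix[symmetric] vector_matrix_mul_assoc gi using q0[OF mm(2,3)] by simp
    ultimately show "\<exists>z\<in>all_flags. pair (fst z v* c) (snd z) \<noteq> 0"
      by (intro bexI[of _ "(?p, g *v q)"]) (auto simp: all_flags_def pair_simps)
  qed
qed

text \<open>The radical of the polar form is invariant, hence the whole space. Then \<open>Q\<close>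
  is additive, so its zero set is an invariant subspace; it contains a nonzero isotropic vector and
  is the whole space as well.\<close>

lemma (in quadratic_form) degenerate_imp_zero:
  assumes group: "subgroup (SO Q) GL" and irred: "acts_irreducibly (SO Q)" and m: "CARD('n) \<ge> 2"
    and u: "u \<noteq> 0" "\<And>v. B u v = 0"
  shows "Q v = 0"
proof -
  have GO: "g \<in> GO Q" if "g \<in> SO Q" for g using that by (simp add: SO_def)
  define R where "R = {x. \<forall>y. B x y = 0}"
  have "vec.subspace R" unfolding R_def by (rule vec.subspaceI) (simp_all add: B_linear)
  moreover have "x v* g \<in> R" if "g \<in> SO Q" "x \<in> R" for g x
  proof -
    have "B (x v* g) y = B x (y v* matrix_inv g)" for y
      using GO_D(2)[OF GO[OF that(1)], of x "y v* matrix_inv g"] subgroup_GL_D(4)[OF group that(1)]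
      by (simp add: vector_matrix_mul_assoc)
    then show ?thesis using that(2) by (simp add: R_def)
  qed
  ultimately have "R = {0} \<or> R = UNIV" using irred unfolding acts_irreducibly_def by blast
  then have "R = UNIV" using u by (auto simp: R_def)
  then have B0: "B x y = 0" for x y by (auto simp: R_def)
  define Z where "Z = {x. Q x = 0}"
  have "vec.subspace Z" unfolding Z_def by (rule vec.subspaceI) (simp_all add: Q_add Q_scale B0)
  moreover have "x v* g \<in> Z" if "g \<in> SO Q" "x \<in> Z" for g x
    using GO_D(1)[OF GO[OF that(1)]] that(2) by (simp add: Z_def)
  ultimately have "Z = {0} \<or> Z = UNIV" using irred unfolding acts_irreducibly_def by blast
  moreover obtain x where "x \<noteq> 0" "Q x = 0" using exists_isotropic[OF m] by metis
  ultimately have "Z = UNIV" by (auto simp: Z_def)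
  then show ?thesis by (auto simp: Z_def)
qed

theorem theorem24:
  fixes K L :: "'a::alg_closed_field set"
    and \<tau> :: "'a topology"
    and Q :: "'a^'n \<Rightarrow> 'a"
    and T :: "('a^'n^'n) set"
    and e :: "nat \<Rightarrow> 'a^'n"
    and r :: nat
    and w :: "('a^'n^'n) cword"
  assumes "local_field L \<tau>" and "algebraic_over L"
    and "subfield K ring_of_type_algebra" and "K \<subseteq> L" and "infinite K"
    and "quadratic_form_over K Q"
    and "quasisimple (SO Q)" and "acts_irreducibly (SO Q)"
    and "maximal_torus (SO Q) T" and "weight_basis (SO Q) T e"
    and "r \<ge> 1" and "w \<in> words (GO Q) r" and "reduced_word w" and "word_length w \<ge> 2"
    and "tomanov_small (SO Q) e \<inter> critical_constants w = {}"
  shows "zariski_dim (word_image w r (rational_points K (SO Q))) \<ge> enat (CARD('n) - 1)"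
proof (cases "CARD('n) = 1")
  case True
  then show ?thesis by (simp add: zero_enat_def[symmetric])
next
  case False
  then have m: "CARD('n) \<ge> 2" using zero_less_card_finite[where 'a = 'n] by linarith
  obtain a where a: "\<And>i j. a i j \<in> K" "\<And>v. Q v = (\<Sum>i\<in>UNIV. \<Sum>j\<in>UNIV. a i j * v $ i * v $ j)"
    using assms(6) unfolding quadratic_form_over_def by blast
  interpret quadratic_form Q a by (rule quadratic_form.intro) (rule a(2))
  have group: "linear_algebraic_group (SO Q)" and conn: "connectedin zariski (SO Q)"
    using assms(7) by (simp_all add: quasisimple_def)
  have K: "subfield_set K" by (rule subfield_imp_subfield_set[OF assms(3)])
  have l: "word_length w \<ge> 1" using assms(14) by simp
  show ?thesis
  proof (cases "\<exists>u. u \<noteq> 0 \<and> (\<forall>v. B u v = 0)")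
    case True
    have "subgroup (SO Q) GL" using group by (simp add: linear_algebraic_group_def)
    then have "Q v = 0" for v using degenerate_imp_zero[OF _ assms(8) m] True by blast
    then have Q: "Q = (\<lambda>_. 0)" by blast
    show ?thesis
      unfolding Q
      by (rule zariski_dim_word_image_zero_form[OF K assms(5) m \<open>subgroup (SO Q) GL\<close>[unfolded Q]
            assms(10)[unfolded Q] assms(12)[unfolded Q] l assms(15)[unfolded Q]])
  next
    case False
    then interpret nondegenerate_form Q a
      using assms(8) group by unfold_locales auto
    show ?thesis
      by (rule zariski_dim_word_image_SO[OF K assms(5) a(1) card_gt_2[OF conn m] assms(10,12) l assms(15)])
  qed
qed

end
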